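(* Let $\lambda,\mu\in\mathbb{Q}$ and let $N\in\mathbb{N}$ be minimal such that $N\lambda,N\mu\in\mathbb{Z}$. Let $\widehat{\mathcal{E}}_{2-a}(z;\tau)$ be the function defined in the context ($a\ge2$ an integer). (1) For $a\ge3$, the function $\tau\mapsto\widehat{\mathcal{E}}_{2-a}(\lambda\tau+\mu;\tau)$ is a harmonic Maass form of weight $2-a$ on $\Gamma(N)$. (2) If $(\lambda,\mu)\notin\mathbb{Z}^2$, the function $\tau\mapsto\widehat{\mathcal{E}}_0(\lambda\tau+\mu;\tau)$ is a harmonic Maass form of weight $0$ on $\Gamma(N)$. (3) For $(\lambda,\mu)\in\mathbb{Z}^2$, the regularized limit $$\tau\mapsto\lim_{z\to0^+}\left(\widehat{\mathcal{E}}_0(z;\tau)+2\log|z|-\log(v)\right)$$ is a sesquiharmonic Maass form of weight $0$ on $\mathrm{SL}_2(\mathbb{Z})$.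
   Context: Write $\tau=u+iv\in\mathbb{H}$ (upper half-plane), $z=x+iy\in\mathbb{C}$, $q=e^{2\pi i\tau}$, $\zeta=e^{2\pi i z}$; $\lfloor\cdot\rfloor$ floor, $\{t\}=t-\lfloor t\rfloor$, $B_n(t)$ the $n$-th Bernoulli polynomial, $\Gamma^*(n,w)=\frac{\Gamma(n,w)}{\Gamma(n)}=e^{-w}\sum_{k=0}^{n-1}\frac{w^k}{k!}$ for integers $n\ge1$; $\Gamma(N)$ is the principal congruence subgroup of level $N$. For $a\ge2$ and $0\le y<v$ (with $z\notin\mathbb{Z}$ if $a=2$): $\mathcal{E}_{2-a}(z;\tau)=\sum_{n\in\mathbb{Z}\setminus\{0\}}\frac{\zeta^n}{n^{a-1}(1-q^n)}$. For $a\ge2$ and $z\in\mathbb{C}$ (with $z\notin\mathbb{Z}\tau+\mathbb{Z}$ if $a=2$): $$\widehat{\mathcal{E}}_{2-a}(z;\tau)=\mathcal{E}_{2-a}\left(z-\left\lfloor\tfrac yv\right\rfloor\tau;\tau\right)-\frac{(-4\pi v)^{a-1}B_a\left(\left\{\frac yv\right\}\right)}{a!}+\mathcal{E}^-_{2-a}(z;\tau),$$ $$\mathcal{E}^-_{2-a}(z;\tau)=\sum_{\substack{m\ge1\\ \ell\ge1+\lfloor y/v\rfloor}}\frac{\Gamma^*\left(a-1,4\pi m\left(\ell-\frac yv\right)v\right)}{m^{a-1}}e^{2\pi i m(z-\ell\tau)}+(-1)^a\sum_{\substack{m\ge1\\ \ell\ge-\lfloor y/v\rfloor}}\frac{\Gamma^*\left(a-1,4\pi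 m\left(\ell+\frac yv\right)v\right)}{m^{a-1}}e^{-2\pi i m(z+\ell\tau)}.$$ For $k\in\mathbb{Z}$ let $\xi_k(f)=-2iv^k\,\overline{\frac{\partial f}{\partial\overline\tau}}$ and $\Delta_k=-\xi_{2-k}\circ\xi_k$. A harmonic Maass form of weight $k$ on $\Gamma\subset\mathrm{SL}_2(\mathbb{Z})$ is a smooth $f:\mathbb{H}\to\mathbb{C}$ such that (i) $f(\gamma\tau)=(c\tau+d)^kf(\tau)$ for all $\gamma=\begin{pmatrix}*&*\\c&d\end{pmatrix}\in\Gamma$; (ii) $\Delta_k(f)=0$; (iii) $f$ has at most linear exponential growth at the cusps of $\Gamma$ (i.e. for each $\begin{pmatrix}*&*\\c&d\end{pmatrix}=\gamma\in\mathrm{SL}_2(\mathbb{Z})$, $(c\tau+d)^{-k}f(\gamma\tau)=O(e^{rv})$ as $v\to\infty$ for some $r>0$). If (ii) is replaced by $\xi_k\circ\Delta_k(f)=0$, $f$ is called a sesquiharmonic Maass form of weight $k$. *)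

theory Defs
  imports
    "HOL-Analysis.Analysis"
    "HOL-Number_Theory.Cong"
    "HOL-Library.Landau_Symbols"
    "HOL-Computational_Algebra.Formal_Power_Series"
begin

section \<open>The completed functions\<close>

text \<open>The normalised upper incomplete Gamma function, for integer first argument \<open>n \<ge> 1\<close>.\<close>

definition upper_Gamma :: "nat \<Rightarrow> real \<Rightarrow> real" where
  "upper_Gamma n w = integral {w..} (\<lambda>t. t ^ (n - 1) * exp (- t))"

definition Gamma_star :: "nat \<Rightarrow> real \<Rightarrow> real" where
  "Gamma_star n w = upper_Gamma n w / Gamma (real n)"

lemma has_integral_upper_Gamma:
  fixes w :: real
  assumes n: "n \<ge> 1" and w: "w \<ge> 0"
  shows "((\<lambda>t. t ^ (n - 1) * exp (- t)) has_integral
           fact (n - 1) * (exp (- w) * (\<Sum>k<n. w ^ k / fact k))) {w..}"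
proof -
  obtain m where m: "n = Suc m" using n by (cases n) auto
  define F where "F = (\<lambda>t::real. - fact m * (exp (- t) * (\<Sum>k<Suc m. t ^ k / fact k)))"
  have sum_deriv: "((\<lambda>t::real. \<Sum>k<Suc j. t ^ k / fact k) has_real_derivative
                    (\<Sum>k<j. t ^ k / fact k)) (at t)" for t j
  proof (induction j)
    case 0
    then show ?case by simp
  next
    case (Suc j)
    have "((\<lambda>t::real. (\<Sum>k<Suc j. t ^ k / fact k) + t ^ Suc j / fact (Suc j)) has_real_derivative
            (\<Sum>k<j. t ^ k / fact k) + t ^ j / fact j) (at t)"
      by (rule DERIV_add[OF Suc.IH])
         (rule derivative_eq_intros refl | simp add: field_simps del: of_nat_Suc)+
    then show ?case by simp
  qed
  have deriv: "(F has_real_derivative t ^ m * exp (- t)) (at t)" for t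
    unfolding F_def
    by (rule derivative_eq_intros sum_deriv refl | simp add: field_simps)+
  have lim: "(F \<longlongrightarrow> 0) at_top"
  proof -
    have "((\<lambda>t::real. \<Sum>k<Suc m. (t ^ k / exp t) / fact k) \<longlongrightarrow> (\<Sum>k<Suc m. 0 / fact k)) at_top"
      by (intro tendsto_intros tendsto_power_div_exp_0) auto
    then have "((\<lambda>t::real. - fact m * (\<Sum>k<Suc m. (t ^ k / exp t) / fact k)) \<longlongrightarrow> - fact m * 0) at_top"
      by (intro tendsto_mult tendsto_const) simp
    also have "(\<lambda>t::real. - fact m * (\<Sum>k<Suc m. (t ^ k / exp t) / fact k)) = F"
      unfolding F_def sum_distrib_left by (simp add: exp_minus field_simps)
    finally show ?thesis by simp
  qed
  have int: "((\<lambda>t. t ^ m * exp (- t)) has_integral (F c - F w)) {w..c}" if "c \<ge> w" for c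
    by (rule fundamental_theorem_of_calculus[OF that])
       (use deriv in \<open>auto simp: has_real_derivative_iff_has_vector_derivative
          intro: has_vector_derivative_at_within\<close>)
  have "((\<lambda>t. t ^ m * exp (- t)) has_integral (0 - F w)) {w..}"
  proof (rule has_integral_to_inf)
    show "(\<lambda>t. t ^ m * exp (- t)) integrable_on {w..c}" for c
      using int[of c] by (cases "c \<ge> w") auto
    show "0 \<le> t ^ m * exp (- t)" if "t \<ge> w" for t
      using that w by simp
    have "((\<lambda>c. F c - F w) \<longlongrightarrow> 0 - F w) at_top"
      by (intro tendsto_diff lim tendsto_const)
    moreover have "eventually (\<lambda>c. F c - F w = integral {w..c} (\<lambda>t. t ^ m * exp (- t))) at_top"
      using eventually_ge_at_top[of w] by eventually_elim (simp add: integral_unique[OF int])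
    ultimately show "((\<lambda>c. integral {w..c} (\<lambda>t. t ^ m * exp (- t))) \<longlongrightarrow> 0 - F w) at_top"
      by (rule Lim_transform_eventually)
  qed
  then show ?thesis by (simp add: F_def m)
qed

lemma Gamma_star_conv_sum:
  assumes "n \<ge> 1" "w \<ge> 0"
  shows "Gamma_star n w = exp (- w) * (\<Sum>k<n. w ^ k / fact k)"
proof -
  have "Gamma (real n) = fact (n - 1)"
    using Gamma_fact[of "n - 1", where 'a = real] assms by (simp add: of_nat_diff)
  then show ?thesis
    using integral_unique[OF has_integral_upper_Gamma[OF assms]]
    by (simp add: Gamma_star_def upper_Gamma_def)
qed

text \<open>Bernoulli polynomials via \<open>X exp(tX) / (exp(X) - 1) = (\<Sum>n. B\<^sub>n(t) X^n / n!)\<close>.\<close>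

definition bernoulli_poly :: "nat \<Rightarrow> real \<Rightarrow> real" where
  "bernoulli_poly n t = fact n * fps_nth (fps_X * fps_exp t / (fps_exp 1 - 1)) n"

text \<open>
  In the three functions below the natural number \<open>a \<ge> 2\<close> is the parameter, so that
  \<open>Ecal a\<close>, \<open>Ecal_minus a\<close>, \<open>Ecal_hat a\<close> stand for the functions with subscript \<open>2 - a\<close>.

  For \<open>a = 2\<close> and \<open>y = 0\<close>, the sum over positive \<open>n\<close> converges only conditionally; the sum over
  the nonzero integers is therefore split into two series ordered by \<open>\<bar>n\<bar>\<close>.
\<close>

definition Ecal_term :: "nat \<Rightarrow> complex \<Rightarrow> complex \<Rightarrow> int \<Rightarrow> complex" where
  "Ecal_term a z \<tau> n =
     exp (2 * pi * \<i> * z) powi n /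
       (of_int n ^ (a - 1) * (1 - exp (2 * pi * \<i> * \<tau>) powi n))"

definition Ecal :: "nat \<Rightarrow> complex \<Rightarrow> complex \<Rightarrow> complex" where
  "Ecal a z \<tau> = (\<Sum>n. Ecal_term a z \<tau> (int (Suc n))) + (\<Sum>n. Ecal_term a z \<tau> (- int (Suc n)))"

text \<open>
  The outer series is over \<open>l\<close> (starting at \<open>1 + \<lfloor>y/v\<rfloor>\<close> and \<open>-\<lfloor>y/v\<rfloor>\<close>, respectively), the inner
  one over \<open>m \<ge> 1\<close>. This matters only if \<open>a = 2\<close> and \<open>y/v\<close> is an integer: then
  the inner series for \<open>l = -y/v\<close> in the second sum converges only conditionally.
\<close>

definition Ecal_minus :: "nat \<Rightarrow> complex \<Rightarrow> complex \<Rightarrow> complex" where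
  "Ecal_minus a z \<tau> =
    (let v = Im \<tau>; t = Im z / v in
       (\<Sum>j::nat. let l = 1 + \<lfloor>t\<rfloor> + int j in
          \<Sum>i::nat. let m = real (Suc i) in
            of_real (Gamma_star (a - 1) (4 * pi * m * (of_int l - t) * v) / m ^ (a - 1)) *
              exp (2 * pi * \<i> * of_real m * (z - of_int l * \<tau>)))
     + (-1) ^ a *
       (\<Sum>j::nat. let l = - \<lfloor>t\<rfloor> + int j in
          \<Sum>i::nat. let m = real (Suc i) in
            of_real (Gamma_star (a - 1) (4 * pi * m * (of_int l + t) * v) / m ^ (a - 1)) *
              exp (- 2 * pi * \<i> * of_real m * (z + of_int l * \<tau>))))"

definition Ecal_hat :: "nat \<Rightarrow> complex \<Rightarrow> complex \<Rightarrow> complex" where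
  "Ecal_hat a z \<tau> =
    (let v = Im \<tau>; t = Im z / v in
       Ecal a (z - of_int \<lfloor>t\<rfloor> * \<tau>) \<tau>
       - of_real ((- 4 * pi * v) ^ (a - 1) * bernoulli_poly a (frac t) / fact a)
       + Ecal_minus a z \<tau>)"


section \<open>Harmonic and sesquiharmonic Maass forms\<close>

definition upper_half_plane :: "complex set" where
  "upper_half_plane = {\<tau>. Im \<tau> > 0}"

definition SL2Z :: "(int ^ 2 ^ 2) set" where
  "SL2Z = {A. det A = 1}"

definition Gamma_congruence :: "nat \<Rightarrow> (int ^ 2 ^ 2) set" where
  "Gamma_congruence N = {A \<in> SL2Z. \<forall>i j. [A $ i $ j = mat 1 $ i $ j] (mod int N)}"

definition moebius :: "int ^ 2 ^ 2 \<Rightarrow> complex \<Rightarrow> complex" where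
  "moebius A \<tau> = (of_int (A $ 1 $ 1) * \<tau> + of_int (A $ 1 $ 2)) /
                 (of_int (A $ 2 $ 1) * \<tau> + of_int (A $ 2 $ 2))"

definition automorphy :: "int ^ 2 ^ 2 \<Rightarrow> complex \<Rightarrow> complex" where
  "automorphy A \<tau> = of_int (A $ 2 $ 1) * \<tau> + of_int (A $ 2 $ 2)"

text \<open>Real differentiability of all orders; intended for open \<open>S\<close>.\<close>

fun Ck_on :: "nat \<Rightarrow> ('a::real_normed_vector \<Rightarrow> 'b::real_normed_vector) \<Rightarrow> 'a set \<Rightarrow> bool" where
  "Ck_on 0 f S \<longleftrightarrow> continuous_on S f"
| "Ck_on (Suc k) f S \<longleftrightarrow> (\<forall>x\<in>S. f differentiable (at x)) \<and>
     (\<forall>h. Ck_on k (\<lambda>x. frechet_derivative f (at x) h) S)"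

definition smooth_on :: "('a::real_normed_vector \<Rightarrow> 'b::real_normed_vector) \<Rightarrow> 'a set \<Rightarrow> bool" where
  "smooth_on f S \<longleftrightarrow> (\<forall>k. Ck_on k f S)"

text \<open>The Wirtinger derivative \<open>\<partial>f/\<partial>\<tau>\<^sup>- = (\<partial>f/\<partial>u + i \<partial>f/\<partial>v) / 2\<close>.\<close>

definition wirtinger_bar :: "(complex \<Rightarrow> complex) \<Rightarrow> complex \<Rightarrow> complex" where
  "wirtinger_bar f \<tau> =
     (frechet_derivative f (at \<tau>) 1 + \<i> * frechet_derivative f (at \<tau>) \<i>) / 2"

definition xi_op :: "int \<Rightarrow> (complex \<Rightarrow> complex) \<Rightarrow> complex \<Rightarrow> complex" where
  "xi_op k f \<tau> = - 2 * \<i> * of_real (Im \<tau> powi k) * cnj (wirtinger_bar f \<tau>)"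

definition Delta_op :: "int \<Rightarrow> (complex \<Rightarrow> complex) \<Rightarrow> complex \<Rightarrow> complex" where
  "Delta_op k f \<tau> = - xi_op (2 - k) (xi_op k f) \<tau>"

definition modular_invariant :: "int \<Rightarrow> (int ^ 2 ^ 2) set \<Rightarrow> (complex \<Rightarrow> complex) \<Rightarrow> bool" where
  "modular_invariant k \<Gamma> f \<longleftrightarrow>
     (\<forall>A\<in>\<Gamma>. \<forall>\<tau>\<in>upper_half_plane. f (moebius A \<tau>) = automorphy A \<tau> powi k * f \<tau>)"

text \<open>
  The filter \<^term>\<open>filtercomap Im at_top\<close> expresses \<open>v \<rightarrow> \<infinity>\<close> uniformly in the real part of \<open>\<tau>\<close>.
\<close>

definition linear_exponential_growth :: "int \<Rightarrow> (complex \<Rightarrow> complex) \<Rightarrow> bool" where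
  "linear_exponential_growth k f \<longleftrightarrow>
     (\<forall>A\<in>SL2Z. \<exists>r>0. (\<lambda>\<tau>. automorphy A \<tau> powi (- k) * f (moebius A \<tau>))
        \<in> O[filtercomap Im at_top](\<lambda>\<tau>. of_real (exp (r * Im \<tau>))))"

definition harmonic_Maass_form :: "int \<Rightarrow> (int ^ 2 ^ 2) set \<Rightarrow> (complex \<Rightarrow> complex) \<Rightarrow> bool" where
  "harmonic_Maass_form k \<Gamma> f \<longleftrightarrow>
     smooth_on f upper_half_plane \<and>
     modular_invariant k \<Gamma> f \<and>
     (\<forall>\<tau>\<in>upper_half_plane. Delta_op k f \<tau> = 0) \<and>
     linear_exponential_growth k f"

definition sesquiharmonic_Maass_form :: "int \<Rightarrow> (int ^ 2 ^ 2) set \<Rightarrow> (complex \<Rightarrow> complex) \<Rightarrow> bool" where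
  "sesquiharmonic_Maass_form k \<Gamma> f \<longleftrightarrow>
     smooth_on f upper_half_plane \<and>
     modular_invariant k \<Gamma> f \<and>
     (\<forall>\<tau>\<in>upper_half_plane. xi_op k (Delta_op k f) \<tau> = 0) \<and>
     linear_exponential_growth k f"

end

(*
  For a >= 3, the completed function equals, up to the factor - (4 pi v)^(a-1) / (2 pi i)^a, the
  absolutely convergent lattice sum over (m,d) /= (0,0) of
    e(m s + d t) / ((m tau - d) (m conj(tau) - d)^(a-1)),     z = t tau + s, e(x) = exp(2 pi i x);
  this is Poisson summation in every row m /= 0 and the Fourier series of the Bernoulli polynomial for
  m = 0. Reindexing the lattice gives the transformation law under SL_2(Z).

  For a = 2 the sum is only conditionally convergent, but d/dz maps the function for a = 3 to 2 pi i
  times the function for a = 2. Differentiating the law for a = 3 gives the one for a = 2 for generic z,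
  and by continuity for all z off the lattice; its limit at z = 0 is the invariance in part (3).

  Harmonicity and growth are read off the expansion for fixed (t,s): it is the sum of a holomorphic
  exponential series, of terms v^k conj(h_k) with h_k holomorphic, whose derivatives with respect to
  conj(tau) telescope to v^(a-2) conj(h), and of a multiple of v^(a-1).
*)
theory Submission
  imports "HOL-Complex_Analysis.Complex_Analysis" Defs
begin

text \<open>\<open>Gamma_star\<close> is what makes the Poisson step work. For fixed m the terms of
  all rows sample one function of the signed distance x to the axis: e(m x \<tau>) for x > 0, and
  for x < 0 the function e(m x cnj \<tau>) times the Taylor polynomial of degree a - 2 of exp(- 4 pi
  m x v). As e(m x \<tau>) = e(m x cnj \<tau>) exp(- 4 pi m x v), the two halves agree at 0 up to
  O(x^(a-1)), and the Fourier coefficients decay like |d|^(-a).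

  The expansion changes its form where Im z / Im \<tau> passes an integer. Differentiation in z is
  therefore done off these lines, and a limit has to reach the remaining points.

  Growth is required at every cusp. The law holds for all of SL_2(Z) and all admissible real (t,s),
  so each cusp leads back to infinity with another pair (t,s); only the invariance uses the level N.

  In part (3), replacing z by z / (c \<tau> + d) changes 2 log|z| by exactly the amount by which log
  v changes; this is why log v is subtracted.\<close>

definition ee :: "complex \<Rightarrow> complex" where
  "ee z = exp (2 * of_real pi * \<i> * z)"

lemma ee_0 [simp]: "ee 0 = 1"
  by (simp add: ee_def)

lemma ee_nonzero [simp]: "ee z \<noteq> 0"
  by (simp add: ee_def)

lemma ee_add: "ee (w + z) = ee w * ee z"
  by (simp add: ee_def exp_add ring_distribs)

lemma ee_diff: "ee (w - z) = ee w / ee z"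
  by (simp add: ee_def exp_diff ring_distribs)

lemma ee_minus: "ee (- z) = inverse (ee z)"
  by (simp add: ee_def exp_minus)

lemma ee_of_int [simp]: "ee (of_int n) = 1"
proof -
  have "ee (of_int n) = exp (of_int (2 * n) * of_real pi * \<i>)"
    by (simp add: ee_def mult_ac)
  then show ?thesis
    by (simp add: exp_eq_1)
qed

lemma ee_power: "ee z ^ n = ee (of_nat n * z)"
  by (simp add: ee_def exp_of_nat_mult [symmetric] mult_ac)

lemma norm_ee: "norm (ee z) = exp (- 2 * pi * Im z)"
  by (simp add: ee_def)

lemma cnj_ee: "cnj (ee z) = ee (- cnj z)"
  by (simp add: ee_def exp_cnj)

lemma has_field_derivative_ee [derivative_intros]:
  "(f has_field_derivative f') (at x within A) \<Longrightarrow>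
   ((\<lambda>x. ee (f x)) has_field_derivative (2 * of_real pi * \<i> * f' * ee (f x))) (at x within A)"
  unfolding ee_def by (auto intro!: derivative_eq_intros)

lemma has_vector_derivative_ee:
  "((\<lambda>t. ee (c * of_real t)) has_vector_derivative (2 * of_real pi * \<i> * c * ee (c * of_real t))) (at t within A)"
  unfolding ee_def
  by (rule derivative_eq_intros has_vector_derivative_real_field refl | simp)+

lemma continuous_on_ee [continuous_intros]:
  "continuous_on A f \<Longrightarrow> continuous_on A (\<lambda>x. ee (f x))"
  unfolding ee_def by (intro continuous_intros)

lemma ee_eq_1_iff: "ee z = 1 \<longleftrightarrow> z \<in> \<int>"
proof
  assume "ee z = 1"
  then obtain n :: int where n: "Re (2 * of_real pi * \<i> * z) = 0" "Im (2 * of_real pi * \<i> * z) = of_int (2 * n) * pi"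
    by (auto simp: ee_def exp_eq_1)
  then have "z = of_int n" by (auto simp: complex_eq_iff)
  then show "z \<in> \<int>" by simp
qed (auto elim!: Ints_cases)

section \<open>Fourier series\<close>

text \<open>Generated by monomials and sums only, so that closure under products and orthogonality
  to a function are both rule inductions, without finite supports to keep track of.\<close>

inductive trig_poly :: "(real \<Rightarrow> complex) \<Rightarrow> bool" where
  monom: "trig_poly (\<lambda>t. c * ee (of_int k * of_real t))"
| add: "trig_poly f \<Longrightarrow> trig_poly g \<Longrightarrow> trig_poly (\<lambda>t. f t + g t)"

lemma trig_poly_mult:
  assumes "trig_poly f" "trig_poly g"
  shows "trig_poly (\<lambda>t. f t * g t)"
  using assms(1)
proof induction
  case (monom c k)
  show ?case using assms(2)
  proof induction
    case (monom c' k')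
    have "(\<lambda>t. c * ee (of_int k * of_real t) * (c' * ee (of_int k' * of_real t))) =
          (\<lambda>t. c * c' * ee (of_int (k + k') * of_real t))"
      by (auto simp: ee_add ring_distribs)
    then show ?case using trig_poly.monom by metis
  next
    case (add f g)
    then show ?case using trig_poly.add by (simp add: ring_distribs)
  qed
next
  case (add f g)
  then show ?case using trig_poly.add by (simp add: ring_distribs)
qed

lemma trig_poly_const: "trig_poly (\<lambda>t. c)"
  using trig_poly.monom[of c 0] by simp

lemma trig_poly_cos_sin:
  "trig_poly (\<lambda>t. of_real (Re (ee (of_real t))))" "trig_poly (\<lambda>t. of_real (Im (ee (of_real t))))"
proof -
  have "(\<lambda>t. of_real (Re (ee (of_real t)))) =
        (\<lambda>t. 1 / 2 * ee (of_int 1 * of_real t) + 1 / 2 * ee (of_int (-1) * of_real t))"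
    using complex_add_cnj[of "ee (of_real _)"] by (auto simp: fun_eq_iff cnj_ee field_simps)
  then show "trig_poly (\<lambda>t. of_real (Re (ee (of_real t))))"
    by (simp only:) (intro trig_poly.intros)
  have "(\<lambda>t. of_real (Im (ee (of_real t)))) =
        (\<lambda>t. 1 / (2 * \<i>) * ee (of_int 1 * of_real t) + (- 1 / (2 * \<i>)) * ee (of_int (-1) * of_real t))"
    using complex_diff_cnj[of "ee (of_real _)"] by (auto simp: fun_eq_iff cnj_ee field_simps)
  then show "trig_poly (\<lambda>t. of_real (Im (ee (of_real t))))"
    by (simp only:) (intro trig_poly.intros)
qed

text \<open>A real-linear functional on the complex plane is a combination of Re and Im, and on the
  unit circle these are combinations of e(t) and e(-t). Sums and products then stay within
  trigonometric polynomials.\<close>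

lemma trig_poly_real_polynomial:
  assumes "real_polynomial_function r"
  shows "trig_poly (\<lambda>t. of_real (r (ee (of_real t))))"
  using assms
proof induction
  case (linear f)
  have "f z = Re z * f 1 + Im z * f \<i>" for z
  proof -
    have "f z = f (Re z *\<^sub>R 1 + Im z *\<^sub>R \<i>)"
      by (rule arg_cong[of _ _ f]) (auto simp: complex_eq_iff)
    also have "\<dots> = Re z * f 1 + Im z * f \<i>"
      using linear by (simp add: bounded_linear.linear linear_add linear_scale)
    finally show ?thesis .
  qed
  then have "(\<lambda>t. complex_of_real (f (ee (of_real t)))) =
     (\<lambda>t. of_real (Re (ee (of_real t))) * of_real (f 1) + of_real (Im (ee (of_real t))) * of_real (f \<i>))"
    by (metis of_real_add of_real_mult)
  then show ?case
    by (simp only:) (intro trig_poly.add trig_poly_mult trig_poly_cos_sin trig_poly_const)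
next
  case (const c)
  show ?case by (rule trig_poly_const)
next
  case (add f g)
  then show ?case using trig_poly.add by simp
next
  case (mult f g)
  then show ?case using trig_poly_mult by simp
qed

lemma trig_poly_polynomial:
  assumes "polynomial_function (q :: complex \<Rightarrow> complex)"
  shows "trig_poly (\<lambda>t. q (ee (of_real t)))"
proof -
  have "real_polynomial_function (\<lambda>z. Re (q z))" "real_polynomial_function (\<lambda>z. Im (q z))"
    using assms by (auto simp: polynomial_function_def o_def bounded_linear_Re bounded_linear_Im)
  from this[THEN trig_poly_real_polynomial]
  have "trig_poly (\<lambda>t. of_real (Re (q (ee (of_real t)))) + \<i> * of_real (Im (q (ee (of_real t)))))"
    by (intro trig_poly.add trig_poly_mult trig_poly_const)
  then show ?thesis by (simp flip: complex_eq)
qed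

lemma ee_real_eq_iff:
  fixes s t :: real
  assumes "s \<in> {0..1}" "t \<in> {0..1}" "ee (of_real s) = ee (of_real t)" "s \<noteq> t"
  shows "s = 0 \<and> t = 1 \<or> s = 1 \<and> t = 0"
proof -
  have "ee (of_real (s - t)) = 1"
    using assms(3) by (simp add: ee_diff)
  then have "complex_of_real (s - t) \<in> \<int>"
    by (subst (asm) ee_eq_1_iff)
  then obtain k :: int where "complex_of_real (s - t) = of_int k"
    by (elim Ints_cases)
  then have k: "s - t = of_int k"
    by (metis of_real_eq_iff of_real_of_int_eq)
  then have "\<bar>of_int k :: real\<bar> \<le> 1" "k \<noteq> 0" using assms(1,2,4) by auto
  then have "k = 1 \<or> k = -1" by linarith
  then show ?thesis using k assms(1,2) by auto
qed

text \<open>A function with equal end values factors through the unit circle, where polynomials in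
  Re and Im approximate it uniformly by Stone-Weierstrass; pulled back to the interval these are
  trigonometric polynomials.\<close>

lemma trig_approx:
  fixes f :: "real \<Rightarrow> complex"
  assumes cont: "continuous_on {0..1} f" and per: "f 0 = f 1" and "e > 0"
  obtains q where "trig_poly q" "\<And>t. t \<in> {0..1} \<Longrightarrow> norm (f t - q t) < e"
proof -
  define p where "p = (\<lambda>t::real. ee (of_real t))"
  \<comment> \<open>The choice of the preimage is harmless: the only ambiguity is between 0 and 1,
    where \<open>f\<close> takes the same value.\<close>
  define g where "g = (\<lambda>w. f (SOME t. t \<in> {0..1} \<and> p t = w))"
  have gp: "g (p t) = f t" if "t \<in> {0..1}" for t
  proof -
    define s where "s = (SOME s. s \<in> {0..1} \<and> p s = p t)"
    have "s \<in> {0..1} \<and> p s = p t"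
      unfolding s_def by (rule someI[of _ t]) (use that in auto)
    then have "f s = f t"
      using ee_real_eq_iff[of s t] that per unfolding p_def by (cases "s = t") auto
    then show ?thesis by (simp add: g_def s_def)
  qed
  have contp: "continuous_on {0..1} p"
    unfolding p_def by (intro continuous_intros)
  define K where "K = p ` {0..1}"
  have K: "compact K"
    unfolding K_def by (intro compact_continuous_image contp) auto
  \<comment> \<open>Continuity of the descended function, by preimages of closed sets: such a
    preimage is the image under \<open>p\<close> of a compact set.\<close>
  have "closed (g -` C \<inter> K)" if "closed C" for C
  proof -
    have "g -` C \<inter> K = p ` (f -` C \<inter> {0..1})"
      unfolding K_def using gp by (auto simp: image_iff) 
    moreover have "closed (f -` C \<inter> {0..1})"
      using cont that continuous_on_closed_vimage[of "{0..1}" f] by auto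
    then have "compact (f -` C \<inter> {0..1})"
      unfolding compact_eq_bounded_closed by (auto intro: bounded_subset[of "{0..1}"])
    then have "compact (p ` (f -` C \<inter> {0..1}))"
      by (intro compact_continuous_image continuous_on_subset[OF contp]) auto
    ultimately show ?thesis by (simp add: compact_imp_closed)
  qed
  then have "continuous_on K g"
    using continuous_on_closed_vimage[OF compact_imp_closed[OF K]] by blast
  from Stone_Weierstrass_polynomial_function[OF K this \<open>e > 0\<close>]
  obtain q where q: "polynomial_function q" "\<And>w. w \<in> K \<Longrightarrow> norm (g w - q w) < e" by auto
  show ?thesis
    by (rule that[OF trig_poly_polynomial[OF q(1)]]) (use q(2) gp in \<open>force simp: K_def p_def\<close>)
qed

lemma trig_poly_continuous: "trig_poly q \<Longrightarrow> continuous_on A q"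
  by (induction rule: trig_poly.induct) (auto intro!: continuous_intros)

text \<open>As \<open>f\<close> is orthogonal to every trigonometric polynomial q, the integral of
  |f|^2 equals that of f (cnj f - q). Choosing q within e of cnj f bounds it by e times the integral
  of |f|, for every e > 0.\<close>

lemma fourier_unique:
  fixes f :: "real \<Rightarrow> complex"
  assumes cont: "continuous_on {0..1} f" and per: "f 0 = f 1"
    and zero: "\<And>d::int. integral {0..1} (\<lambda>t. f t * ee (- of_int d * of_real t)) = 0"
    and t: "t \<in> {0..1}"
  shows "f t = 0"
proof -
  note [continuous_intros] = cont
  have orth: "integral {0..1} (\<lambda>t. f t * q t) = 0" if "trig_poly q" for q
    using that
  proof induction
    case (monom c k)
    have "integral {0..1} (\<lambda>t. f t * (c * ee (of_int k * of_real t))) =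
          integral {0..1} (\<lambda>t. c * (f t * ee (- of_int (- k) * of_real t)))"
      by (intro integral_cong) auto
    also have "\<dots> = c * 0"
      by (subst integral_mult_right) (use zero[of "- k"] in auto)
    finally show ?case by simp
  next
    case (add q r)
    note [continuous_intros] = add.hyps[THEN trig_poly_continuous]
    have "integral {0..1} (\<lambda>t. f t * q t + f t * r t) =
          integral {0..1} (\<lambda>t. f t * q t) + integral {0..1} (\<lambda>t. f t * r t)"
      by (rule integral_add) (intro integrable_continuous_interval continuous_intros)+
    also have "\<dots> = 0" using add.IH by simp
    finally have "integral {0..1} (\<lambda>t. f t * q t + f t * r t) = 0" .
    then show ?case by (simp add: ring_distribs)
  qed
  define I where "I = integral {0..1} (\<lambda>t. (norm (f t))\<^sup>2)"
  define J where "J = integral {0..1} (\<lambda>t. norm (f t))"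
  have J: "J \<ge> 0" unfolding J_def by (intro integral_nonneg integrable_continuous_interval continuous_intros) auto
  have le: "norm (of_real I :: complex) \<le> e * J" if e: "e > 0" for e
  proof -
    have "continuous_on {0..1} (\<lambda>t. cnj (f t))" "cnj (f 0) = cnj (f 1)"
      using per by (auto intro!: continuous_intros)
    from trig_approx[OF this e] obtain q where q: "trig_poly q" "\<And>t. t \<in> {0..1} \<Longrightarrow> norm (cnj (f t) - q t) < e"
      by blast
    note [continuous_intros] = trig_poly_continuous[OF q(1)]
    have "((\<lambda>t. (norm (f t))\<^sup>2) has_integral I) {0..1}"
      unfolding I_def by (intro integrable_integral integrable_continuous_interval continuous_intros)
    then have "((\<lambda>t. complex_of_real ((norm (f t))\<^sup>2)) has_integral of_real I) {0..1}"
      by (rule has_integral_of_real)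
    then have "of_real I = integral {0..1} (\<lambda>t. complex_of_real ((norm (f t))\<^sup>2))"
      by (simp add: integral_unique)
    also have "\<dots> = integral {0..1} (\<lambda>t. complex_of_real ((norm (f t))\<^sup>2)) - integral {0..1} (\<lambda>t. f t * q t)"
      by (simp add: orth[OF q(1)])
    also have "\<dots> = integral {0..1} (\<lambda>t. complex_of_real ((norm (f t))\<^sup>2) - f t * q t)"
      by (rule integral_diff [symmetric]) (intro integrable_continuous_interval continuous_intros)+
    also have "\<dots> = integral {0..1} (\<lambda>t. f t * (cnj (f t) - q t))"
      by (intro integral_cong) (auto simp: complex_norm_square ring_distribs simp del: of_real_power)
    also have "norm \<dots> \<le> integral {0..1} (\<lambda>t. e * norm (f t))"
    proof (rule integral_norm_bound_integral)
      show "norm (f t * (cnj (f t) - q t)) \<le> e * norm (f t)" if "t \<in> {0..1}" for t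
        using q(2)[OF that] by (auto simp: norm_mult mult.commute[of e] intro!: mult_left_mono)
    qed (intro integrable_continuous_interval continuous_intros)+
    also have "\<dots> = e * J" by (simp add: J_def)
    finally show ?thesis .
  qed
  have "I = 0"
  proof (rule ccontr)
    assume "I \<noteq> 0"
    then have pos: "\<bar>I\<bar> > 0" by simp
    \<comment> \<open>This value of e makes the bound at most half of |I|; adding 1 to
      \<open>J\<close> keeps the denominator positive.\<close>
    with le[of "\<bar>I\<bar> / (2 * (J + 1))"] J have "\<bar>I\<bar> \<le> \<bar>I\<bar> / (2 * (J + 1)) * J" by auto
    also have "\<dots> \<le> \<bar>I\<bar> * (J / (2 * (J + 1)))" by simp
    also have "\<dots> < \<bar>I\<bar> * 1" using J pos by (intro mult_strict_left_mono) (auto simp: field_simps)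
    finally show False by simp
  qed
  then have "(norm (f t))\<^sup>2 = 0"
    using integral_eq_0_iff[of 0 1 "\<lambda>t. (norm (f t))\<^sup>2", OF continuous_on_power[OF continuous_on_norm[OF cont]]] t
    unfolding I_def by (metis zero_le_power2 zero_less_one)
  then show ?thesis by simp
qed

lemma integral_ee_int:
  "integral {0..1} (\<lambda>t. ee (of_int d * of_real t)) = (if d = 0 then 1 else 0)"
proof (cases "d = 0")
  case False
  have "((\<lambda>t. ee (of_int d * of_real t)) has_integral
          ee (of_int d * of_real 1) / (2 * of_real pi * \<i> * of_int d) - ee (of_int d * of_real 0) / (2 * of_real pi * \<i> * of_int d)) {0..1}"
    by (rule fundamental_theorem_of_calculus)
       (use False in \<open>auto intro!: derivative_eq_intros has_vector_derivative_ee\<close>)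
  then show ?thesis using False by (simp add: integral_unique)
qed auto

text \<open>Summable coefficients make the series converge uniformly to a continuous function with
  the same Fourier coefficients as \<open>f\<close>; the difference vanishes by uniqueness.\<close>

lemma fourier_series:
  fixes f :: "real \<Rightarrow> complex" and c :: "int \<Rightarrow> complex"
  assumes cont: "continuous_on {0..1} f" and per: "f 0 = f 1"
    and coeff: "\<And>d::int. integral {0..1} (\<lambda>t. f t * ee (- of_int d * of_real t)) = c d"
    and summ: "(\<lambda>d. norm (c d)) summable_on UNIV"
    and t: "t \<in> {0..1}"
  shows "((\<lambda>d. c d * ee (of_int d * of_real t)) has_sum f t) UNIV"
proof -
  have nrm: "norm (c d * ee (of_int d * of_real t)) \<le> norm (c d)" for d and t :: real
    by (simp add: norm_mult norm_ee)
  define S where "S = (\<lambda>t::real. \<Sum>\<^sub>\<infinity>d. c d * ee (of_int d * of_real t))"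
  have ul: "uniform_limit {0..1} (\<lambda>X t. \<Sum>d\<in>X. c d * ee (of_int d * of_real t)) S (finite_subsets_at_top UNIV)"
    unfolding S_def by (rule Weierstrass_m_test_general[OF nrm summ])
  have contS: "continuous_on {0..1} S"
    by (rule uniform_limit_theorem[OF _ ul]) (auto intro!: always_eventually continuous_intros)
  note [continuous_intros] = cont contS
  have coeffS: "integral {0..1} (\<lambda>t. S t * ee (- of_int k * of_real t)) = c k" for k
  proof -
    have "uniform_limit {0..1} (\<lambda>X t. (\<Sum>d\<in>X. c d * ee (of_int d * of_real t)) * ee (- of_int k * of_real t))
            (\<lambda>t. S t * ee (- of_int k * of_real t)) (finite_subsets_at_top UNIV)"
    proof (rule uniform_lim_mult[OF ul uniform_limit_const])
      show "bounded (S ` {0..1})"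
        by (intro compact_imp_bounded compact_continuous_image contS) auto
      show "bounded ((\<lambda>t. ee (- of_int k * of_real t)) ` {0..1})"
        by (intro compact_imp_bounded compact_continuous_image continuous_intros) auto
    qed
    then obtain I J where IJ: "\<And>X. ((\<lambda>t. (\<Sum>d\<in>X. c d * ee (of_int d * of_real t)) * ee (- of_int k * of_real t)) has_integral I X) {0..1}"
      "((\<lambda>t. S t * ee (- of_int k * of_real t)) has_integral J) {0..1}" "(I \<longlongrightarrow> J) (finite_subsets_at_top UNIV)"
      by (rule uniform_limit_integral) (auto intro!: continuous_intros)
    have I: "I X = (if k \<in> X then c k else 0)" if "finite X" for X
    proof -
      have "I X = integral {0..1} (\<lambda>t. (\<Sum>d\<in>X. c d * ee (of_int d * of_real t)) * ee (- of_int k * of_real t))"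
        by (rule integral_unique[OF IJ(1), symmetric])
      also have "\<dots> = integral {0..1} (\<lambda>t. \<Sum>d\<in>X. c d * ee (of_int (d - k) * of_real t))"
        by (intro integral_cong) (simp add: sum_distrib_right ee_diff ring_distribs ee_minus divide_inverse mult.assoc)
      also have "\<dots> = (\<Sum>d\<in>X. c d * (if d - k = 0 then 1 else 0))"
        by (subst integral_sum)
           (use that in \<open>auto intro!: integrable_continuous_interval continuous_intros sum.cong simp del: of_int_diff simp: integral_ee_int\<close>)
      also have "\<dots> = (\<Sum>d\<in>X. if d = k then c k else 0)"
        by (intro sum.cong) auto
      also have "\<dots> = (if k \<in> X then c k else 0)"
        using that by simp
      finally show ?thesis .
    qed
    have "eventually (\<lambda>X. finite X \<and> {k} \<subseteq> X) (finite_subsets_at_top UNIV)"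
      by (intro eventually_finite_subsets_at_top_weakI[THEN eventually_conj] eventually_finite_subsets_at_top_finite
            eventually_finite_subsets_at_top[THEN iffD2]) auto
    then have "eventually (\<lambda>X. I X = c k) (finite_subsets_at_top UNIV)"
      by eventually_elim (simp add: I)
    then have "(I \<longlongrightarrow> c k) (finite_subsets_at_top UNIV)"
      by (rule tendsto_eventually)
    then have "J = c k" using IJ(3) tendsto_unique finite_subsets_at_top_neq_bot by blast
    then show ?thesis using IJ(2) by (simp add: integral_unique)
  qed
  have S_eq: "f t - S t = 0"
  proof (rule fourier_unique[where f = "\<lambda>t. f t - S t", OF _ _ _ t])
    show "f 0 - S 0 = f 1 - S 1" using per by (simp add: S_def)
    fix d :: int
    have "integral {0..1} (\<lambda>t. f t * ee (- of_int d * of_real t) - S t * ee (- of_int d * of_real t)) =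
          integral {0..1} (\<lambda>t. f t * ee (- of_int d * of_real t)) - integral {0..1} (\<lambda>t. S t * ee (- of_int d * of_real t))"
      by (rule integral_diff) (intro integrable_continuous_interval continuous_intros)+
    also have "\<dots> = 0"
      by (simp only: coeff coeffS diff_self)
    finally have "integral {0..1} (\<lambda>t. f t * ee (- of_int d * of_real t) - S t * ee (- of_int d * of_real t)) = 0" .
    then show "integral {0..1} (\<lambda>t. (f t - S t) * ee (- of_int d * of_real t)) = 0"
      by (simp add: ring_distribs)
  qed (intro continuous_intros)
  have "(\<lambda>d. norm (c d * ee (of_int d * of_real t))) summable_on UNIV"
    by (rule Infinite_Sum.abs_summable_on_comparison_test'[OF summ nrm])
  then have "((\<lambda>d. c d * ee (of_int d * of_real t)) has_sum S t) UNIV"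
    unfolding S_def by (rule has_sum_infsum[OF abs_summable_summable])
  then show ?thesis using S_eq by simp
qed

section \<open>Poisson summation\<close>

lemma summable_exp_neg:
  fixes e :: real
  assumes "e > 0"
  shows "summable (\<lambda>l. exp (- e * real l))"
proof -
  have "summable (\<lambda>l. exp (- e) ^ l)"
    by (rule summable_geometric) (use assms in auto)
  then show ?thesis by (simp add: exp_of_nat_mult [symmetric] mult.commute)
qed

text \<open>\<open>g\<close> and \<open>h\<close> are the two halves of one function on the real
  line, g(x) for x \<ge> 0 and h(-x) for x \<le> 0, and the right-hand side is its periodization.
  Supplying antiderivatives of the halves times the exponential replaces the Fourier integral over
  the line by a telescoping sum, whose value is the contribution of the antiderivatives at
  0.\<close>

lemma poisson:
  fixes g h :: "real \<Rightarrow> complex" and G H :: "int \<Rightarrow> real \<Rightarrow> complex"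
  assumes contg: "continuous_on {0..} g" and conth: "continuous_on {0..} h"
    and e: "e > 0" and bg: "\<And>x. x \<ge> 0 \<Longrightarrow> norm (g x) \<le> M * exp (- e * x)"
    and bh: "\<And>x. x \<ge> 0 \<Longrightarrow> norm (h x) \<le> M * exp (- e * x)"
    and gh: "g 0 = h 0"
    and dG: "\<And>d x. x \<ge> 0 \<Longrightarrow> (G d has_vector_derivative g x * ee (- of_int d * of_real x)) (at x)"
    and dH: "\<And>d x. x \<ge> 0 \<Longrightarrow> (H d has_vector_derivative h x * ee (of_int d * of_real x)) (at x)"
    and lG: "\<And>d. (G d \<longlongrightarrow> 0) at_top" and lH: "\<And>d. (H d \<longlongrightarrow> 0) at_top"
    and summ: "(\<lambda>d. norm (- G d 0 - H d 0)) summable_on UNIV"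
    and t: "t \<in> {0..1}"
  shows "((\<lambda>d. (- G d 0 - H d 0) * ee (of_int d * of_real t)) has_sum
           (\<Sum>l. g (real l + t) + h (real (Suc l) - t))) UNIV"
proof -
  define u where "u = (\<lambda>l t. g (real l + t) + h (real (Suc l) - t))"
  define f where "f = (\<lambda>t. \<Sum>l. u l t)"
  have M: "M \<ge> 0" using order_trans[OF norm_ge_zero bg[of 0]] by simp
  have bu: "norm (u l t) \<le> 2 * M * exp (- e * real l)" if "t \<in> {0..1}" for l t
  proof -
    have "norm (g (real l + t)) \<le> M * exp (- e * (real l + t))" using that by (intro bg) auto
    also have "\<dots> \<le> M * exp (- e * real l)" using that M e by (intro mult_left_mono) auto
    finally have 1: "norm (g (real l + t)) \<le> M * exp (- e * real l)" .
    have "norm (h (real (Suc l) - t)) \<le> M * exp (- e * (real (Suc l) - t))" using that by (intro bh) auto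
    also have "\<dots> \<le> M * exp (- e * real l)" using that M e by (intro mult_left_mono) auto
    finally have "norm (h (real (Suc l) - t)) \<le> M * exp (- e * real l)" .
    with 1 show ?thesis unfolding u_def using norm_triangle_ineq[of "g (real l + t)" "h (real (Suc l) - t)"] by simp
  qed
  have sumM: "summable (\<lambda>l. 2 * M * exp (- e * real l))"
    by (intro summable_mult summable_exp_neg e)
  have contu: "continuous_on {0..1} (u l)" for l
    unfolding u_def
    by (intro continuous_intros continuous_on_compose2[OF contg] continuous_on_compose2[OF conth]) auto
  have ul: "uniform_limit {0..1} (\<lambda>n t. \<Sum>l<n. u l t) f sequentially"
    unfolding f_def by (rule Weierstrass_m_test[OF _ sumM]) (use bu in auto)
  have contf: "continuous_on {0..1} f"
    by (rule uniform_limit_theorem[OF _ ul]) (auto intro!: always_eventually continuous_on_sum contu)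
  have summu: "summable (\<lambda>l. u l t)" if "t \<in> {0..1}" for t
    by (rule summable_comparison_test'[OF sumM]) (use bu that in auto)
  \<comment> \<open>Moving t from 0 to 1 removes the sample g(0) and adds the sample h(0), so the
    equality of these two values gives periodicity.\<close>
  have per: "f 0 = f 1"
  proof -
    have bg': "norm (g (real l)) \<le> M * exp (- e * real l)" "norm (h (real l)) \<le> M * exp (- e * real l)" for l
      using bg[of "real l"] bh[of "real l"] by simp_all
    have sg: "summable (\<lambda>l. g (real l))" "summable (\<lambda>l. h (real l))"
      by (rule summable_comparison_test'[OF summable_mult[OF summable_exp_neg[OF e]]], rule bg')+
    have sg': "summable (\<lambda>l. g (real (Suc l)))" "summable (\<lambda>l. h (real (Suc l)))"
      using sg summable_Suc_iff[of "\<lambda>l. g (real l)"] summable_Suc_iff[of "\<lambda>l. h (real l)"] by auto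
    have "f 0 = (\<Sum>l. g (real l)) + (\<Sum>l. h (real (Suc l)))"
      unfolding f_def u_def by (simp add: suminf_add sg sg' del: of_nat_Suc)
    also have "\<dots> = (\<Sum>l. g (real (Suc l))) + (\<Sum>l. h (real l))"
      using suminf_split_head[OF sg(1)] suminf_split_head[OF sg(2)] gh by simp
    also have "\<dots> = f 1"
      unfolding f_def u_def using sg sg' by (subst suminf_add) (auto simp: add.commute)
    finally show ?thesis .
  qed
  have coeff: "integral {0..1} (\<lambda>t. f t * ee (- of_int d * of_real t)) = - G d 0 - H d 0" for d
  proof -
    have "uniform_limit {0..1} (\<lambda>n t. (\<Sum>l<n. u l t) * ee (- of_int d * of_real t))
            (\<lambda>t. f t * ee (- of_int d * of_real t)) sequentially"
    proof (rule uniform_lim_mult[OF ul uniform_limit_const])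
      show "bounded (f ` {0..1})"
        by (intro compact_imp_bounded compact_continuous_image contf) auto
      show "bounded ((\<lambda>t. ee (- of_int d * of_real t)) ` {0..1})"
        by (intro compact_imp_bounded compact_continuous_image continuous_intros) auto
    qed
    then obtain I J where IJ: "\<And>n. ((\<lambda>t. (\<Sum>l<n. u l t) * ee (- of_int d * of_real t)) has_integral I n) {0..1}"
      "((\<lambda>t. f t * ee (- of_int d * of_real t)) has_integral J) {0..1}" "I \<longlonglongrightarrow> J"
      by (rule uniform_limit_integral) (auto intro!: continuous_intros contu)
    \<comment> \<open>The exponential does not notice the integer shift of its argument, so each
      summand is the derivative of a difference of translated antiderivatives.\<close>
    have int: "((\<lambda>t. u l t * ee (- of_int d * of_real t)) has_integral
                (G d (real l + 1) - H d (real (Suc l) - 1)) - (G d (real l + 0) - H d (real (Suc l) - 0))) {0..1}" for l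
    proof (rule fundamental_theorem_of_calculus)
      fix t :: real assume t: "t \<in> {0..1}"
      have e1: "ee (- of_int d * of_real (real l + t)) = ee (- of_int d * of_real t)"
      proof -
        have "- of_int d * of_real (real l + t) = of_int (- (d * int l)) + (- of_int d * complex_of_real t)"
          by (simp add: algebra_simps)
        then show ?thesis by (simp only: ee_add ee_of_int mult_1)
      qed
      have e2: "ee (of_int d * of_real (real (Suc l) - t)) = ee (- of_int d * of_real t)"
      proof -
        have "of_int d * of_real (real (Suc l) - t) = of_int (d * int (Suc l)) + (- of_int d * complex_of_real t)"
          by (simp add: algebra_simps)
        then show ?thesis by (simp only: ee_add ee_of_int mult_1)
      qed
      have "((\<lambda>t. real l + t) has_vector_derivative 1) (at t within {0..1})"
        unfolding has_real_derivative_iff_has_vector_derivative [symmetric] by (auto intro!: derivative_eq_intros)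
      from vector_diff_chain_within[OF this has_vector_derivative_at_within[OF dG[of "real l + t" d]]]
      have "((\<lambda>t. G d (real l + t)) has_vector_derivative (g (real l + t) * ee (- of_int d * of_real t))) (at t within {0..1})"
        using t unfolding e1 by (simp add: o_def)
      moreover have "((\<lambda>t. real (Suc l) - t) has_vector_derivative -1) (at t within {0..1})"
        unfolding has_real_derivative_iff_has_vector_derivative [symmetric] by (auto intro!: derivative_eq_intros)
      from vector_diff_chain_within[OF this has_vector_derivative_at_within[OF dH[of "real (Suc l) - t" d]]]
      have "((\<lambda>t. H d (real (Suc l) - t)) has_vector_derivative - (h (real (Suc l) - t) * ee (- of_int d * of_real t))) (at t within {0..1})"
        using t unfolding e2 by (simp add: o_def)
      ultimately show "((\<lambda>t. G d (real l + t) - H d (real (Suc l) - t)) has_vector_derivative u l t * ee (- of_int d * of_real t)) (at t within {0..1})"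
        using has_vector_derivative_diff by (fastforce simp: u_def ring_distribs)
    qed auto
    have I: "I n = G d (real n) - G d 0 + H d (real n) - H d 0" for n
    proof -
      have "((\<lambda>t. \<Sum>l<n. u l t * ee (- of_int d * of_real t)) has_integral
          (\<Sum>l<n. (G d (real l + 1) - H d (real (Suc l) - 1)) - (G d (real l + 0) - H d (real (Suc l) - 0)))) {0..1}"
        by (intro has_integral_sum int) auto
      then have "I n = (\<Sum>l<n. (G d (real l + 1) - H d (real (Suc l) - 1)) - (G d (real l + 0) - H d (real (Suc l) - 0)))"
        using IJ(1)[of n] by (simp add: sum_distrib_right has_integral_unique)
      also have "\<dots> = (\<Sum>l<n. (G d (real (Suc l)) + H d (real (Suc l))) - (G d (real l) + H d (real l)))"
        by (intro sum.cong) (auto simp: add.commute)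
      also have "\<dots> = (G d (real n) + H d (real n)) - (G d 0 + H d 0)"
        by (subst sum_lessThan_telescope) simp
      finally show ?thesis by simp
    qed
    have "(\<lambda>n. G d (real n) - G d 0 + H d (real n) - H d 0) \<longlonglongrightarrow> 0 - G d 0 + 0 - H d 0"
      by (intro tendsto_intros filterlim_compose[OF lG] filterlim_compose[OF lH] filterlim_real_sequentially)
    then have "J = - G d 0 - H d 0"
      using IJ(3) LIMSEQ_unique unfolding I by fastforce
    then show ?thesis using IJ(2) by (simp add: integral_unique)
  qed
  show ?thesis
    using fourier_series[OF contf per coeff summ t] unfolding f_def u_def .
qed

section \<open>Fourier series of the Bernoulli polynomials\<close>

text \<open>The series X / (exp X - 1), with coefficients B_n / n!. Removing the factor X from the
  denominator first leaves a unit, so that an inverse can be used in place of a division.\<close>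

definition bern_base :: "real fps" where
  "bern_base = inverse (fps_shift 1 (fps_exp 1 - 1))"

lemma fps_exp_minus_1: "fps_exp 1 - 1 = fps_X * fps_shift 1 (fps_exp 1 - 1 :: real fps)"
  by (intro fps_ext) (auto simp: fps_exp_def)

lemma bern_base_inverse: "bern_base * fps_shift 1 (fps_exp 1 - 1) = 1"
  unfolding bern_base_def by (rule inverse_mult_eq_1) (simp add: fps_exp_def)

lemma bernoulli_poly_fps:
  "fps_X * fps_exp t / (fps_exp 1 - 1) = fps_exp t * bern_base"
proof -
  define U where "U = fps_shift 1 (fps_exp 1 - 1 :: real fps)"
  have U0: "fps_nth U 0 \<noteq> 0" by (simp add: U_def fps_exp_def)
  have "fps_X * fps_exp t / (fps_X * U) = fps_exp t / U"
    by (rule div_mult_mult1) simp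
  also have "\<dots> = fps_exp t * inverse U"
    using U0 by (simp add: fps_divide_unit)
  finally show ?thesis
    using fps_exp_minus_1 by (simp only: U_def bern_base_def)
qed

lemma bernoulli_poly_sum:
  "bernoulli_poly n t = fact n * (\<Sum>k\<le>n. t ^ k / fact k * fps_nth bern_base (n - k))"
  unfolding bernoulli_poly_def bernoulli_poly_fps fps_mult_nth by (simp add: atMost_atLeast0)

lemma bern_base_0: "fps_nth bern_base 0 = 1"
  by (simp add: bern_base_def fps_exp_def)

lemma bernoulli_poly_0: "bernoulli_poly 0 t = 1"
  by (simp add: bernoulli_poly_sum bern_base_0)

lemma bernoulli_poly_deriv:
  "(bernoulli_poly (Suc n) has_real_derivative (real (Suc n) * bernoulli_poly n t)) (at t within A)"
proof -
  have "((\<lambda>t. fact (Suc n) * (\<Sum>k\<le>Suc n. t ^ k / fact k * fps_nth bern_base (Suc n - k))) has_real_derivative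
         fact (Suc n) * (\<Sum>k\<le>Suc n. real k * t ^ (k - 1) / fact k * fps_nth bern_base (Suc n - k))) (at t within A)"
  proof (intro DERIV_cmult DERIV_sum)
    fix k
    show "((\<lambda>t. t ^ k / fact k * fps_nth bern_base (Suc n - k)) has_real_derivative
            real k * t ^ (k - 1) / fact k * fps_nth bern_base (Suc n - k)) (at t within A)"
      using DERIV_pow[of k t A] by (intro DERIV_cmult_right DERIV_cdivide) simp
  qed
  moreover have "(\<Sum>k\<le>Suc n. real k * t ^ (k - 1) / fact k * fps_nth bern_base (Suc n - k)) =
        (\<Sum>k\<le>n. t ^ k / fact k * fps_nth bern_base (n - k))"
    by (subst sum.atMost_Suc_shift) (auto intro!: sum.cong simp: fact_Suc divide_simps simp del: of_nat_Suc)
  ultimately show ?thesis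
    by (simp add: bernoulli_poly_sum [abs_def] mult_ac)
qed

text \<open>The generating functions at 1 and at 0 differ by the factor exp X - 1 times X / (exp X -
  1), that is by X.\<close>

lemma bernoulli_poly_1_minus_0:
  "bernoulli_poly n 1 - bernoulli_poly n 0 = (if n = 1 then 1 else 0)"
proof -
  have "fps_exp 1 * bern_base - fps_exp 0 * bern_base = bern_base * (fps_exp 1 - 1)"
    by (simp add: algebra_simps)
  also have "\<dots> = fps_X * (bern_base * fps_shift 1 (fps_exp 1 - 1))"
    by (subst fps_exp_minus_1) (simp only: mult_ac)
  also have "\<dots> = fps_X" unfolding bern_base_inverse by simp
  finally have "fps_nth (fps_exp 1 * bern_base) n - fps_nth (fps_exp 0 * bern_base) n = fps_nth fps_X n"
    by (metis fps_sub_nth)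
  then show ?thesis
    unfolding bernoulli_poly_def bernoulli_poly_fps right_diff_distrib [symmetric] by simp
qed

lemma continuous_on_bernoulli_poly [continuous_intros]: "continuous_on A (bernoulli_poly n)"
  unfolding bernoulli_poly_sum [abs_def] by (intro continuous_intros) auto

text \<open>Integration by parts lowers the degree. Its boundary term is the difference of the
  values at 1 and 0, which is nonzero only in degree 1 and there starts the recursion with the
  coefficient -1 / (2 pi i d).\<close>

lemma bernoulli_poly_fourier_coeff:
  assumes "n \<ge> 1"
  shows "integral {0..1} (\<lambda>t. of_real (bernoulli_poly n t) * ee (- of_int d * of_real t)) =
     (if d = 0 then 0 else - fact n / (2 * of_real pi * \<i> * of_int d) ^ n)"
proof (cases "d = 0")
  case True
  have "((\<lambda>t. bernoulli_poly n t) has_integral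
          bernoulli_poly (Suc n) 1 / real (Suc n) - bernoulli_poly (Suc n) 0 / real (Suc n)) {0..1}"
    by (rule fundamental_theorem_of_calculus)
       (auto intro!: derivative_eq_intros bernoulli_poly_deriv simp flip: has_real_derivative_iff_has_vector_derivative simp del: of_nat_Suc)
  also have "bernoulli_poly (Suc n) 1 / real (Suc n) - bernoulli_poly (Suc n) 0 / real (Suc n) = 0"
    using bernoulli_poly_1_minus_0[of "Suc n"] assms by (simp flip: diff_divide_distrib)
  finally have "((\<lambda>t. complex_of_real (bernoulli_poly n t)) has_integral of_real 0) {0..1}"
    by (rule has_integral_of_real)
  then show ?thesis using True by (simp add: integral_unique)
next
  case False
  define D where "D = 2 * of_real pi * \<i> * complex_of_int d"
  have D: "D \<noteq> 0" using False by (simp add: D_def)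
  define I where "I = (\<lambda>n. integral {0..1} (\<lambda>t. complex_of_real (bernoulli_poly n t) * ee (- of_int d * of_real t)))"
  have hI: "((\<lambda>t. complex_of_real (bernoulli_poly n t) * ee (- of_int d * of_real t)) has_integral I n) {0..1}" for n
    unfolding I_def by (intro integrable_integral integrable_continuous_interval continuous_intros)
  have rec: "D * I (Suc n) = of_nat (Suc n) * I n - (if n = 0 then 1 else 0)" for n
  proof -
    have "((\<lambda>t. complex_of_real (real (Suc n) * bernoulli_poly n t) * ee (- of_int d * of_real t)
              + complex_of_real (bernoulli_poly (Suc n) t) * (- D * ee (- of_int d * of_real t))) has_integral
           complex_of_real (bernoulli_poly (Suc n) 1) * ee (- of_int d * of_real 1) -
           complex_of_real (bernoulli_poly (Suc n) 0) * ee (- of_int d * of_real 0)) {0..1}"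
    proof (rule fundamental_theorem_of_calculus)
      fix t :: real
      have "((\<lambda>t. complex_of_real (bernoulli_poly (Suc n) t)) has_vector_derivative complex_of_real (real (Suc n) * bernoulli_poly n t)) (at t within {0..1})"
        using bernoulli_poly_deriv by (intro has_vector_derivative_of_real) (auto simp: has_real_derivative_iff_has_vector_derivative)
      from has_vector_derivative_mult[OF this has_vector_derivative_ee[of "- of_int d" t "{0..1}"]]
      show "((\<lambda>t. complex_of_real (bernoulli_poly (Suc n) t) * ee (- of_int d * of_real t)) has_vector_derivative
         complex_of_real (real (Suc n) * bernoulli_poly n t) * ee (- of_int d * of_real t)
              + complex_of_real (bernoulli_poly (Suc n) t) * (- D * ee (- of_int d * of_real t))) (at t within {0..1})"
        by (simp add: D_def add.commute mult_ac)
    qed auto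
    moreover have "((\<lambda>t. complex_of_real (real (Suc n) * bernoulli_poly n t) * ee (- of_int d * of_real t)
              + complex_of_real (bernoulli_poly (Suc n) t) * (- D * ee (- of_int d * of_real t))) has_integral
             of_nat (Suc n) * I n + (- D) * I (Suc n)) {0..1}"
      using has_integral_add[OF has_integral_mult_right[OF hI[of n], of "of_nat (Suc n)"] has_integral_mult_right[OF hI[of "Suc n"], of "- D"]]
      by (simp add: mult_ac)
    ultimately have "of_nat (Suc n) * I n + (- D) * I (Suc n) =
         complex_of_real (bernoulli_poly (Suc n) 1 - bernoulli_poly (Suc n) 0)"
      using ee_of_int[of "-d"] by (simp add: has_integral_unique del: of_nat_Suc)
    then show ?thesis unfolding bernoulli_poly_1_minus_0 by (auto simp: algebra_simps split: if_splits)
  qed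
  have I0: "I 0 = 0"
    using integral_ee_int[of "- d"] False by (simp add: I_def bernoulli_poly_0)
  have "I n = - fact n / D ^ n"
    using assms
  proof (induction n rule: dec_induct)
    case base
    then show ?case using rec[of 0] I0 D by (simp add: field_simps)
  next
    case (step n)
    have "I (Suc n) = of_nat (Suc n) * I n / D"
      using rec[of n] step.hyps D by (simp add: field_simps)
    then show ?case by (simp add: step.IH mult_ac)
  qed
  then show ?thesis using False by (simp add: I_def D_def)
qed

lemma summable_on_int_abs:
  fixes f :: "real \<Rightarrow> real"
  assumes "summable (\<lambda>m. f (real m))" "\<And>x. x \<ge> 0 \<Longrightarrow> f x \<ge> 0"
  shows "(\<lambda>d::int. f \<bar>of_int d\<bar>) summable_on UNIV"
proof -
  have nat: "(\<lambda>m::nat. f (real m)) summable_on UNIV"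
    using assms by (intro norm_summable_imp_summable_on) simp
  have "(\<lambda>d::int. f \<bar>of_int d\<bar>) summable_on range int"
    using nat by (subst summable_on_reindex) (auto simp: o_def)
  moreover have "(\<lambda>d::int. f \<bar>of_int d\<bar>) summable_on range (\<lambda>m. - int m)"
    using nat by (subst summable_on_reindex) (auto simp: o_def inj_on_def)
  ultimately have "(\<lambda>d::int. f \<bar>of_int d\<bar>) summable_on (range int \<union> range (\<lambda>m. - int m))"
    by (rule summable_on_union)
  moreover have "range int \<union> range (\<lambda>m. - int m) = UNIV"
    by (auto intro: int_cases2)
  ultimately show ?thesis by simp
qed

lemma summable_inverse_power_int:
  assumes "n \<ge> 2"
  shows "(\<lambda>d::int. inverse (\<bar>real_of_int d\<bar> ^ n)) summable_on UNIV"
  using summable_on_int_abs[of "\<lambda>x. inverse (x ^ n)"] inverse_power_summable[OF assms, where 'a = real]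
  by simp

lemma bernoulli_poly_fourier_series:
  assumes n: "n \<ge> 2" and t: "t \<in> {0..1}"
  shows "((\<lambda>d. - fact n / (2 * of_real pi * \<i> * of_int d) ^ n * ee (of_int d * of_real t)) has_sum
           complex_of_real (bernoulli_poly n t)) UNIV"
proof -
  \<comment> \<open>At d = 0 division by zero yields 0, which is also the mean value of the
    polynomial; one formula thus covers all d.\<close>
  have eq: "- fact n / (2 * of_real pi * \<i> * of_int d) ^ n = (if d = 0 then 0 else - fact n / (2 * of_real pi * \<i> * complex_of_int d) ^ n)" for d
    using n by auto
  show ?thesis
  proof (rule fourier_series[OF _ _ _ _ t])
    show "continuous_on {0..1} (\<lambda>t. complex_of_real (bernoulli_poly n t))"
      by (intro continuous_intros)
    show "complex_of_real (bernoulli_poly n 0) = complex_of_real (bernoulli_poly n 1)"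
      using bernoulli_poly_1_minus_0[of n] n by simp
    show "integral {0..1} (\<lambda>t. complex_of_real (bernoulli_poly n t) * ee (- of_int d * of_real t)) =
          - fact n / (2 * of_real pi * \<i> * of_int d) ^ n" for d
      using bernoulli_poly_fourier_coeff[of n d] n by (subst eq) auto
    have "(\<lambda>d::int. fact n / (2 * pi) ^ n * inverse (\<bar>real_of_int d\<bar> ^ n)) summable_on UNIV"
      by (intro summable_on_cmult_right summable_inverse_power_int n)
    also have "(\<lambda>d::int. fact n / (2 * pi) ^ n * inverse (\<bar>real_of_int d\<bar> ^ n)) =
               (\<lambda>d::int. norm (- fact n / (2 * of_real pi * \<i> * complex_of_int d) ^ n))"
      by (simp add: fun_eq_iff norm_divide norm_power norm_mult power_mult_distrib field_simps)
    finally show "(\<lambda>d::int. norm (- fact n / (2 * of_real pi * \<i> * complex_of_int d) ^ n)) summable_on UNIV" .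
  qed
qed

section \<open>Exponential series\<close>

text \<open>Absolute convergence at every height of the upper half-plane: the terms of
  \<open>exp_series\<close> have norm
  \<open>norm (c i) * exp (- 2 * pi * Im \<tau> * \<kappa> i)\<close>. Exponents are real because
  they will be m (l + t). Asking for all \<delta> lets termwise derivatives inherit the
  property.\<close>

definition exp_summable :: "'i set \<Rightarrow> ('i \<Rightarrow> complex) \<Rightarrow> ('i \<Rightarrow> real) \<Rightarrow> bool" where
  "exp_summable I c \<kappa> \<longleftrightarrow> (\<forall>i\<in>I. \<kappa> i \<ge> 0) \<and> (\<forall>\<delta>>0. (\<lambda>i. norm (c i) * exp (- \<delta> * \<kappa> i)) summable_on I)"

definition exp_series :: "'i set \<Rightarrow> ('i \<Rightarrow> complex) \<Rightarrow> ('i \<Rightarrow> real) \<Rightarrow> complex \<Rightarrow> complex" where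
  "exp_series I c \<kappa> \<tau> = (\<Sum>\<^sub>\<infinity>i\<in>I. c i * ee (of_real (\<kappa> i) * \<tau>))"

lemma summable_on_comparison_real:
  fixes f g :: "'i \<Rightarrow> real"
  assumes "g summable_on I" "\<And>i. i \<in> I \<Longrightarrow> 0 \<le> f i" "\<And>i. i \<in> I \<Longrightarrow> f i \<le> g i"
  shows "f summable_on I"
  by (rule summable_on_comparison_test[OF assms(1)]) (use assms in auto)

text \<open>Half of the decay rate pays for the extra factor, by \<kappa> \<le> (2 / \<delta>)
  exp(\<delta> \<kappa> / 2).\<close>

lemma exp_summable_times_exponent:
  assumes "exp_summable I c \<kappa>"
  shows "exp_summable I (\<lambda>i. c i * of_real (\<kappa> i)) \<kappa>"
  unfolding exp_summable_def
proof (intro conjI allI impI)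
  show "\<forall>i\<in>I. \<kappa> i \<ge> 0" using assms by (auto simp: exp_summable_def)
  fix \<delta> :: real assume \<delta>: "\<delta> > 0"
  have "(\<lambda>i. norm (c i) * exp (- (\<delta> / 2) * \<kappa> i)) summable_on I"
    using assms \<delta> half_gt_zero unfolding exp_summable_def by blast
  then have "(\<lambda>i. (2 / \<delta>) * (norm (c i) * exp (- (\<delta> / 2) * \<kappa> i))) summable_on I"
    by (rule summable_on_cmult_right)
  then show "(\<lambda>i. norm (c i * of_real (\<kappa> i)) * exp (- \<delta> * \<kappa> i)) summable_on I"
  proof (rule summable_on_comparison_real)
    fix i assume i: "i \<in> I"
    then have \<kappa>: "\<kappa> i \<ge> 0" using assms by (auto simp: exp_summable_def)
    have "\<delta> / 2 * \<kappa> i \<le> exp (\<delta> / 2 * \<kappa> i)"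
      using exp_ge_add_one_self[of "\<delta> / 2 * \<kappa> i"] by linarith
    then have "\<kappa> i \<le> 2 / \<delta> * exp (\<delta> / 2 * \<kappa> i)" using \<delta> by (simp add: field_simps)
    then have "\<kappa> i * exp (- \<delta> * \<kappa> i) \<le> 2 / \<delta> * exp (\<delta> / 2 * \<kappa> i) * exp (- \<delta> * \<kappa> i)"
      by (intro mult_right_mono) auto
    also have "\<dots> = 2 / \<delta> * exp (- (\<delta> / 2) * \<kappa> i)"
      by (simp add: mult.assoc exp_add [symmetric])
    finally have "norm (c i) * (\<kappa> i * exp (- \<delta> * \<kappa> i)) \<le> norm (c i) * (2 / \<delta> * exp (- (\<delta> / 2) * \<kappa> i))"
      by (rule mult_left_mono) auto
    then show "norm (c i * of_real (\<kappa> i)) * exp (- \<delta> * \<kappa> i) \<le> (2 / \<delta>) * (norm (c i) * exp (- (\<delta> / 2) * \<kappa> i))"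
      using \<kappa> by (simp add: norm_mult mult_ac)
  qed auto
qed

lemma exp_summable_power_exponent:
  assumes "exp_summable I c \<kappa>"
  shows "exp_summable I (\<lambda>i. c i * of_real (\<kappa> i) ^ k) \<kappa>"
proof (induction k)
  case (Suc k)
  then show ?case using exp_summable_times_exponent[OF Suc.IH] by (simp add: mult_ac)
qed (use assms in auto)

lemma exp_series_abs_summable:
  assumes "exp_summable I c \<kappa>" "Im \<tau> > 0"
  shows "(\<lambda>i. norm (c i * ee (of_real (\<kappa> i) * \<tau>))) summable_on I"
proof -
  have "(\<lambda>i. norm (c i) * exp (- (2 * pi * Im \<tau>) * \<kappa> i)) summable_on I"
    using assms by (auto simp: exp_summable_def)
  then show ?thesis by (simp add: norm_mult norm_ee mult_ac)
qed

lemma exp_series_summable: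
  assumes "exp_summable I c \<kappa>" "Im \<tau> > 0"
  shows "(\<lambda>i. c i * ee (of_real (\<kappa> i) * \<tau>)) summable_on I"
  using abs_summable_summable[OF exp_series_abs_summable[OF assms]] .

lemma exp_series_norm_le:
  assumes "exp_summable I c \<kappa>" "Im \<tau> \<ge> 1"
  shows "norm (exp_series I c \<kappa> \<tau>) \<le> (\<Sum>\<^sub>\<infinity>i\<in>I. norm (c i) * exp (- (2 * pi) * \<kappa> i))"
proof -
  have s: "(\<lambda>i. norm (c i) * exp (- (2 * pi) * \<kappa> i)) summable_on I"
    using assms by (auto simp: exp_summable_def)
  have "norm (exp_series I c \<kappa> \<tau>) \<le> (\<Sum>\<^sub>\<infinity>i\<in>I. norm (c i * ee (of_real (\<kappa> i) * \<tau>)))"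
    unfolding exp_series_def by (rule norm_infsum_bound) (use exp_series_abs_summable[OF assms(1)] assms(2) in auto)
  also have "\<dots> \<le> (\<Sum>\<^sub>\<infinity>i\<in>I. norm (c i) * exp (- (2 * pi) * \<kappa> i))"
  proof (rule infsum_mono[OF _ s])
    show "(\<lambda>i. norm (c i * ee (of_real (\<kappa> i) * \<tau>))) summable_on I"
      using exp_series_abs_summable[OF assms(1)] assms(2) by auto
    fix i assume "i \<in> I"
    then have "\<kappa> i * 1 \<le> \<kappa> i * Im \<tau>"
      using assms by (intro mult_left_mono) (auto simp: exp_summable_def)
    then show "norm (c i * ee (of_real (\<kappa> i) * \<tau>)) \<le> norm (c i) * exp (- (2 * pi) * \<kappa> i)"
      by (auto simp: norm_mult norm_ee intro!: mult_left_mono)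
  qed
  finally show ?thesis .
qed

text \<open>On the closed disc of radius Im \<tau> / 2 all points have height at least Im \<tau> /
  2, so the series converges uniformly there and Weierstrass' theorem permits termwise
  differentiation.\<close>

lemma exp_series_has_field_derivative:
  assumes "exp_summable I c \<kappa>" "Im \<tau> > 0"
  shows "(exp_series I c \<kappa> has_field_derivative
           2 * of_real pi * \<i> * exp_series I (\<lambda>i. c i * of_real (\<kappa> i)) \<kappa> \<tau>) (at \<tau>)"
proof -
  define r where "r = Im \<tau> / 2"
  have r: "r > 0" using assms by (simp add: r_def)
  have Im: "Im w \<ge> r" if "w \<in> cball \<tau> r" for w
  proof -
    have "\<bar>Im (\<tau> - w)\<bar> \<le> r" using that abs_Im_le_cmod[of "\<tau> - w"] by (simp add: dist_norm)
    then have "Im \<tau> - Im w \<le> r" by (simp add: abs_le_iff)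
    then show ?thesis unfolding r_def by linarith
  qed
  have ul: "uniform_limit (cball \<tau> r) (\<lambda>X w. \<Sum>i\<in>X. c i * ee (of_real (\<kappa> i) * w)) (exp_series I c \<kappa>) (finite_subsets_at_top I)"
    unfolding exp_series_def
  proof (rule Weierstrass_m_test_general)
    show "(\<lambda>i. norm (c i) * exp (- (2 * pi * r) * \<kappa> i)) summable_on I"
      using assms r by (auto simp: exp_summable_def)
    fix i w assume i: "i \<in> I" and w: "w \<in> cball \<tau> r"
    have "\<kappa> i * r \<le> \<kappa> i * Im w" using i assms Im[OF w] by (intro mult_left_mono) (auto simp: exp_summable_def)
    then show "norm (c i * ee (of_real (\<kappa> i) * w)) \<le> norm (c i) * exp (- (2 * pi * r) * \<kappa> i)"
      by (auto simp: norm_mult norm_ee mult_ac intro!: mult_left_mono)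
  qed
  obtain g' where g': "\<And>w. w \<in> ball \<tau> r \<Longrightarrow> (exp_series I c \<kappa> has_field_derivative g' w) (at w) \<and>
        ((\<lambda>X. \<Sum>i\<in>X. 2 * of_real pi * \<i> * (c i * of_real (\<kappa> i) * ee (of_real (\<kappa> i) * w))) \<longlongrightarrow> g' w) (finite_subsets_at_top I)"
  proof (rule has_complex_derivative_uniform_limit[OF _ ul _ r,
      where f' = "\<lambda>X w. \<Sum>i\<in>X. 2 * of_real pi * \<i> * (c i * of_real (\<kappa> i) * ee (of_real (\<kappa> i) * w))"])
    show "eventually (\<lambda>X. continuous_on (cball \<tau> r) (\<lambda>w. \<Sum>i\<in>X. c i * ee (of_real (\<kappa> i) * w)) \<and>
        (\<forall>w\<in>ball \<tau> r. ((\<lambda>w. \<Sum>i\<in>X. c i * ee (of_real (\<kappa> i) * w)) has_field_derivative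
          (\<Sum>i\<in>X. 2 * of_real pi * \<i> * (c i * of_real (\<kappa> i) * ee (of_real (\<kappa> i) * w)))) (at w))) (finite_subsets_at_top I)"
      by (intro always_eventually allI conjI ballI continuous_intros)
         (auto intro!: derivative_eq_intros sum.cong simp: mult_ac)
  qed auto
  have "((\<lambda>i. c i * of_real (\<kappa> i) * ee (of_real (\<kappa> i) * \<tau>)) has_sum exp_series I (\<lambda>i. c i * of_real (\<kappa> i)) \<kappa> \<tau>) I"
    unfolding exp_series_def using exp_series_summable[OF exp_summable_times_exponent[OF assms(1)] assms(2)]
    by (rule has_sum_infsum)
  then have "((\<lambda>i. 2 * of_real pi * \<i> * (c i * of_real (\<kappa> i) * ee (of_real (\<kappa> i) * \<tau>))) has_sum
      2 * of_real pi * \<i> * exp_series I (\<lambda>i. c i * of_real (\<kappa> i)) \<kappa> \<tau>) I"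
    by (rule has_sum_cmult_right)
  then have "g' \<tau> = 2 * of_real pi * \<i> * exp_series I (\<lambda>i. c i * of_real (\<kappa> i)) \<kappa> \<tau>"
    using g'[of \<tau>] r unfolding has_sum_def by (auto dest: tendsto_unique[OF finite_subsets_at_top_neq_bot])
  with g'[of \<tau>] r show ?thesis by auto
qed

lemma open_upper_half_plane: "open upper_half_plane"
  unfolding upper_half_plane_def by (rule open_halfspace_Im_gt)

lemma exp_series_holomorphic:
  assumes "exp_summable I c \<kappa>"
  shows "exp_series I c \<kappa> holomorphic_on upper_half_plane"
  unfolding holomorphic_on_open[OF open_upper_half_plane]
  using exp_series_has_field_derivative[OF assms] by (auto simp: upper_half_plane_def)

section \<open>Smooth functions\<close>

lemma frechet_derivative_cong_open:
  assumes "open S" "x \<in> S" "\<And>y. y \<in> S \<Longrightarrow> f y = g y"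
  shows "frechet_derivative f (at x) = frechet_derivative g (at x)"
proof -
  have "(f has_derivative D) (at x) \<longleftrightarrow> (g has_derivative D) (at x)" for D
    using assms has_derivative_transform_within_open[of f D x UNIV S g] 
       has_derivative_transform_within_open[of g D x UNIV S f] by auto
  then show ?thesis by (simp add: frechet_derivative_def)
qed

lemma Ck_on_cong:
  assumes "open S" "\<And>x. x \<in> S \<Longrightarrow> f x = g x" "Ck_on k f S"
  shows "Ck_on k g S"
  using assms(2,3)
proof (induction k arbitrary: f g)
  case 0
  then show ?case by (metis Ck_on.simps(1) continuous_on_cong)
next
  case (Suc k)
  have "g differentiable (at x)" if "x \<in> S" for x
  proof -
    have "(f has_derivative frechet_derivative f (at x)) (at x)"
      using Suc.prems that frechet_derivative_works by auto
    then have "(g has_derivative frechet_derivative f (at x)) (at x)"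
      by (rule has_derivative_transform_within_open[OF _ assms(1) that]) (use Suc.prems in auto)
    then show ?thesis by (auto simp: differentiable_def)
  qed
  moreover have "Ck_on k (\<lambda>x. frechet_derivative g (at x) h) S" for h
    by (rule Suc.IH[where f = "\<lambda>x. frechet_derivative f (at x) h"])
       (use Suc.prems frechet_derivative_cong_open[OF assms(1), of _ f g] in auto)
  ultimately show ?case by simp
qed

text \<open>Replaces the selected \<open>frechet_derivative\<close> by an explicit formula, so that
  an induction on k only has to be closed under that formula.\<close>

lemma Ck_on_SucI:
  assumes "open S" "\<And>x. x \<in> S \<Longrightarrow> (f has_derivative f' x) (at x)"
    and "\<And>h. Ck_on k (\<lambda>x. f' x h) S"
  shows "Ck_on (Suc k) f S"
proof -
  have "Ck_on k (\<lambda>x. frechet_derivative f (at x) h) S" for h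
    by (rule Ck_on_cong[OF assms(1) _ assms(3)[of h]]) (use assms(2) frechet_derivative_at in metis)
  then show ?thesis using assms(2) by (auto simp: differentiable_def)
qed

lemma Ck_on_Suc_has_derivative:
  assumes "Ck_on (Suc k) f S" "x \<in> S"
  shows "(f has_derivative frechet_derivative f (at x)) (at x)"
  using assms frechet_derivative_works by auto

lemma Ck_on_Suc_imp: "Ck_on (Suc k) f S \<Longrightarrow> Ck_on k f S"
proof (induction k arbitrary: f)
  case 0
  then show ?case
    by (auto simp: continuous_on_eq_continuous_within differentiable_imp_continuous_within
        intro: continuous_at_imp_continuous_within)
qed auto

lemma Ck_on_const: "Ck_on k (\<lambda>x. c) S"
  by (induction k arbitrary: c) auto

lemma Ck_on_add:
  assumes "open S" "Ck_on k f S" "Ck_on k g S"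
  shows "Ck_on k (\<lambda>x. f x + g x) S"
  using assms(2,3)
proof (induction k arbitrary: f g)
  case 0
  then show ?case by (auto intro: continuous_on_add)
next
  case (Suc k)
  show ?case
    by (rule Ck_on_SucI[OF assms(1), where f' = "\<lambda>x h. frechet_derivative f (at x) h + frechet_derivative g (at x) h"])
       (use Suc.prems in \<open>auto intro!: has_derivative_add Suc.IH Ck_on_Suc_has_derivative\<close>)
qed

lemma Ck_on_mult:
  fixes f g :: "'a::real_normed_vector \<Rightarrow> 'b::real_normed_algebra"
  assumes "open S" "Ck_on k f S" "Ck_on k g S"
  shows "Ck_on k (\<lambda>x. f x * g x) S"
  using assms(2,3)
proof (induction k arbitrary: f g)
  case 0
  then show ?case by (auto intro: continuous_on_mult)
next
  case (Suc k)
  show ?case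
  proof (rule Ck_on_SucI[OF assms(1), where f' = "\<lambda>x h. f x * frechet_derivative g (at x) h + frechet_derivative f (at x) h * g x"])
    show "((\<lambda>x. f x * g x) has_derivative (\<lambda>h. f x * frechet_derivative g (at x) h + frechet_derivative f (at x) h * g x)) (at x)"
      if "x \<in> S" for x
      using Suc.prems that by (intro has_derivative_mult Ck_on_Suc_has_derivative)
    show "Ck_on k (\<lambda>x. f x * frechet_derivative g (at x) h + frechet_derivative f (at x) h * g x) S" for h
      using Suc.prems Ck_on_Suc_imp[OF Suc.prems(1)] Ck_on_Suc_imp[OF Suc.prems(2)]
      by (intro Ck_on_add assms(1) Suc.IH) auto
  qed
qed

lemma Ck_on_bounded_linear_compose:
  assumes "open S" "bounded_linear L" "Ck_on k f S"
  shows "Ck_on k (\<lambda>x. L (f x)) S"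
  using assms(3)
proof (induction k arbitrary: f)
  case 0
  then show ?case using bounded_linear.continuous_on[OF assms(2)] by auto
next
  case (Suc k)
  show ?case
    by (rule Ck_on_SucI[OF assms(1), where f' = "\<lambda>x h. L (frechet_derivative f (at x) h)"])
       (use Suc.prems Suc.IH in \<open>auto intro!: bounded_linear.has_derivative[OF assms(2)] Ck_on_Suc_has_derivative\<close>)
qed

lemma Ck_on_bounded_linear:
  assumes "open S" "bounded_linear L"
  shows "Ck_on k L S"
proof (cases k)
  case (Suc j)
  show ?thesis unfolding Suc
    by (rule Ck_on_SucI[OF assms(1), where f' = "\<lambda>_. L"])
       (auto intro!: bounded_linear_imp_has_derivative assms Ck_on_const)
qed (use assms(2) linear_continuous_on in auto)

text \<open>In each fixed direction the real derivative is a constant times \<open>deriv f\<close>,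
  hence holomorphic again, and the induction closes.\<close>

lemma Ck_on_holomorphic:
  assumes "open S" "f holomorphic_on S"
  shows "Ck_on k f S"
  using assms(2)
proof (induction k arbitrary: f)
  case 0
  then show ?case by (simp add: holomorphic_on_imp_continuous_on)
next
  case (Suc k)
  show ?case
  proof (rule Ck_on_SucI[OF assms(1), where f' = "\<lambda>x h. deriv f x * h"])
    show "(f has_derivative (\<lambda>h. deriv f x * h)) (at x)" if "x \<in> S" for x
      using holomorphic_derivI[OF Suc.prems assms(1) that] by (simp add: has_field_derivative_def)
    show "Ck_on k (\<lambda>x. deriv f x * h) S" for h
      by (intro Suc.IH holomorphic_intros holomorphic_deriv assms Suc.prems)
  qed
qed

text \<open>The derivative is a constant times the square of the function itself, so the induction
  hypothesis already covers it.\<close>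

lemma Ck_on_inverse_Im:
  assumes "open S" "\<And>x. x \<in> S \<Longrightarrow> Im x \<noteq> 0"
  shows "Ck_on k (\<lambda>x. complex_of_real (inverse (Im x))) S"
proof (induction k)
  case 0
  then show ?case using assms by (auto intro!: continuous_intros)
next
  case (Suc k)
  show ?case
  proof (rule Ck_on_SucI[OF assms(1), where f' = "\<lambda>x h. - of_real (Im h) * (of_real (inverse (Im x)) * of_real (inverse (Im x)))"])
    show "((\<lambda>x. complex_of_real (inverse (Im x))) has_derivative
            (\<lambda>h. - of_real (Im h) * (of_real (inverse (Im x)) * of_real (inverse (Im x))))) (at x)"
      if "x \<in> S" for x
      using assms(2)[OF that]
      by (auto intro!: derivative_eq_intros has_derivative_of_real simp: fun_eq_iff power2_eq_square field_simps)
    show "Ck_on k (\<lambda>x. - of_real (Im h) * (complex_of_real (inverse (Im x)) * of_real (inverse (Im x)))) S" for h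
      by (intro Ck_on_mult assms(1) Ck_on_const Suc.IH)
  qed
qed

lemma Ck_on_ln_Im:
  assumes "open S" "\<And>x. x \<in> S \<Longrightarrow> Im x > 0"
  shows "Ck_on k (\<lambda>x. complex_of_real (ln (Im x))) S"
proof (cases k)
  case 0
  then show ?thesis using assms(2) by (force intro!: continuous_intros)
next
  case (Suc j)
  show ?thesis unfolding Suc
  proof (rule Ck_on_SucI[OF assms(1), where f' = "\<lambda>x h. of_real (Im h) * of_real (inverse (Im x))"])
    show "((\<lambda>x. complex_of_real (ln (Im x))) has_derivative (\<lambda>h. of_real (Im h) * of_real (inverse (Im x)))) (at x)"
      if "x \<in> S" for x
      using assms(2)[OF that]
      by (auto intro!: derivative_eq_intros has_derivative_of_real simp: fun_eq_iff field_simps)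
    show "Ck_on j (\<lambda>x. of_real (Im h) * complex_of_real (inverse (Im x))) S" for h
      using assms by (intro Ck_on_mult Ck_on_const Ck_on_inverse_Im) force+
  qed
qed

lemma smooth_on_cong: "open S \<Longrightarrow> (\<And>x. x \<in> S \<Longrightarrow> f x = g x) \<Longrightarrow> smooth_on f S \<Longrightarrow> smooth_on g S"
  unfolding smooth_on_def using Ck_on_cong by blast

named_theorems smooth_intros

lemma smooth_on_const [smooth_intros]: "smooth_on (\<lambda>x. c) S"
  by (simp add: smooth_on_def Ck_on_const)

lemma smooth_on_add [smooth_intros]:
  "open S \<Longrightarrow> smooth_on f S \<Longrightarrow> smooth_on g S \<Longrightarrow> smooth_on (\<lambda>x. f x + g x) S"
  by (simp add: smooth_on_def Ck_on_add)

lemma smooth_on_mult [smooth_intros]: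
  fixes f g :: "'a::real_normed_vector \<Rightarrow> 'b::real_normed_algebra"
  shows "open S \<Longrightarrow> smooth_on f S \<Longrightarrow> smooth_on g S \<Longrightarrow> smooth_on (\<lambda>x. f x * g x) S"
  by (simp add: smooth_on_def Ck_on_mult)

lemma smooth_on_power [smooth_intros]:
  fixes f :: "'a::real_normed_vector \<Rightarrow> 'b::real_normed_algebra_1"
  shows "open S \<Longrightarrow> smooth_on f S \<Longrightarrow> smooth_on (\<lambda>x. f x ^ n) S"
  by (induction n) (auto intro: smooth_intros)

lemma smooth_on_sum [smooth_intros]:
  "open S \<Longrightarrow> (\<And>k. k \<in> K \<Longrightarrow> smooth_on (f k) S) \<Longrightarrow> smooth_on (\<lambda>x. \<Sum>k\<in>K. f k x) S"
  by (induction K rule: infinite_finite_induct) (auto intro: smooth_intros)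

lemma smooth_on_cnj [smooth_intros]:
  "open S \<Longrightarrow> smooth_on f S \<Longrightarrow> smooth_on (\<lambda>x. cnj (f x)) S"
  by (simp add: smooth_on_def Ck_on_bounded_linear_compose bounded_linear_cnj)

lemma smooth_on_holomorphic: "open S \<Longrightarrow> f holomorphic_on S \<Longrightarrow> smooth_on f S"
  by (simp add: smooth_on_def Ck_on_holomorphic)

lemma smooth_on_Im [smooth_intros]: "open S \<Longrightarrow> smooth_on (\<lambda>x. complex_of_real (Im x)) S"
  using Ck_on_bounded_linear[OF _ bounded_linear_compose[OF bounded_linear_of_real bounded_linear_Im]]
  by (auto simp: smooth_on_def)

lemma smooth_on_ln_Im: "open S \<Longrightarrow> (\<And>x. x \<in> S \<Longrightarrow> Im x > 0) \<Longrightarrow> smooth_on (\<lambda>x. complex_of_real (ln (Im x))) S"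
  by (simp add: smooth_on_def Ck_on_ln_Im)

section \<open>Expansion of the completed functions\<close>

text \<open>Both orders of iterated summation are needed: \<open>Ecal\<close> has the outer index m
  and an inner geometric series, whereas \<open>Ecal_minus\<close> has the outer index l.\<close>

lemma double_suminf_eq_infsum:
  fixes f :: "nat \<times> nat \<Rightarrow> complex"
  assumes "f summable_on UNIV"
  shows "summable (\<lambda>i. f (i, j))" "summable (\<lambda>j. f (i, j))"
    "(\<lambda>i. \<Sum>j. f (i, j)) sums infsum f UNIV" "(\<lambda>j. \<Sum>i. f (i, j)) sums infsum f UNIV"
proof -
  have 1: "(\<lambda>i. f (i, j)) summable_on UNIV" for j
  proof -
    have "f summable_on range (\<lambda>i. (i, j))" by (rule summable_on_subset_banach[OF assms]) auto
    then show ?thesis by (subst (asm) summable_on_reindex) (auto simp: inj_on_def o_def)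
  qed
  have 2: "(\<lambda>j. f (i, j)) summable_on UNIV" for i
  proof -
    have "f summable_on range (\<lambda>j. (i, j))" by (rule summable_on_subset_banach[OF assms]) auto
    then show ?thesis by (subst (asm) summable_on_reindex) (auto simp: inj_on_def o_def)
  qed
  show "summable (\<lambda>i. f (i, j))" "summable (\<lambda>j. f (i, j))"
    using 1 2 by (auto intro: summable_on_imp_summable)
  have hs: "(f has_sum infsum f UNIV) (UNIV \<times> UNIV)"
    using has_sum_infsum[OF assms] by simp
  have "((\<lambda>i. \<Sum>\<^sub>\<infinity>j. f (i, j)) has_sum infsum f UNIV) UNIV"
    by (rule has_sum_SigmaD[OF hs]) (use 2 in auto)
  moreover have "(\<Sum>\<^sub>\<infinity>j. f (i, j)) = (\<Sum>j. f (i, j))" for i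
    using 2[of i] by (intro sums_unique has_sum_imp_sums has_sum_infsum)
  ultimately show "(\<lambda>i. \<Sum>j. f (i, j)) sums infsum f UNIV"
    by (auto dest: has_sum_imp_sums)
  have "((\<lambda>(j, i). f (i, j)) has_sum infsum f UNIV) (UNIV \<times> UNIV)"
    using has_sum_swap[of f UNIV UNIV "infsum f UNIV"] hs by (simp add: case_prod_unfold)
  then have "((\<lambda>j. \<Sum>\<^sub>\<infinity>i. f (i, j)) has_sum infsum f UNIV) UNIV"
    by (rule has_sum_SigmaD) (use 1 in auto)
  moreover have "(\<Sum>\<^sub>\<infinity>i. f (i, j)) = (\<Sum>i. f (i, j))" for j
    using 1[of j] by (intro sums_unique has_sum_imp_sums has_sum_infsum)
  ultimately show "(\<lambda>j. \<Sum>i. f (i, j)) sums infsum f UNIV"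
    by (auto dest: has_sum_imp_sums)
qed

lemma has_sum_sum:
  fixes f :: "'k \<Rightarrow> 'i \<Rightarrow> 'b::{topological_comm_monoid_add, t2_space}"
  assumes "\<And>k. k \<in> K \<Longrightarrow> (f k has_sum S k) I"
  shows "((\<lambda>i. \<Sum>k\<in>K. f k i) has_sum (\<Sum>k\<in>K. S k)) I"
  using assms by (induction K rule: infinite_finite_induct) (auto intro: has_sum_add)

definition exp_partial :: "nat \<Rightarrow> real \<Rightarrow> real" where
  "exp_partial n x = (\<Sum>k<n. x ^ k / fact k)"

text \<open>For \<open>\<sigma> = (-1)\<^sup>a\<close>, a block is a part of the holomorphic series \<open>Ecal\<close> together with the
  corresponding part of \<open>Ecal_minus\<close>, where the factor \<open>exp (- 4 \<pi> \<kappa> v)\<close> of \<open>Gamma_star\<close> turns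
  \<open>ee (- \<kappa> \<tau>)\<close> into \<open>cnj (ee (\<kappa> \<tau>))\<close>.\<close>

definition block_term :: "nat \<Rightarrow> complex \<Rightarrow> complex \<Rightarrow> real \<Rightarrow> complex \<Rightarrow> complex" where
  "block_term n \<sigma> c \<kappa> \<tau> = c * ee (of_real \<kappa> * \<tau>) +
     \<sigma> * of_real (exp_partial n (4 * pi * \<kappa> * Im \<tau>)) * cnj (c * ee (of_real \<kappa> * \<tau>))"

definition block :: "nat \<Rightarrow> complex \<Rightarrow> 'i set \<Rightarrow> ('i \<Rightarrow> complex) \<Rightarrow> ('i \<Rightarrow> real) \<Rightarrow> complex \<Rightarrow> complex" where
  "block n \<sigma> I c \<kappa> \<tau> = exp_series I c \<kappa> \<tau> +
     \<sigma> * (\<Sum>k<n. of_real ((4 * pi * Im \<tau>) ^ k / fact k) * cnj (exp_series I (\<lambda>i. c i * of_real (\<kappa> i) ^ k) \<kappa> \<tau>))"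

lemma exp_partial_series_summable:
  assumes "exp_summable I c \<kappa>" "Im \<tau> > 0"
  shows "((\<lambda>i. of_real (exp_partial n (4 * pi * \<kappa> i * Im \<tau>)) * cnj (c i * ee (of_real (\<kappa> i) * \<tau>))) has_sum
     (\<Sum>k<n. of_real ((4 * pi * Im \<tau>) ^ k / fact k) * cnj (exp_series I (\<lambda>i. c i * of_real (\<kappa> i) ^ k) \<kappa> \<tau>))) I"
proof -
  have "((\<lambda>i. \<Sum>k<n. of_real ((4 * pi * Im \<tau>) ^ k / fact k) * cnj (c i * of_real (\<kappa> i) ^ k * ee (of_real (\<kappa> i) * \<tau>))) has_sum
     (\<Sum>k<n. of_real ((4 * pi * Im \<tau>) ^ k / fact k) * cnj (exp_series I (\<lambda>i. c i * of_real (\<kappa> i) ^ k) \<kappa> \<tau>))) I"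
  proof (intro has_sum_sum has_sum_cmult_right)
    fix k
    have "((\<lambda>i. c i * of_real (\<kappa> i) ^ k * ee (of_real (\<kappa> i) * \<tau>)) has_sum exp_series I (\<lambda>i. c i * of_real (\<kappa> i) ^ k) \<kappa> \<tau>) I"
      unfolding exp_series_def
      by (intro has_sum_infsum exp_series_summable exp_summable_power_exponent assms)
    then show "((\<lambda>i. cnj (c i * of_real (\<kappa> i) ^ k * ee (of_real (\<kappa> i) * \<tau>))) has_sum cnj (exp_series I (\<lambda>i. c i * of_real (\<kappa> i) ^ k) \<kappa> \<tau>)) I"
      by (subst has_sum_cnj_iff)
  qed
  also have "(\<lambda>i. \<Sum>k<n. of_real ((4 * pi * Im \<tau>) ^ k / fact k) * cnj (c i * of_real (\<kappa> i) ^ k * ee (of_real (\<kappa> i) * \<tau>))) =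
      (\<lambda>i. of_real (exp_partial n (4 * pi * \<kappa> i * Im \<tau>)) * cnj (c i * ee (of_real (\<kappa> i) * \<tau>)))"
    unfolding exp_partial_def of_real_sum sum_distrib_right
    by (intro ext sum.cong) (simp_all add: power_mult_distrib)
  finally show ?thesis .
qed

lemma block_has_sum:
  assumes "exp_summable I c \<kappa>" "Im \<tau> > 0"
  shows "((\<lambda>i. block_term n \<sigma> (c i) (\<kappa> i) \<tau>) has_sum block n \<sigma> I c \<kappa> \<tau>) I"
proof -
  have "((\<lambda>i. c i * ee (of_real (\<kappa> i) * \<tau>)) has_sum exp_series I c \<kappa> \<tau>) I"
    unfolding exp_series_def by (intro has_sum_infsum exp_series_summable assms)
  from has_sum_add[OF this has_sum_cmult_right[OF exp_partial_series_summable[OF assms]]]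
  show ?thesis by (simp only: block_term_def block_def mult.assoc)
qed

text \<open>The pair \<open>(i, j)\<close> stands for \<open>m = i + 1\<close> and \<open>l = j + 1\<close>. Replacing \<open>(s, t)\<close> by \<open>(- s, - t)\<close>
  gives the data for the rows below the real axis; the row \<open>l = 0\<close> is kept apart because for \<open>a = 2\<close>
  and \<open>t = 0\<close> it converges only conditionally.\<close>

definition kplus :: "real \<Rightarrow> nat \<times> nat \<Rightarrow> real" where
  "kplus t = (\<lambda>(i, j). real (Suc i) * (real (Suc j) + t))"

definition czero :: "nat \<Rightarrow> real \<Rightarrow> nat \<Rightarrow> complex" where
  "czero n s i = ee (of_nat (Suc i) * of_real s) / of_nat (Suc i) ^ n"

definition cplus :: "nat \<Rightarrow> real \<Rightarrow> nat \<times> nat \<Rightarrow> complex" where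
  "cplus n s = (\<lambda>(i, j). czero n s i)"

lemma norm_czero_le: "norm (czero n s i) \<le> 1"
proof -
  have "1 \<le> real (Suc i) ^ n" by (rule one_le_power) auto
  then show ?thesis by (simp add: czero_def norm_divide norm_ee norm_power del: of_nat_Suc)
qed

lemma summable_on_exp_neg_nat:
  assumes "e > 0"
  shows "(\<lambda>i::nat. exp (- e * real i)) summable_on UNIV"
  by (rule norm_summable_imp_summable_on) (use summable_exp_neg[OF assms] in simp)

lemma summable_on_exp_neg_prod:
  assumes "e > 0"
  shows "(\<lambda>(i::nat, j::nat). exp (- e * (real (Suc i) * real (Suc j)))) summable_on UNIV"
proof -
  have e2: "e / 2 > 0" using assms by simp
  have "(\<lambda>(i::nat, j::nat). exp (- (e / 2) * real i) * exp (- (e / 2) * real j)) summable_on UNIV \<times> UNIV"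
  proof (rule summable_on_SigmaI)
    fix i
    show "((\<lambda>j. case (i, j) of (i, j) \<Rightarrow> exp (- (e / 2) * real i) * exp (- (e / 2) * real j)) has_sum
          exp (- (e / 2) * real i) * (\<Sum>\<^sub>\<infinity>j. exp (- (e / 2) * real j))) UNIV"
      unfolding prod.case by (intro has_sum_cmult_right has_sum_infsum summable_on_exp_neg_nat e2)
    show "(\<lambda>i. exp (- (e / 2) * real i) * (\<Sum>\<^sub>\<infinity>j. exp (- (e / 2) * real j))) summable_on UNIV"
      by (intro summable_on_cmult_left summable_on_exp_neg_nat e2)
  qed auto
  then show ?thesis unfolding UNIV_Times_UNIV
  proof (rule summable_on_comparison_real)
    fix x :: "nat \<times> nat"
    obtain i j where x: "x = (i, j)" by force
    have "1/2 * (real i + real j) \<le> real (Suc i) * real (Suc j)"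
      by (simp add: algebra_simps)
    then have "e * (1/2 * (real i + real j)) \<le> e * (real (Suc i) * real (Suc j))"
      using assms by (intro mult_left_mono) auto
    then show "(case x of (i, j) \<Rightarrow> exp (- e * (real (Suc i) * real (Suc j)))) \<le>
          (case x of (i, j) \<Rightarrow> exp (- (e / 2) * real i) * exp (- (e / 2) * real j))"
      by (simp add: x exp_add [symmetric] algebra_simps)
  qed auto
qed

lemma exp_summable_prodI:
  assumes \<rho>: "\<rho> > 0" and c: "\<And>i j. norm (c (i, j)) \<le> 1"
    and \<kappa>: "\<And>i j. \<kappa> (i, j) \<ge> \<rho> * (real (Suc i) * real (Suc j))"
  shows "exp_summable UNIV c \<kappa>"
  unfolding exp_summable_def
proof (intro conjI allI impI ballI)
  fix x :: "nat \<times> nat"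
  obtain i j where x: "x = (i, j)" by force
  show "\<kappa> x \<ge> 0" using order_trans[OF _ \<kappa>[of i j]] \<rho> by (auto simp: x)
next
  fix \<delta> :: real assume \<delta>: "\<delta> > 0"
  have "(\<lambda>(i::nat, j::nat). exp (- (\<delta> * \<rho>) * (real (Suc i) * real (Suc j)))) summable_on UNIV"
    by (rule summable_on_exp_neg_prod) (use \<rho> \<delta> in auto)
  then show "(\<lambda>i. norm (c i) * exp (- \<delta> * \<kappa> i)) summable_on UNIV"
  proof (rule summable_on_comparison_real)
    fix x :: "nat \<times> nat"
    obtain i j where x: "x = (i, j)" by force
    have "\<delta> * (\<rho> * (real (Suc i) * real (Suc j))) \<le> \<delta> * \<kappa> x"
      unfolding x using \<delta> by (intro mult_left_mono \<kappa>) auto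
    then have "exp (- \<delta> * \<kappa> x) \<le> exp (- (\<delta> * \<rho>) * (real (Suc i) * real (Suc j)))"
      by (simp add: mult_ac del: of_nat_Suc)
    moreover have "norm (c x) * exp (- \<delta> * \<kappa> x) \<le> 1 * exp (- \<delta> * \<kappa> x)"
      by (intro mult_right_mono) (auto simp: x c)
    ultimately have "norm (c x) * exp (- \<delta> * \<kappa> x) \<le> exp (- (\<delta> * \<rho>) * (real (Suc i) * real (Suc j)))"
      by linarith
    then show "norm (c x) * exp (- \<delta> * \<kappa> x) \<le> (case x of (i, j) \<Rightarrow> exp (- (\<delta> * \<rho>) * (real (Suc i) * real (Suc j))))"
      by (simp add: x)
  qed auto
qed

lemma exp_summable_kplus:
  assumes "-1 < t"  shows "exp_summable UNIV (cplus n s) (kplus t)"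
proof (rule exp_summable_prodI)
  show "min 1 (1 + t) > 0" using assms by simp
  show "norm (cplus n s (i, j)) \<le> 1" for i j by (simp add: cplus_def norm_czero_le)
  show "min 1 (1 + t) * (real (Suc i) * real (Suc j)) \<le> kplus t (i, j)" for i j
  proof -
    have "min 1 (1 + t) * real (Suc j) \<le> real (Suc j) + t"
    proof (cases "t \<ge> 0")
      case False
      then have "t * real j \<le> 0" by (simp add: mult_nonpos_nonneg)
      then show ?thesis using False by (simp add: algebra_simps)
    qed auto
    then have "real (Suc i) * (min 1 (1 + t) * real (Suc j)) \<le> real (Suc i) * (real (Suc j) + t)"
      by (rule mult_left_mono) auto
    then show ?thesis by (simp add: kplus_def mult_ac del: of_nat_Suc)
  qed
qed

text \<open>The floor moves by k and all summation ranges move with it; only combinations such as l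
  - t, z - l \<tau>, l + t and z + l \<tau> occur, which stay the same.\<close>

lemma Ecal_hat_translate_tau:
  assumes "Im \<tau> > 0"
  shows "Ecal_hat a (z + of_int k * \<tau>) \<tau> = Ecal_hat a z \<tau>"
proof -
  have t: "Im (z + of_int k * \<tau>) / Im \<tau> = Im z / Im \<tau> + of_int k"
    using assms by (simp add: field_simps)
  have f: "frac (x + of_int k) = frac x" for x :: real
    by (simp add: frac_def)
  show ?thesis
    unfolding Ecal_hat_def Ecal_minus_def Let_def t f
    by (simp add: algebra_simps)
qed

lemma exp_2_pi_i:
  "exp (of_real (2 * pi) * \<i> * z) = ee z"
  "exp (of_real (2 * pi) * \<i> * of_real m * w) = ee (of_real m * w)"
  "exp (of_real (- 2 * pi) * \<i> * of_real m * w) = ee (- (of_real m * w))"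
  by (simp_all add: ee_def mult_ac)

lemma Ecal_hat_translate_1: "Ecal_hat a (z + of_int k) \<tau> = Ecal_hat a z \<tau>"
proof -
  have 1: "ee (z + of_int k - w) = ee (z - w)" for w
    using ee_add[of "z - w" "of_int k"] by (simp add: algebra_simps)
  have 2: "ee (of_real (real (Suc i)) * (z + of_int k + w)) = ee (of_real (real (Suc i)) * (z + w))" for w i
  proof -
    have "of_real (real (Suc i)) * (z + of_int k + w) = of_real (real (Suc i)) * (z + w) + of_int (int (Suc i) * k)"
      by (simp add: algebra_simps)
    then show ?thesis by (simp only: ee_add ee_of_int mult_1_right)
  qed
  have 3: "ee (- (of_real (real (Suc i)) * (z + of_int k + w))) = ee (- (of_real (real (Suc i)) * (z + w)))" for w i
    using 2[of i w] by (simp only: ee_minus)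
  have 4: "ee (of_real (real (Suc i)) * (z + of_int k - w)) = ee (of_real (real (Suc i)) * (z - w))" for w i
    using 2[of i "-w"] by simp
  have 5: "Im (z + of_int k) = Im z" by simp
  show ?thesis
    unfolding Ecal_hat_def Ecal_minus_def Let_def Ecal_def Ecal_term_def exp_2_pi_i 1 3 4 5 ..
qed

lemma Gamma_star_times_ee:
  assumes "n \<ge> 1" "\<kappa> \<ge> 0" "Im \<tau> > 0"
  shows "of_real (Gamma_star n (4 * pi * \<kappa> * Im \<tau>)) * ee (of_real \<theta> - of_real \<kappa> * \<tau>) =
         of_real (exp_partial n (4 * pi * \<kappa> * Im \<tau>)) * cnj (ee (- of_real \<theta> + of_real \<kappa> * \<tau>))"
proof -
  have "- cnj (- of_real \<theta> + of_real \<kappa> * \<tau>) = (of_real \<theta> - of_real \<kappa> * \<tau>) + of_real (2 * \<kappa> * Im \<tau>) * \<i>"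
    by (simp add: complex_eq_iff algebra_simps)
  then have "cnj (ee (- of_real \<theta> + of_real \<kappa> * \<tau>)) = ee ((of_real \<theta> - of_real \<kappa> * \<tau>) + of_real (2 * \<kappa> * Im \<tau>) * \<i>)"
    by (simp only: cnj_ee)
  also have "\<dots> = ee (of_real \<theta> - of_real \<kappa> * \<tau>) * of_real (exp (- (4 * pi * \<kappa> * Im \<tau>)))"
    unfolding ee_add by (simp add: ee_def exp_of_real [symmetric] mult_ac)
  finally show ?thesis
    using Gamma_star_conv_sum[OF assms(1), of "4 * pi * \<kappa> * Im \<tau>"] assms(2,3)
    by (simp add: exp_partial_def mult_ac)
qed

text \<open>Expanding 1 / (1 - q^n) geometrically yields the rows l \<ge> 0 for positive n and the
  rows l \<ge> 1, with a sign, for negative n. The second sum of \<open>Ecal_minus\<close> supplies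
  the conjugate partners of the former, the first sum those of the latter. Only the row l = 0 needs
  a convergence assumption.\<close>

theorem Ecal_hat_expansion:
  fixes t s :: real and n :: nat
  defines "\<sigma> \<equiv> (-1) ^ Suc n"
  assumes v: "Im \<tau> > 0" and t: "0 \<le> t" "t < 1" and n: "n \<ge> 1"
    and summ: "summable (\<lambda>i. czero n s i * ee (of_real (real (Suc i) * t) * \<tau>))"
  shows "Ecal_hat (Suc n) (of_real t * \<tau> + of_real s) \<tau> =
     (\<Sum>i. czero n s i * ee (of_real (real (Suc i) * t) * \<tau>)) +
     \<sigma> * (\<Sum>i. of_real (exp_partial n (4 * pi * (real (Suc i) * t) * Im \<tau>)) * cnj (czero n s i * ee (of_real (real (Suc i) * t) * \<tau>))) +
     block n \<sigma> UNIV (cplus n s) (kplus t) \<tau> + \<sigma> * block n \<sigma> UNIV (cplus n (- s)) (kplus (- t)) \<tau>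
     - of_real ((- 4 * pi * Im \<tau>) ^ n * bernoulli_poly (Suc n) t / fact (Suc n))"
proof -
  define z where "z = of_real t * \<tau> + of_real s"
  define q where "q = ee \<tau>"
  have Imz: "Im z / Im \<tau> = t" using v by (simp add: z_def)
  have fl: "\<lfloor>t\<rfloor> = 0" "frac t = t" using t by (auto simp: floor_eq_iff frac_eq)
  have q: "norm (q ^ Suc i) < 1" for i
  proof -
    have "norm q < 1" using v by (simp add: q_def norm_ee)
    then show ?thesis unfolding norm_power by (intro power_less_one_iff[THEN iffD2]) auto
  qed
  have q1: "1 - q ^ Suc i \<noteq> 0" for i using q[of i] by auto
  define p where "p = (\<lambda>i. czero n s i * ee (of_real (real (Suc i) * t) * \<tau>))"
  define A where "A = (\<lambda>x. cplus n s x * ee (of_real (kplus t x) * \<tau>))"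
  define B where "B = (\<lambda>x. cplus n (- s) x * ee (of_real (kplus (- t) x) * \<tau>))"
  have Aeq: "A (i, j) = p i * (q ^ Suc i) ^ Suc j" for i j
  proof -
    have "of_real (kplus t (i, j)) * \<tau> = of_real (real (Suc i) * t) * \<tau> + of_nat (Suc j) * (of_nat (Suc i) * \<tau>)"
      by (simp add: kplus_def algebra_simps)
    then show ?thesis
      unfolding A_def p_def cplus_def q_def ee_power by (simp only: ee_add prod.case mult.assoc)
  qed
  have peq: "p i = ee z ^ Suc i / of_nat (Suc i) ^ n" for i
  proof -
    have "of_nat (Suc i) * z = of_nat (Suc i) * of_real s + of_real (real (Suc i) * t) * \<tau>"
      by (simp add: z_def algebra_simps)
    then show ?thesis by (simp only: p_def czero_def ee_power ee_add times_divide_eq_left)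
  qed
  have Beq: "B (i, j) = inverse (ee z) ^ Suc i / of_nat (Suc i) ^ n * (q ^ Suc i) ^ Suc j" for i j
  proof -
    have "of_nat (Suc i) * of_real (- s) + of_real (kplus (- t) (i, j)) * \<tau> = of_nat (Suc i) * (- z) + of_nat (Suc j) * (of_nat (Suc i) * \<tau>)"
      by (simp add: kplus_def z_def algebra_simps)
    from arg_cong[OF this, of ee] show ?thesis
      unfolding B_def czero_def cplus_def q_def ee_power ee_minus [symmetric]
      by (simp only: ee_add prod.case mult.assoc times_divide_eq_left)
  qed
  have es: "exp_summable UNIV (cplus n s) (kplus t)" "exp_summable UNIV (cplus n (- s)) (kplus (- t))"
    using t by (auto intro: exp_summable_kplus)
  have sA: "A summable_on UNIV" and sB: "B summable_on UNIV"
    unfolding A_def B_def by (rule exp_series_summable[OF es(1) v] exp_series_summable[OF es(2) v])+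
  have geo: "(\<lambda>j. (q ^ Suc i) ^ Suc j) sums (q ^ Suc i / (1 - q ^ Suc i))" for i
    using sums_mult[OF geometric_sums[OF q[of i]], of "q ^ Suc i"] by (simp add: mult_ac)
  have pos: "Ecal_term (Suc n) z \<tau> (int (Suc i)) = p i + (\<Sum>j. A (i, j))" for i
  proof -
    have "(\<Sum>j. A (i, j)) = p i * (q ^ Suc i / (1 - q ^ Suc i))"
      unfolding Aeq using sums_mult[OF geo[of i], of "p i"] by (rule sums_unique [symmetric])
    moreover have "Ecal_term (Suc n) z \<tau> (int (Suc i)) = p i / (1 - q ^ Suc i)"
      unfolding Ecal_term_def power_int_of_nat peq q_def exp_2_pi_i by simp
    moreover have "p i / (1 - Q) = p i + p i * (Q / (1 - Q))" if "1 - Q \<noteq> 0" for Q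
      using that by (simp add: field_simps)
    ultimately show ?thesis using q1[of i] by metis
  qed
  \<comment> \<open>For negative index, 1 / (1 - 1/Q) = - Q / (1 - Q) contributes one sign and the
    power of the index contributes (-1)^n; together they give \<sigma>.\<close>
  have neg: "Ecal_term (Suc n) z \<tau> (- int (Suc i)) = \<sigma> * (\<Sum>j. B (i, j))" for i
  proof -
    have "(\<Sum>j. B (i, j)) = inverse (ee z) ^ Suc i / of_nat (Suc i) ^ n * (q ^ Suc i / (1 - q ^ Suc i))"
      unfolding Beq using sums_mult[OF geo[of i]] by (rule sums_unique [symmetric])
    moreover have "Ecal_term (Suc n) z \<tau> (- int (Suc i)) =
        inverse (ee z) ^ Suc i / ((- of_nat (Suc i)) ^ n * (1 - inverse (q ^ Suc i)))"
      unfolding Ecal_term_def power_int_minus power_int_of_nat q_def exp_2_pi_i by (simp add: power_inverse)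
    moreover have "(- of_nat (Suc i) :: complex) ^ n = (- 1) ^ n * of_nat (Suc i) ^ n"
      by (rule power_minus)
    moreover have "Z / ((S * M) * (1 - inverse Q)) = - S * (Z / M * (Q / (1 - Q)))"
      if "S * S = 1" "1 - Q \<noteq> 0" "Q \<noteq> 0" for Z S M Q :: complex
    proof -
      have "1 - inverse Q = - ((1 - Q) / Q)" using that by (simp add: field_simps)
      moreover have "inverse S = S" using that(1) by (rule inverse_unique)
      ultimately show ?thesis by (simp add: divide_inverse mult_ac)
    qed
    moreover have "(- 1 :: complex) ^ n * (- 1) ^ n = 1" by (simp flip: power_mult_distrib)
    moreover have "q ^ Suc i \<noteq> 0" by (simp add: q_def)
    moreover have "- ((- 1) ^ n) = \<sigma>" by (simp add: \<sigma>_def)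
    ultimately show ?thesis
      using q1[of i] by metis
  qed
  have E: "Ecal (Suc n) z \<tau> = (\<Sum>i. p i) + infsum A UNIV + \<sigma> * infsum B UNIV"
  proof -
    have "(\<lambda>i. p i + (\<Sum>j. A (i, j))) sums ((\<Sum>i. p i) + infsum A UNIV)"
      by (intro sums_add double_suminf_eq_infsum(3)[OF sA] summable_sums summ[folded p_def])
    moreover have "(\<lambda>i. \<sigma> * (\<Sum>j. B (i, j))) sums (\<sigma> * infsum B UNIV)"
      by (intro sums_mult double_suminf_eq_infsum(3)[OF sB])
    ultimately show ?thesis
      unfolding Ecal_def pos neg by (simp add: sums_unique [symmetric])
  qed
  define A' where "A' = (\<lambda>x. of_real (exp_partial n (4 * pi * kplus t x * Im \<tau>)) * cnj (A x))"
  define B' where "B' = (\<lambda>x. of_real (exp_partial n (4 * pi * kplus (- t) x * Im \<tau>)) * cnj (B x))"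
  define p' where "p' = (\<lambda>i. of_real (exp_partial n (4 * pi * (real (Suc i) * t) * Im \<tau>)) * cnj (p i))"
  have hA': "(A' has_sum (\<Sum>k<n. of_real ((4 * pi * Im \<tau>) ^ k / fact k) * cnj (exp_series UNIV (\<lambda>i. cplus n s i * of_real (kplus t i) ^ k) (kplus t) \<tau>))) UNIV"
    unfolding A'_def A_def by (rule exp_partial_series_summable[OF es(1) v])
  have hB': "(B' has_sum (\<Sum>k<n. of_real ((4 * pi * Im \<tau>) ^ k / fact k) * cnj (exp_series UNIV (\<lambda>i. cplus n (- s) i * of_real (kplus (- t) i) ^ k) (kplus (- t)) \<tau>))) UNIV"
    unfolding B'_def B_def by (rule exp_partial_series_summable[OF es(2) v])
  have sA': "A' summable_on UNIV" and sB': "B' summable_on UNIV"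
    using hA' hB' by (auto simp: summable_on_def)
  have M1: "of_real (Gamma_star n (4 * pi * real (Suc i) * (of_int (1 + 0 + int j) - t) * Im \<tau>) / real (Suc i) ^ n) *
       ee (of_real (real (Suc i)) * (z - of_int (1 + 0 + int j) * \<tau>)) = B' (i, j)" for i j
  proof -
    define \<kappa> where "\<kappa> = kplus (- t) (i, j)"
    have \<kappa>: "\<kappa> \<ge> 0" unfolding \<kappa>_def kplus_def using t by (auto intro!: mult_nonneg_nonneg)
    have 1: "4 * pi * real (Suc i) * (of_int (1 + 0 + int j) - t) * Im \<tau> = 4 * pi * \<kappa> * Im \<tau>"
      by (simp add: \<kappa>_def kplus_def)
    have 2: "of_real (real (Suc i)) * (z - of_int (1 + 0 + int j) * \<tau>) = of_real (real (Suc i) * s) - of_real \<kappa> * \<tau>"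
      by (simp add: \<kappa>_def kplus_def z_def algebra_simps)
    have 3: "B (i, j) = ee (- of_real (real (Suc i) * s) + of_real \<kappa> * \<tau>) / of_nat (Suc i) ^ n"
      unfolding \<kappa>_def [symmetric] B_def cplus_def czero_def prod.case ee_add by simp
    show ?thesis
      using Gamma_star_times_ee[OF n \<kappa> v, of "real (Suc i) * s"]
      unfolding 1 2 B'_def 3 \<kappa>_def [symmetric] by (simp del: of_nat_Suc)
  qed
  \<comment> \<open>This sum starts at l = 0 while the pairs of \<open>kplus\<close> start at l = 1,
    hence the case distinction on j.\<close>
  have M2: "of_real (Gamma_star n (4 * pi * real (Suc i) * (of_int (- 0 + int j) + t) * Im \<tau>) / real (Suc i) ^ n) *
       ee (- (of_real (real (Suc i)) * (z + of_int (- 0 + int j) * \<tau>))) = (case j of 0 \<Rightarrow> p' i | Suc j \<Rightarrow> A' (i, j))" for i j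
  proof -
    define \<kappa> where "\<kappa> = real (Suc i) * (real j + t)"
    have \<kappa>: "\<kappa> \<ge> 0" unfolding \<kappa>_def using t by (auto intro!: mult_nonneg_nonneg)
    have 1: "4 * pi * real (Suc i) * (of_int (- 0 + int j) + t) * Im \<tau> = 4 * pi * \<kappa> * Im \<tau>"
      by (simp add: \<kappa>_def)
    have 2: "- (of_real (real (Suc i)) * (z + of_int (- 0 + int j) * \<tau>)) = of_real (- real (Suc i) * s) - of_real \<kappa> * \<tau>"
      by (simp add: \<kappa>_def z_def algebra_simps)
    have 3: "(case j of 0 \<Rightarrow> p' i | Suc j \<Rightarrow> A' (i, j)) =
       of_real (exp_partial n (4 * pi * \<kappa> * Im \<tau>)) * cnj (ee (- of_real (- real (Suc i) * s) + of_real \<kappa> * \<tau>) / of_nat (Suc i) ^ n)"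
    proof -
      have "- of_real (- real (Suc i) * s) = of_nat (Suc i) * complex_of_real s" by (simp add: algebra_simps)
      then show ?thesis
      unfolding ee_add \<kappa>_def
      by (cases j) (simp_all add: p'_def p_def A'_def A_def cplus_def kplus_def czero_def del: of_nat_Suc)
    qed
    show ?thesis
      using Gamma_star_times_ee[OF n \<kappa> v, of "- real (Suc i) * s"]
      unfolding 1 2 3 by (simp del: of_nat_Suc)
  qed
  have M: "Ecal_minus (Suc n) z \<tau> = infsum B' UNIV + \<sigma> * ((\<Sum>i. p' i) + infsum A' UNIV)"
  proof -
    have "(\<lambda>j. \<Sum>i. A' (i, j)) sums infsum A' UNIV"
      by (rule double_suminf_eq_infsum(4)[OF sA'])
    then have "(\<lambda>j. case j of 0 \<Rightarrow> \<Sum>i. p' i | Suc j \<Rightarrow> \<Sum>i. A' (i, j)) sums (infsum A' UNIV + (\<Sum>i. p' i))"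
      using sums_Suc_iff [of "\<lambda>j. case j of 0 \<Rightarrow> \<Sum>i. p' i | Suc j \<Rightarrow> \<Sum>i. A' (i, j)" "infsum A' UNIV"] by simp
    also have "(\<lambda>j. case j of 0 \<Rightarrow> \<Sum>i. p' i | Suc j \<Rightarrow> \<Sum>i. A' (i, j)) = (\<lambda>j. \<Sum>i. case j of 0 \<Rightarrow> p' i | Suc j \<Rightarrow> A' (i, j))"
      by (auto simp: fun_eq_iff split: nat.split)
    finally have 2: "(\<lambda>j. \<Sum>i. case j of 0 \<Rightarrow> p' i | Suc j \<Rightarrow> A' (i, j)) sums (infsum A' UNIV + (\<Sum>i. p' i))" .
    have 1: "(\<lambda>j. \<Sum>i. B' (i, j)) sums infsum B' UNIV"
      by (rule double_suminf_eq_infsum(4)[OF sB'])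
    show ?thesis
      unfolding Ecal_minus_def Let_def Imz fl(1) exp_2_pi_i diff_Suc_1 M1 M2
      using 1 2 by (simp add: sums_unique [symmetric] \<sigma>_def add.commute)
  qed
  have bA: "block n \<sigma> UNIV (cplus n s) (kplus t) \<tau> = infsum A UNIV + \<sigma> * infsum A' UNIV"
    unfolding block_def infsumI[OF hA'] by (simp add: exp_series_def A_def)
  have bB: "block n \<sigma> UNIV (cplus n (- s)) (kplus (- t)) \<tau> = infsum B UNIV + \<sigma> * infsum B' UNIV"
    unfolding block_def infsumI[OF hB'] by (simp add: exp_series_def B_def)
  \<comment> \<open>The block below the axis carries \<sigma> outside and inside, so its conjugate
    part appears without a sign, as in the first sum of \<open>Ecal_minus\<close>.\<close>
  have \<sigma>\<sigma>: "\<sigma> * (\<sigma> * x) = x" for x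
    by (simp add: \<sigma>_def mult.assoc [symmetric] flip: power_mult_distrib)
  have "Ecal_hat (Suc n) z \<tau> = Ecal (Suc n) z \<tau> - of_real ((- 4 * pi * Im \<tau>) ^ n * bernoulli_poly (Suc n) t / fact (Suc n)) + Ecal_minus (Suc n) z \<tau>"
    unfolding Ecal_hat_def Let_def Imz fl by simp
  also have "\<dots> = (\<Sum>i. p i) + \<sigma> * (\<Sum>i. p' i) + block n \<sigma> UNIV (cplus n s) (kplus t) \<tau> + \<sigma> * block n \<sigma> UNIV (cplus n (- s)) (kplus (- t)) \<tau>
     - of_real ((- 4 * pi * Im \<tau>) ^ n * bernoulli_poly (Suc n) t / fact (Suc n))"
    unfolding E M bA bB by (simp add: ring_distribs \<sigma>\<sigma>)
  finally show ?thesis unfolding z_def p'_def p_def .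
qed

section \<open>Harmonicity and growth\<close>

text \<open>A relation in place of the operator \<open>wirtinger_bar\<close>: it includes real
  differentiability, so the sum, product and chain rules compose without side conditions.\<close>

definition has_wbar :: "(complex \<Rightarrow> complex) \<Rightarrow> complex \<Rightarrow> complex \<Rightarrow> bool" where
  "has_wbar f D \<tau> \<longleftrightarrow> (\<exists>f'. (f has_derivative f') (at \<tau>) \<and> D = (f' 1 + \<i> * f' \<i>) / 2)"

lemma wirtinger_bar_eq: "has_wbar f D \<tau> \<Longrightarrow> wirtinger_bar f \<tau> = D"
  unfolding has_wbar_def wirtinger_bar_def using frechet_derivative_at by metis

lemma has_wbar_unique: "has_wbar f D \<tau> \<Longrightarrow> has_wbar f D' \<tau> \<Longrightarrow> D = D'"
  using wirtinger_bar_eq by metis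

lemma has_wbar_cong:
  assumes "has_wbar f D \<tau>" "open S" "\<tau> \<in> S" "\<And>w. w \<in> S \<Longrightarrow> f w = g w"
  shows "has_wbar g D \<tau>"
  using assms has_derivative_transform_within_open[of f _ \<tau> UNIV S g] unfolding has_wbar_def by metis

lemma has_wbar_const: "has_wbar (\<lambda>_. c) 0 \<tau>"
  unfolding has_wbar_def by (rule exI[of _ "\<lambda>_. 0"]) auto

lemma has_wbar_add: "has_wbar f D \<tau> \<Longrightarrow> has_wbar g E \<tau> \<Longrightarrow> has_wbar (\<lambda>w. f w + g w) (D + E) \<tau>"
  unfolding has_wbar_def
proof (elim exE conjE)
  fix f' g' assume *: "(f has_derivative f') (at \<tau>)" "(g has_derivative g') (at \<tau>)"
    and D: "D = (f' 1 + \<i> * f' \<i>) / 2" "E = (g' 1 + \<i> * g' \<i>) / 2"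
  show "\<exists>h. ((\<lambda>w. f w + g w) has_derivative h) (at \<tau>) \<and> D + E = (h 1 + \<i> * h \<i>) / 2"
    by (rule exI, rule conjI, rule has_derivative_add[OF *]) (simp add: D field_simps)
qed

lemma has_wbar_mult:
  "has_wbar f D \<tau> \<Longrightarrow> has_wbar g E \<tau> \<Longrightarrow> has_wbar (\<lambda>w. f w * g w) (f \<tau> * E + D * g \<tau>) \<tau>"
  unfolding has_wbar_def
proof (elim exE conjE)
  fix f' g' assume *: "(f has_derivative f') (at \<tau>)" "(g has_derivative g') (at \<tau>)"
    and D: "D = (f' 1 + \<i> * f' \<i>) / 2" "E = (g' 1 + \<i> * g' \<i>) / 2"
  show "\<exists>h. ((\<lambda>w. f w * g w) has_derivative h) (at \<tau>) \<and> f \<tau> * E + D * g \<tau> = (h 1 + \<i> * h \<i>) / 2"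
    by (rule exI, rule conjI, rule has_derivative_mult[OF *]) (simp add: D field_simps)
qed

lemma has_wbar_cmult: "has_wbar f D \<tau> \<Longrightarrow> has_wbar (\<lambda>w. c * f w) (c * D) \<tau>"
  using has_wbar_mult[OF has_wbar_const] by force

lemma has_wbar_sum:
  "(\<And>k. k \<in> K \<Longrightarrow> has_wbar (f k) (D k) \<tau>) \<Longrightarrow> has_wbar (\<lambda>w. \<Sum>k\<in>K. f k w) (\<Sum>k\<in>K. D k) \<tau>"
  by (induction K rule: infinite_finite_induct) (auto intro: has_wbar_add has_wbar_const)

lemma has_wbar_holomorphic: "(f has_field_derivative f') (at \<tau>) \<Longrightarrow> has_wbar f 0 \<tau>"
  unfolding has_wbar_def has_field_derivative_def by (rule exI[of _ "(*) f'"]) (auto simp: complex_eq_iff)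

lemma has_wbar_cnj_holomorphic:
  assumes "(f has_field_derivative f') (at \<tau>)"
  shows "has_wbar (\<lambda>w. cnj (f w)) (cnj f') \<tau>"
  unfolding has_wbar_def
proof (intro exI conjI)
  show "((\<lambda>w. cnj (f w)) has_derivative (\<lambda>h. cnj (f' * h))) (at \<tau>)"
    using assms has_derivative_cnj unfolding has_field_derivative_def by blast
qed (simp add: complex_eq_iff)

lemma has_wbar_real:
  assumes "(g has_real_derivative g') (at (Im \<tau>))"
  shows "has_wbar (\<lambda>w. of_real (g (Im w))) (\<i> / 2 * of_real g') \<tau>"
  unfolding has_wbar_def
proof (intro exI conjI)
  have "((\<lambda>w. g (Im w)) has_derivative (\<lambda>h. g' * Im h)) (at \<tau>)"
    using has_derivative_compose[OF bounded_linear_imp_has_derivative[OF bounded_linear_Im] assms[unfolded has_field_derivative_def]] .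
  then show "((\<lambda>w. complex_of_real (g (Im w))) has_derivative (\<lambda>h. complex_of_real (g' * Im h))) (at \<tau>)"
    by (rule has_derivative_of_real)
qed simp

text \<open>The condition on the derivative says that \<open>\<xi>\<close> in weight \<open>1 - n\<close> maps the function to a holomorphic
  one; unlike harmonicity in this weight it is phrased so that it can be checked part by part.\<close>

definition preharmonic :: "nat \<Rightarrow> (complex \<Rightarrow> complex) \<Rightarrow> bool" where
  "preharmonic n f \<longleftrightarrow> smooth_on f upper_half_plane \<and>
     (\<exists>h. h holomorphic_on upper_half_plane \<and>
        (\<forall>\<tau>\<in>upper_half_plane. has_wbar f (of_real (Im \<tau> ^ (n - 1)) * cnj (h \<tau>)) \<tau>)) \<and>
     (\<exists>C. \<forall>\<tau>. Im \<tau> \<ge> 1 \<longrightarrow> norm (f \<tau>) \<le> C * Im \<tau> ^ n)"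

lemma preharmonic_cong:
  assumes "preharmonic n f" "\<And>\<tau>. Im \<tau> > 0 \<Longrightarrow> f \<tau> = g \<tau>"
  shows "preharmonic n g"
proof -
  have "smooth_on g upper_half_plane"
    by (rule smooth_on_cong[OF open_upper_half_plane, of f])
       (use assms in \<open>auto simp: preharmonic_def upper_half_plane_def\<close>)
  moreover have "has_wbar g D \<tau>" if "has_wbar f D \<tau>" "\<tau> \<in> upper_half_plane" for D \<tau>
    using that(1) open_upper_half_plane that(2) by (rule has_wbar_cong) (use assms in \<open>auto simp: upper_half_plane_def\<close>)
  moreover have "norm (g \<tau>) = norm (f \<tau>)" if "Im \<tau> \<ge> 1" for \<tau>
    using assms(2)[of \<tau>] that by auto
  ultimately show ?thesis using assms(1) unfolding preharmonic_def by metis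
qed

lemma preharmonic_add:
  assumes "preharmonic n f" "preharmonic n g"
  shows "preharmonic n (\<lambda>\<tau>. f \<tau> + g \<tau>)"
proof -
  obtain h C where h: "smooth_on f upper_half_plane" "h holomorphic_on upper_half_plane"
    "\<And>\<tau>. \<tau> \<in> upper_half_plane \<Longrightarrow> has_wbar f (of_real (Im \<tau> ^ (n - 1)) * cnj (h \<tau>)) \<tau>"
    "\<And>\<tau>. Im \<tau> \<ge> 1 \<Longrightarrow> norm (f \<tau>) \<le> C * Im \<tau> ^ n"
    using assms(1) unfolding preharmonic_def by auto
  obtain h' C' where h': "smooth_on g upper_half_plane" "h' holomorphic_on upper_half_plane"
    "\<And>\<tau>. \<tau> \<in> upper_half_plane \<Longrightarrow> has_wbar g (of_real (Im \<tau> ^ (n - 1)) * cnj (h' \<tau>)) \<tau>"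
    "\<And>\<tau>. Im \<tau> \<ge> 1 \<Longrightarrow> norm (g \<tau>) \<le> C' * Im \<tau> ^ n"
    using assms(2) unfolding preharmonic_def by auto
  show ?thesis
    unfolding preharmonic_def
  proof (intro conjI exI ballI allI impI)
    show "smooth_on (\<lambda>\<tau>. f \<tau> + g \<tau>) upper_half_plane"
      by (intro smooth_intros open_upper_half_plane h h')
    show "(\<lambda>\<tau>. h \<tau> + h' \<tau>) holomorphic_on upper_half_plane"
      by (intro holomorphic_intros h h')
    show "has_wbar (\<lambda>\<tau>. f \<tau> + g \<tau>) (of_real (Im \<tau> ^ (n - 1)) * cnj (h \<tau> + h' \<tau>)) \<tau>"
      if "\<tau> \<in> upper_half_plane" for \<tau>
      using has_wbar_add[OF h(3) h'(3), OF that that] by (simp add: ring_distribs)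
    show "norm (f \<tau> + g \<tau>) \<le> (C + C') * Im \<tau> ^ n" if "Im \<tau> \<ge> 1" for \<tau>
      using h(4)[OF that] h'(4)[OF that] norm_triangle_ineq[of "f \<tau>" "g \<tau>"] by (simp add: ring_distribs)
  qed
qed

lemma preharmonic_cmult:
  assumes "preharmonic n f"
  shows "preharmonic n (\<lambda>\<tau>. c * f \<tau>)"
proof -
  obtain h C where h: "smooth_on f upper_half_plane" "h holomorphic_on upper_half_plane"
    "\<And>\<tau>. \<tau> \<in> upper_half_plane \<Longrightarrow> has_wbar f (of_real (Im \<tau> ^ (n - 1)) * cnj (h \<tau>)) \<tau>"
    "\<And>\<tau>. Im \<tau> \<ge> 1 \<Longrightarrow> norm (f \<tau>) \<le> C * Im \<tau> ^ n"
    using assms(1) unfolding preharmonic_def by auto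
  show ?thesis
    unfolding preharmonic_def
  proof (intro conjI exI ballI allI impI)
    show "smooth_on (\<lambda>\<tau>. c * f \<tau>) upper_half_plane"
      by (intro smooth_intros open_upper_half_plane h)
    show "(\<lambda>\<tau>. cnj c * h \<tau>) holomorphic_on upper_half_plane"
      by (intro holomorphic_intros h)
    show "has_wbar (\<lambda>\<tau>. c * f \<tau>) (of_real (Im \<tau> ^ (n - 1)) * cnj (cnj c * h \<tau>)) \<tau>"
      if "\<tau> \<in> upper_half_plane" for \<tau>
      using has_wbar_cmult[OF h(3)[OF that], of c] by (simp add: mult_ac)
    show "norm (c * f \<tau>) \<le> (norm c * C) * Im \<tau> ^ n" if "Im \<tau> \<ge> 1" for \<tau>
      using mult_left_mono[OF h(4)[OF that], of "norm c"] by (simp add: norm_mult mult.assoc)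
  qed
qed

lemma preharmonic_const: "preharmonic n (\<lambda>_. c)"
  unfolding preharmonic_def
proof (intro conjI exI ballI allI impI)
  show "(\<lambda>\<tau>. 0) holomorphic_on upper_half_plane" by simp
  show "has_wbar (\<lambda>_. c) (of_real (Im \<tau> ^ (n - 1)) * cnj 0) \<tau>" for \<tau>
    using has_wbar_const by simp
  show "norm c \<le> norm c * Im \<tau> ^ n" if "Im \<tau> \<ge> 1" for \<tau>
    using mult_left_mono[OF one_le_power[OF that, of n], of "norm c"] by simp
qed (rule smooth_on_const)

lemma preharmonic_Im_power:
  assumes "n \<ge> 1"
  shows "preharmonic n (\<lambda>\<tau>. of_real (Im \<tau> ^ n))"
  unfolding preharmonic_def
proof (intro conjI exI ballI allI impI)
  show "(\<lambda>\<tau>. cnj (\<i> / 2 * of_nat n)) holomorphic_on upper_half_plane" by simp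
  show "has_wbar (\<lambda>\<tau>. of_real (Im \<tau> ^ n)) (of_real (Im \<tau> ^ (n - 1)) * cnj (cnj (\<i> / 2 * of_nat n))) \<tau>" for \<tau>
    using has_wbar_real[OF DERIV_pow[of n "Im \<tau>" UNIV]] by (simp add: mult_ac)
  show "norm (complex_of_real (Im \<tau> ^ n)) \<le> 1 * Im \<tau> ^ n" if "Im \<tau> \<ge> 1" for \<tau>
    using that by (simp add: norm_power)
  show "smooth_on (\<lambda>\<tau>. complex_of_real (Im \<tau> ^ n)) upper_half_plane"
    unfolding of_real_power by (intro smooth_intros open_upper_half_plane)
qed

text \<open>The bound holds because on Im \<tau> \<ge> 1 each series is dominated by its sum of
  absolute values at height 1, and every power of v that occurs is at most v^n.\<close>

lemma preharmonic_block:
  assumes es: "exp_summable I c \<kappa>" and n: "n \<ge> 1"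
  shows "preharmonic n (block n \<sigma> I c \<kappa>)"
proof -
  define S where "S = (\<lambda>k. exp_series I (\<lambda>i. c i * of_real (\<kappa> i) ^ k) \<kappa>)"
  have es': "exp_summable I (\<lambda>i. c i * of_real (\<kappa> i) ^ k) \<kappa>" for k
    by (rule exp_summable_power_exponent[OF es])
  have dS: "(S k has_field_derivative 2 * of_real pi * \<i> * S (Suc k) \<tau>) (at \<tau>)" if "Im \<tau> > 0" for k \<tau>
    using exp_series_has_field_derivative[OF es'[of k] that] by (simp add: S_def mult_ac)
  have holS: "S k holomorphic_on upper_half_plane" for k
    unfolding S_def by (rule exp_series_holomorphic[OF es'])
  have block: "block n \<sigma> I c \<kappa> \<tau> = S 0 \<tau> + \<sigma> * (\<Sum>k<n. of_real ((4 * pi * Im \<tau>) ^ k / fact k) * cnj (S k \<tau>))" for \<tau>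
    by (simp add: block_def S_def)
  show ?thesis
    unfolding preharmonic_def
  proof (intro conjI exI ballI allI impI)
    have "smooth_on (\<lambda>\<tau>. S 0 \<tau> + \<sigma> * (\<Sum>k<n. (of_real ((4 * pi) ^ k / fact k) * of_real (Im \<tau>) ^ k) * cnj (S k \<tau>))) upper_half_plane"
      by (intro smooth_intros open_upper_half_plane smooth_on_holomorphic holS)
    then show "smooth_on (block n \<sigma> I c \<kappa>) upper_half_plane"
      by (simp add: block [abs_def] power_mult_distrib)
    show "(\<lambda>\<tau>. cnj (\<sigma> * of_real ((4 * pi) ^ (n - 1) / fact (n - 1)) * cnj (2 * of_real pi * \<i>)) * S n \<tau>) holomorphic_on upper_half_plane"
      by (intro holomorphic_intros holS)
    fix \<tau> assume "\<tau> \<in> upper_half_plane"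
    then have v: "Im \<tau> > 0" by (simp add: upper_half_plane_def)
    \<comment> \<open>In the k-th term, differentiating the conjugated series gives
      \<open>T (Suc k)\<close>, and differentiating the power of v gives \<open>- T k\<close>, the
      sign coming from cnj(2 pi i) = - 2 pi i. The value at k = 0 is set to 0 because v^0 is
      constant.\<close>
    define T where "T = (\<lambda>k. (if k = 0 then 0 else of_real ((4 * pi * Im \<tau>) ^ (k - 1) / fact (k - 1)) * cnj (2 * of_real pi * \<i> * S k \<tau>)))"
    have T0: "T 0 = 0" by (simp add: T_def)
    have "has_wbar (\<lambda>\<tau>. of_real ((4 * pi * Im \<tau>) ^ k / fact k) * cnj (S k \<tau>)) (T (Suc k) - T k) \<tau>" for k
    proof -
      have "((\<lambda>x. (4 * pi * x) ^ k / fact k) has_real_derivative 4 * pi * (real k * (4 * pi * Im \<tau>) ^ (k - 1) / fact k)) (at (Im \<tau>))"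
        by (rule derivative_eq_intros refl | simp)+
      from has_wbar_mult[OF has_wbar_real[OF this] has_wbar_cnj_holomorphic[OF dS[OF v]]]
      have "has_wbar (\<lambda>\<tau>. of_real ((4 * pi * Im \<tau>) ^ k / fact k) * cnj (S k \<tau>))
         (of_real ((4 * pi * Im \<tau>) ^ k / fact k) * cnj (2 * of_real pi * \<i> * S (Suc k) \<tau>) +
          \<i> / 2 * of_real (4 * pi * (real k * (4 * pi * Im \<tau>) ^ (k - 1) / fact k)) * cnj (S k \<tau>)) \<tau>" .
      moreover have "\<i> / 2 * of_real (4 * pi * (real k * (4 * pi * Im \<tau>) ^ (k - 1) / fact k)) * cnj (S k \<tau>) = - T k"
      proof (cases k)
        case (Suc j)
        have "real k * (4 * pi * Im \<tau>) ^ (k - 1) / fact k = (4 * pi * Im \<tau>) ^ (k - 1) / fact (k - 1)"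
          by (simp add: Suc fact_Suc del: of_nat_Suc)
        then show ?thesis unfolding T_def using Suc by simp
      qed (simp add: T_def)
      moreover have "of_real ((4 * pi * Im \<tau>) ^ k / fact k) * cnj (2 * of_real pi * \<i> * S (Suc k) \<tau>) = T (Suc k)"
        unfolding T_def by (simp only: diff_Suc_1 nat.simps if_False)
      ultimately show ?thesis by (simp only: diff_conv_add_uminus)
    qed
    then have "has_wbar (\<lambda>\<tau>. \<Sum>k<n. of_real ((4 * pi * Im \<tau>) ^ k / fact k) * cnj (S k \<tau>)) (\<Sum>k<n. T (Suc k) - T k) \<tau>"
      by (intro has_wbar_sum)
    then have "has_wbar (\<lambda>\<tau>. \<Sum>k<n. of_real ((4 * pi * Im \<tau>) ^ k / fact k) * cnj (S k \<tau>)) (T n) \<tau>"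
      unfolding sum_lessThan_telescope by (simp only: T0 diff_zero)
    from has_wbar_add[OF has_wbar_holomorphic[OF dS[OF v]] has_wbar_cmult[OF this]]
    have "has_wbar (block n \<sigma> I c \<kappa>) (0 + \<sigma> * T n) \<tau>"
      by (simp only: block [abs_def])
    also have "0 + \<sigma> * T n = of_real (Im \<tau> ^ (n - 1)) * cnj (cnj (\<sigma> * of_real ((4 * pi) ^ (n - 1) / fact (n - 1)) * cnj (2 * of_real pi * \<i>)) * S n \<tau>)"
      using n by (simp add: T_def power_mult_distrib)
    finally show "has_wbar (block n \<sigma> I c \<kappa>) (of_real (Im \<tau> ^ (n - 1)) * cnj (cnj (\<sigma> * of_real ((4 * pi) ^ (n - 1) / fact (n - 1)) * cnj (2 * of_real pi * \<i>)) * S n \<tau>)) \<tau>" .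
  next
    define M where "M = (\<lambda>k. \<Sum>\<^sub>\<infinity>i\<in>I. norm (c i * of_real (\<kappa> i) ^ k) * exp (- (2 * pi) * \<kappa> i))"
    fix \<tau> :: complex assume v: "Im \<tau> \<ge> 1"
    have S: "norm (S k \<tau>) \<le> M k" for k
      unfolding S_def M_def by (rule exp_series_norm_le[OF es' v])
    have pw: "Im \<tau> ^ k \<le> Im \<tau> ^ n" if "k \<le> n" for k
      using that v by (rule power_increasing)
    have "norm (of_real ((4 * pi * Im \<tau>) ^ k / fact k) * cnj (S k \<tau>)) \<le> (4 * pi) ^ k / fact k * M k * Im \<tau> ^ n" if "k < n" for k
    proof -
      have "norm (of_real ((4 * pi * Im \<tau>) ^ k / fact k) * cnj (S k \<tau>)) = (4 * pi) ^ k / fact k * (norm (S k \<tau>) * Im \<tau> ^ k)"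
        using v by (simp add: norm_mult norm_power norm_divide power_mult_distrib)
      also have "\<dots> \<le> (4 * pi) ^ k / fact k * (M k * Im \<tau> ^ n)"
        using that v order_trans[OF norm_ge_zero S[of k]] by (intro mult_left_mono mult_mono S pw) auto
      finally show ?thesis by simp
    qed
    then have "norm (\<Sum>k<n. of_real ((4 * pi * Im \<tau>) ^ k / fact k) * cnj (S k \<tau>)) \<le> (\<Sum>k<n. (4 * pi) ^ k / fact k * M k * Im \<tau> ^ n)"
      by (intro sum_norm_le) auto
    then have "norm \<sigma> * norm (\<Sum>k<n. of_real ((4 * pi * Im \<tau>) ^ k / fact k) * cnj (S k \<tau>)) \<le> norm \<sigma> * (\<Sum>k<n. (4 * pi) ^ k / fact k * M k * Im \<tau> ^ n)"
      by (rule mult_left_mono) auto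
    moreover have "norm (S 0 \<tau>) \<le> M 0 * Im \<tau> ^ n"
      using mult_mono[OF S[of 0] pw[of 0]] order_trans[OF norm_ge_zero S[of 0]] by simp
    ultimately show "norm (block n \<sigma> I c \<kappa> \<tau>) \<le> (M 0 + norm \<sigma> * (\<Sum>k<n. (4 * pi) ^ k / fact k * M k)) * Im \<tau> ^ n"
      unfolding block
      by (intro order_trans[OF norm_triangle_ineq]) (simp add: norm_mult ring_distribs sum_distrib_right mult.assoc)
  qed
qed

section \<open>Harmonicity and growth of preharmonic functions\<close>

lemma xi_op_cong:
  assumes "open S" "\<tau> \<in> S" "\<And>w. w \<in> S \<Longrightarrow> f w = g w"
  shows "xi_op k f \<tau> = xi_op k g \<tau>"
  using frechet_derivative_cong_open[OF assms] by (simp add: xi_op_def wirtinger_bar_def)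

lemma xi_op_eq: "has_wbar f D \<tau> \<Longrightarrow> xi_op k f \<tau> = - 2 * \<i> * of_real (Im \<tau> powi k) * cnj D"
  by (simp add: xi_op_def wirtinger_bar_eq)

lemma xi_op_holomorphic:
  assumes "open S" "\<tau> \<in> S" "\<And>w. w \<in> S \<Longrightarrow> f w = g w" "g holomorphic_on S"
  shows "xi_op k f \<tau> = 0"
proof -
  have "has_wbar g 0 \<tau>"
    using holomorphic_derivI[OF assms(4,1,2)] by (rule has_wbar_holomorphic)
  then show ?thesis using xi_op_cong[OF assms(1-3)] xi_op_eq by simp
qed

text \<open>The factor v^(1-n) in the operator cancels v^(n-1) and the two conjugations cancel, so
  the first \<xi> produces -2 i h. This is holomorphic and is annihilated by the second.\<close>

lemma preharmonic_Delta:
  assumes f: "preharmonic n f" and n: "n \<ge> 1" and \<tau>: "\<tau> \<in> upper_half_plane"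
  shows "Delta_op (1 - int n) f \<tau> = 0"
proof -
  obtain h where h: "h holomorphic_on upper_half_plane"
    "\<And>\<tau>. \<tau> \<in> upper_half_plane \<Longrightarrow> has_wbar f (of_real (Im \<tau> ^ (n - 1)) * cnj (h \<tau>)) \<tau>"
    using f unfolding preharmonic_def by auto
  have "xi_op (1 - int n) f w = - 2 * \<i> * h w" if "w \<in> upper_half_plane" for w
  proof -
    have v: "Im w > 0" using that by (simp add: upper_half_plane_def)
    have "1 - int n = - int (n - 1)" using n by simp
    then have "Im w powi (1 - int n) * Im w ^ (n - 1) = 1"
      using v by (simp only: power_int_minus power_int_of_nat) simp
    then have "complex_of_real (Im w powi (1 - int n)) * of_real (Im w ^ (n - 1)) = 1"
      by (simp only: of_real_mult [symmetric] of_real_1)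
    then show ?thesis
      by (simp add: xi_op_eq[OF h(2)[OF that]] mult.assoc del: of_real_power)
  qed
  then show ?thesis
    unfolding Delta_op_def
    using xi_op_holomorphic[OF open_upper_half_plane \<tau>, of _ "\<lambda>w. - 2 * \<i> * h w"] h(1)
    by (simp add: holomorphic_intros)
qed

lemma power_le_exp:
  fixes x :: real assumes "x \<ge> 0" shows "x ^ n \<le> fact n * exp x"
proof -
  have "x ^ n / fact n \<le> (\<Sum>k. x ^ k / fact k)"
    using sum_le_suminf[OF summable_exp[of x], of "{n}"] assms by (simp add: divide_inverse mult.commute)
  also have "\<dots> = exp x" by (simp add: exp_def divide_inverse mult.commute)
  finally show ?thesis by (simp add: field_simps)
qed

lemma preharmonic_growth:
  assumes "preharmonic n f"
  shows "f \<in> O[filtercomap Im at_top](\<lambda>\<tau>. of_real (exp (1 * Im \<tau>)))"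
proof -
  obtain C where C: "\<And>\<tau>. Im \<tau> \<ge> 1 \<Longrightarrow> norm (f \<tau>) \<le> C * Im \<tau> ^ n"
    using assms unfolding preharmonic_def by auto
  have "eventually (\<lambda>\<tau>. Im \<tau> \<ge> 1) (filtercomap Im at_top)"
    using eventually_ge_at_top[of "1::real"] by (rule eventually_filtercomapI)
  then have "eventually (\<lambda>\<tau>. norm (f \<tau>) \<le> (\<bar>C\<bar> * fact n) * norm (complex_of_real (exp (1 * Im \<tau>)))) (filtercomap Im at_top)"
  proof eventually_elim
    case (elim \<tau>)
    have "norm (f \<tau>) \<le> C * Im \<tau> ^ n" by (rule C[OF elim])
    also have "\<dots> \<le> \<bar>C\<bar> * Im \<tau> ^ n" using elim by (intro mult_right_mono) auto
    also have "\<dots> \<le> \<bar>C\<bar> * (fact n * exp (Im \<tau>))" using elim by (intro mult_left_mono power_le_exp) auto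
    finally show ?case by simp
  qed
  then show ?thesis by (rule bigoI)
qed

lemma exp_summable_czero:
  assumes "t > 0"
  shows "exp_summable UNIV (czero n s) (\<lambda>i. real (Suc i) * t)"
  unfolding exp_summable_def
proof (intro conjI allI impI ballI)
  show "0 \<le> real (Suc i) * t" for i using assms by simp
  fix \<delta> :: real assume \<delta>: "\<delta> > 0"
  show "(\<lambda>i. norm (czero n s i) * exp (- \<delta> * (real (Suc i) * t))) summable_on UNIV"
  proof (rule summable_on_comparison_real[OF summable_on_exp_neg_nat[of "\<delta> * t"]])
    fix i
    have "norm (czero n s i) * exp (- \<delta> * (real (Suc i) * t)) \<le> 1 * exp (- (\<delta> * t) * real i)"
      using \<delta> assms by (intro mult_mono norm_czero_le) (auto simp: algebra_simps)
    then show "norm (czero n s i) * exp (- \<delta> * (real (Suc i) * t)) \<le> exp (- (\<delta> * t) * real i)" by simp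
  qed (use \<delta> assms in auto)
qed

theorem preharmonic_Ecal_hat:
  assumes t: "0 \<le> t" "t < 1" and n: "n \<ge> 1" and summ: "t = 0 \<Longrightarrow> summable (czero n s)"
  shows "preharmonic n (\<lambda>\<tau>. Ecal_hat (Suc n) (of_real t * \<tau> + of_real s) \<tau>)"
proof -
  define \<sigma> :: complex where "\<sigma> = (-1) ^ Suc n"
  \<comment> \<open>For t = 0 the row through z does not depend on \<tau> and enters as a constant.
    For t > 0 it is a block of its own, with exponents m t; the empty index set switches that block
    off when t = 0.\<close>
  define K where "K = (if t = 0 then (\<Sum>i. czero n s i) + \<sigma> * (\<Sum>i. of_real (exp_partial n 0) * cnj (czero n s i)) else 0)"
  define I where "I = (if t = 0 then {} else UNIV :: nat set)"
  have esI: "exp_summable I (czero n s) (\<lambda>i. real (Suc i) * t)"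
    using exp_summable_czero[of t n s] t by (auto simp: I_def exp_summable_def)
  define B where "B = (\<lambda>\<tau>. K + block n \<sigma> I (czero n s) (\<lambda>i. real (Suc i) * t) \<tau> +
     block n \<sigma> UNIV (cplus n s) (kplus t) \<tau> + \<sigma> * block n \<sigma> UNIV (cplus n (- s)) (kplus (- t)) \<tau>
     + of_real (- ((- 4 * pi) ^ n * bernoulli_poly (Suc n) t / fact (Suc n))) * of_real (Im \<tau> ^ n))"
  have "preharmonic n B"
    unfolding B_def
    using t n by (intro preharmonic_add preharmonic_cmult preharmonic_const preharmonic_block preharmonic_Im_power esI exp_summable_kplus) auto
  then show ?thesis
  proof (rule preharmonic_cong)
    fix \<tau> assume v: "Im \<tau> > 0"
    have S0: "summable (\<lambda>i. czero n s i * ee (of_real (real (Suc i) * t) * \<tau>))"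
    proof (cases "t = 0")
      case False
      then have "exp_summable UNIV (czero n s) (\<lambda>i. real (Suc i) * t)" using t by (intro exp_summable_czero) auto
      from exp_series_summable[OF this v] show ?thesis by (rule summable_on_imp_summable)
    qed (use summ in simp)
    have K0: "(\<Sum>i. czero n s i * ee (of_real (real (Suc i) * t) * \<tau>)) +
     \<sigma> * (\<Sum>i. of_real (exp_partial n (4 * pi * (real (Suc i) * t) * Im \<tau>)) * cnj (czero n s i * ee (of_real (real (Suc i) * t) * \<tau>)))
     = K + block n \<sigma> I (czero n s) (\<lambda>i. real (Suc i) * t) \<tau>"
    proof (cases "t = 0")
      case True
      then show ?thesis by (simp add: K_def I_def block_def exp_series_def)
    next
      case False
      then have es: "exp_summable UNIV (czero n s) (\<lambda>i. real (Suc i) * t)" using t by (intro exp_summable_czero) auto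
      note 1 = has_sum_imp_sums[OF exp_partial_series_summable[OF es v], THEN sums_unique]
      note 2 = has_sum_imp_sums[OF has_sum_infsum[OF exp_series_summable[OF es v]], THEN sums_unique]
      show ?thesis using False unfolding K_def I_def block_def 1[symmetric] 2[symmetric] exp_series_def by simp
    qed
    show "B \<tau> = Ecal_hat (Suc n) (of_real t * \<tau> + of_real s) \<tau>"
    proof -
      have "(- 4 * pi * Im \<tau>) ^ n = (- 4 * pi) ^ n * Im \<tau> ^ n"
        by (rule power_mult_distrib)
      then show ?thesis
        unfolding Ecal_hat_expansion[OF v t n S0] B_def \<sigma>_def[symmetric] K0 by simp
    qed
  qed
qed

section \<open>Summation over a lattice row\<close>

text \<open>Division by zero makes the term at \<open>(0, 0)\<close> vanish, so that sums over all pairs are sums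
  over the nonzero lattice vectors.\<close>

definition lat :: "nat \<Rightarrow> real \<Rightarrow> real \<Rightarrow> complex \<Rightarrow> int \<times> int \<Rightarrow> complex" where
  "lat n t s \<tau> = (\<lambda>(m, d). ee (of_real (of_int m * s + of_int d * t)) /
     ((of_int m * \<tau> - of_int d) * (of_int m * cnj \<tau> - of_int d) ^ n))"

lemma norm_lat: "norm (lat n t s \<tau> (m, d)) = inverse (norm (of_int m * \<tau> - of_int d) ^ Suc n)"
proof -
  have "norm (of_int m * cnj \<tau> - of_int d) = norm (cnj (of_int m * \<tau> - of_int d))" by simp
  also have "\<dots> = norm (of_int m * \<tau> - of_int d)" by (rule complex_mod_cnj)
  finally show ?thesis by (simp add: lat_def norm_divide norm_ee norm_mult norm_power inverse_eq_divide)
qed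

lemma summable_on_int_powr:
  "(\<lambda>d::int. (1 + \<bar>real_of_int d\<bar>) powr (- 3 / 2)) summable_on UNIV"
proof (rule summable_on_int_abs)
  have "summable (\<lambda>m::nat. real m powr (- 3 / 2))" by (subst summable_real_powr_iff) simp
  then show "summable (\<lambda>m. (1 + real m) powr (- 3 / 2))"
    using summable_Suc_iff[of "\<lambda>m. real m powr (- 3 / 2)"] by (simp add: add.commute)
qed auto

text \<open>The imaginary part controls |m|. If |d| is at least twice |m \<tau>|, the triangle
  inequality controls |d|; otherwise |d| is controlled through |m|. The three entries of the minimum
  defining \<open>c\<close> serve these three estimates.\<close>

lemma lattice_norm_lower_bound:
  assumes v: "Im \<tau> > 0"
  obtains c where "c > 0" "\<And>m d::int. c * \<bar>of_int m\<bar> \<le> norm (of_int m * \<tau> - of_int d)"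
    "\<And>m d::int. c * \<bar>of_int d\<bar> \<le> norm (of_int m * \<tau> - of_int d)"
proof -
  have \<tau>: "norm \<tau> > 0" using v by auto
  define c where "c = min (Im \<tau>) (min (1 / 2) (Im \<tau> / (2 * norm \<tau>)))"
  have c: "c > 0" "c \<le> Im \<tau>" "c \<le> 1 / 2" "c \<le> Im \<tau> / (2 * norm \<tau>)" using v \<tau> by (auto simp: c_def)
  have 1: "\<bar>of_int m\<bar> * Im \<tau> \<le> norm (of_int m * \<tau> - of_int d)" for m d :: int
    using abs_Im_le_cmod[of "of_int m * \<tau> - of_int d"] v by (simp add: abs_mult)
  show ?thesis
  proof (rule that[OF c(1)])
    fix m d :: int
    show "c * \<bar>of_int m\<bar> \<le> norm (of_int m * \<tau> - of_int d)"
      using mult_right_mono[OF c(2), of "\<bar>of_int m\<bar>"] 1[of m d] by (simp add: mult.commute)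
    show "c * \<bar>of_int d\<bar> \<le> norm (of_int m * \<tau> - of_int d)"
    proof (cases "2 * \<bar>of_int m\<bar> * norm \<tau> \<le> \<bar>of_int d\<bar>")
      case True
      have "\<bar>of_int d\<bar> \<le> norm (of_int m * \<tau> - of_int d) + norm (of_int m * \<tau>)"
        using norm_triangle_ineq4[of "of_int m * \<tau>" "of_int m * \<tau> - of_int d"] by simp
      then have "1 / 2 * \<bar>of_int d\<bar> \<le> norm (of_int m * \<tau> - of_int d)"
        using True by (simp add: norm_mult)
      then show ?thesis using mult_right_mono[OF c(3), of "\<bar>of_int d\<bar>"] by linarith
    next
      case False
      have "c * \<bar>of_int d\<bar> \<le> Im \<tau> / (2 * norm \<tau>) * (2 * \<bar>of_int m\<bar> * norm \<tau>)"
        using False v c by (intro mult_mono) auto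
      also have "\<dots> = \<bar>of_int m\<bar> * Im \<tau>" using \<tau> by (simp add: field_simps)
      finally show ?thesis using 1[of m d] by linarith
    qed
  qed
qed

text \<open>Away from the origin both 1 + |m| and 1 + |d| are at most a constant times |w|. Hence
  |w|^(-3) is dominated by the product of their powers with exponent -3/2, and each factor is
  summable over the integers.\<close>

lemma lat_abs_summable:
  assumes v: "Im \<tau> > 0" and n: "n \<ge> 2"
  shows "(\<lambda>x. norm (lat n t s \<tau> x)) summable_on UNIV"
proof -
  obtain c where c: "c > 0" "\<And>m d::int. c * \<bar>of_int m\<bar> \<le> norm (of_int m * \<tau> - of_int d)"
    "\<And>m d::int. c * \<bar>of_int d\<bar> \<le> norm (of_int m * \<tau> - of_int d)"
    using lattice_norm_lower_bound[OF v] by blast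
  define p where "p = (\<lambda>d::int. (1 + \<bar>real_of_int d\<bar>) powr (- 3 / 2))"
  have "(\<lambda>(m, d). p m * p d) summable_on UNIV \<times> UNIV"
  proof (rule summable_on_SigmaI)
    show "((\<lambda>d. case (m, d) of (m, d) \<Rightarrow> p m * p d) has_sum p m * infsum p UNIV) UNIV" for m
      unfolding prod.case using summable_on_int_powr
      by (intro has_sum_cmult_right has_sum_infsum) (simp add: p_def)
    show "(\<lambda>m. p m * infsum p UNIV) summable_on UNIV"
      using summable_on_int_powr by (intro summable_on_cmult_left) (simp add: p_def)
  qed (auto simp: p_def)
  then have "(\<lambda>x. inverse ((c / 2) ^ Suc n) * (case x of (m, d) \<Rightarrow> p m * p d)) summable_on UNIV"
    unfolding UNIV_Times_UNIV by (rule summable_on_cmult_right)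
  then show ?thesis
  proof (rule summable_on_comparison_real)
    fix x :: "int \<times> int"
    obtain m d where x: "x = (m, d)" by force
    define w where "w = norm (of_int m * \<tau> - of_int d)"
    show "norm (lat n t s \<tau> x) \<le> inverse ((c / 2) ^ Suc n) * (case x of (m, d) \<Rightarrow> p m * p d)"
    proof (cases "m = 0 \<and> d = 0")
      case True
      then show ?thesis using c(1) by (simp add: x norm_lat p_def)
    next
      case False
      define M where "M = 1 + \<bar>real_of_int m\<bar>"
      define D where "D = 1 + \<bar>real_of_int d\<bar>"
      have MD: "M \<ge> 1" "D \<ge> 1" by (auto simp: M_def D_def)
      have w1: "c * \<bar>of_int m\<bar> \<le> w" "c * \<bar>of_int d\<bar> \<le> w" using c by (auto simp: w_def)
      have cw: "c \<le> w"
      proof (cases "m = 0")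
        case True
        then have "1 \<le> \<bar>real_of_int d\<bar>" using False by linarith
        then show ?thesis using w1(2) mult_left_mono[of 1 "\<bar>real_of_int d\<bar>" c] c(1) by linarith
      next
        case False
        then have "1 \<le> \<bar>real_of_int m\<bar>" by linarith
        then show ?thesis using w1(1) mult_left_mono[of 1 "\<bar>real_of_int m\<bar>" c] c(1) by linarith
      qed
      then have wM: "c / 2 * M \<le> w" "c / 2 * D \<le> w" using w1 by (auto simp: M_def D_def algebra_simps)
      define u where "u = w / (c / 2)"
      have u: "M \<le> u" "D \<le> u" using wM c(1) by (auto simp: u_def field_simps)
      have u1: "u \<ge> 1" using u(1) MD(1) by linarith
      have "M powr (3 / 2) * D powr (3 / 2) \<le> u powr (3 / 2) * u powr (3 / 2)"
        using u MD by (intro mult_mono powr_mono2) auto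
      also have "\<dots> = u ^ 3" using u1 by (simp flip: powr_add powr_numeral)
      also have "\<dots> \<le> u ^ Suc n" using u1 n by (intro power_increasing) auto
      also have "\<dots> = w ^ Suc n / (c / 2) ^ Suc n" by (simp add: u_def power_divide)
      finally have le: "M powr (3 / 2) * D powr (3 / 2) \<le> w ^ Suc n / (c / 2) ^ Suc n" .
      have "inverse (w ^ Suc n / (c / 2) ^ Suc n) \<le> inverse (M powr (3 / 2) * D powr (3 / 2))"
        using MD by (intro le_imp_inverse_le le) auto
      also have "\<dots> = p m * p d"
        using MD by (simp add: p_def M_def D_def powr_minus)
      finally have "inverse (w ^ Suc n) * (c / 2) ^ Suc n \<le> p m * p d"
        by (simp add: field_simps)
      then have "inverse (w ^ Suc n) \<le> inverse ((c / 2) ^ Suc n) * (p m * p d)"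
        using c(1) pos_le_divide_eq[of "(c / 2) ^ Suc n" "inverse (w ^ Suc n)" "p m * p d"]
        by (simp only: divide_inverse[of "p m * p d"] mult.commute[of "p m * p d"]) simp
      then show ?thesis by (simp add: x norm_lat w_def)
    qed
  qed auto
qed

section \<open>Antiderivatives of truncated exponentials, with complex arguments\<close>

definition exp_partial_c :: "nat \<Rightarrow> complex \<Rightarrow> complex" where
  "exp_partial_c n x = (\<Sum>k<n. x ^ k / fact k)"

lemma exp_partial_c_of_real: "exp_partial_c n (of_real x) = of_real (exp_partial n x)"
  by (simp add: exp_partial_c_def exp_partial_def)

lemma exp_partial_c_0: "n \<ge> 1 \<Longrightarrow> exp_partial_c n 0 = 1"
proof -
  assume n: "n \<ge> 1"
  have "exp_partial_c n 0 = (\<Sum>k<n. if k = 0 then 1 else 0)"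
    unfolding exp_partial_c_def by (intro sum.cong) (auto simp: power_0_left)
  then show ?thesis using n by simp
qed

lemma exp_partial_0: "n \<ge> 1 \<Longrightarrow> exp_partial n 0 = 1"
  using exp_partial_c_0[of n] exp_partial_c_of_real[of n 0] by simp

lemma exp_partial_c_deriv:
  "(exp_partial_c (Suc n) has_field_derivative exp_partial_c n x) (at x)"
proof (induction n)
  case 0
  then show ?case by (simp add: exp_partial_c_def)
next
  case (Suc n)
  have "((\<lambda>x. exp_partial_c (Suc n) x + x ^ Suc n / fact (Suc n)) has_field_derivative exp_partial_c n x + x ^ n / fact n) (at x)"
    by (rule DERIV_add[OF Suc.IH]) (rule derivative_eq_intros refl | simp add: field_simps del: of_nat_Suc)+
  then show ?case by (simp add: exp_partial_c_def)
qed

lemma exp_partial_c_bound: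
  assumes "e > 0"
  obtains C where "C \<ge> 0" "\<And>x. x \<ge> 0 \<Longrightarrow> norm (exp_partial_c n (c * of_real x)) \<le> C * exp (e * x)"
proof (rule that)
  show "(\<Sum>k<n. (norm c / e) ^ k) \<ge> 0" using assms by (intro sum_nonneg) auto
  fix x :: real assume x: "x \<ge> 0"
  show "norm (exp_partial_c n (c * of_real x)) \<le> (\<Sum>k<n. (norm c / e) ^ k) * exp (e * x)"
    unfolding exp_partial_c_def sum_distrib_right
  proof (rule sum_norm_le)
    fix k
    have "norm ((c * of_real x) ^ k / fact k) = (norm c / e) ^ k * ((e * x) ^ k / fact k)"
      using assms x by (simp add: norm_divide norm_power norm_mult power_mult_distrib power_divide)
    also have "\<dots> \<le> (norm c / e) ^ k * exp (e * x)"
      using power_le_exp[of "e * x" k] assms x by (intro mult_left_mono) (auto simp: field_simps)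
    finally show "norm ((c * of_real x) ^ k / fact k) \<le> (norm c / e) ^ k * exp (e * x)" .
  qed
qed

text \<open>Integration by parts, using that the truncated exponential series \<open>E\<^sub>n\<close> satisfies
  \<open>(E\<^sub>n(x) e\<^sup>-\<^sup>x)' = - x\<^sup>n\<^sup>-\<^sup>1 e\<^sup>-\<^sup>x / (n - 1)!\<close>.\<close>

lemma incomplete_gamma_antiderivative:
  fixes c \<beta> :: complex
  defines "\<alpha> \<equiv> \<beta> - c"
  assumes n: "n \<ge> 1" and \<alpha>: "\<alpha> \<noteq> 0" and \<beta>: "\<beta> \<noteq> 0"
  shows "((\<lambda>x. - 1 / \<alpha> * (exp_partial_c n (c * x) * exp (- \<beta> * x) - (c / \<beta>) ^ n * (exp_partial_c n (\<beta> * x) * exp (- \<beta> * x))))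
     has_field_derivative exp_partial_c n (c * x) * exp (- \<beta> * x)) (at x)"
proof -
  obtain k where k: "n = Suc k" using n by (cases n) auto
  have d: "((\<lambda>x. exp_partial_c n (b * x)) has_field_derivative exp_partial_c k (b * x) * b) (at x)" for b
    unfolding k by (rule DERIV_chain2[OF exp_partial_c_deriv]) (auto intro!: derivative_eq_intros)
  have e: "exp_partial_c k y = exp_partial_c n y - y ^ k / fact k" for y
    by (simp add: k exp_partial_c_def)
  have "((\<lambda>x. - 1 / \<alpha> * (exp_partial_c n (c * x) * exp (- \<beta> * x) - (c / \<beta>) ^ n * (exp_partial_c n (\<beta> * x) * exp (- \<beta> * x))))
     has_field_derivative - 1 / \<alpha> * ((exp_partial_c k (c * x) * c * exp (- \<beta> * x) + exp (- \<beta> * x) * (- \<beta>) * exp_partial_c n (c * x)) -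
       (c / \<beta>) ^ n * (exp_partial_c k (\<beta> * x) * \<beta> * exp (- \<beta> * x) + exp (- \<beta> * x) * (- \<beta>) * exp_partial_c n (\<beta> * x)))) (at x)"
    by (rule d derivative_eq_intros refl | simp)+
  moreover have "(c / \<beta>) ^ n * (exp_partial_c k (\<beta> * x) * \<beta> * exp (- \<beta> * x) + exp (- \<beta> * x) * (- \<beta>) * exp_partial_c n (\<beta> * x)) =
     - (c * (c * x) ^ k / fact k * exp (- \<beta> * x))"
    unfolding e using \<beta> by (simp add: k power_mult_distrib power_divide field_simps)
  moreover have "exp_partial_c k (c * x) * c * exp (- \<beta> * x) + exp (- \<beta> * x) * (- \<beta>) * exp_partial_c n (c * x) =
     - \<alpha> * (exp_partial_c n (c * x) * exp (- \<beta> * x)) - c * (c * x) ^ k / fact k * exp (- \<beta> * x)"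
    unfolding e \<alpha>_def by (simp add: algebra_simps)
  ultimately show ?thesis using \<alpha> by simp
qed

text \<open>For \<open>\<tau>\<close> replaced by \<open>m\<tau>\<close>, these are the contributions of the \<open>m\<close>-th Fourier coefficient in
  the lattice rows above (\<open>pg\<close>) and below (\<open>ph\<close>) the real axis, as functions of the distance \<open>x\<close>
  to the axis in units of \<open>Im \<tau>\<close>.\<close>

definition pg :: "complex \<Rightarrow> real \<Rightarrow> complex" where
  "pg \<tau> x = ee (of_real x * \<tau>)"

definition ph :: "nat \<Rightarrow> complex \<Rightarrow> real \<Rightarrow> complex" where
  "ph n \<tau> x = of_real (exp_partial n (4 * pi * x * Im \<tau>)) * cnj (ee (of_real x * \<tau>))"

lemma pg_ph_bound:
  assumes v: "Im \<tau> > 0"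
  obtains M e where "e > 0" "\<And>x. x \<ge> 0 \<Longrightarrow> norm (pg \<tau> x) \<le> M * exp (- e * x)"
    "\<And>x. x \<ge> 0 \<Longrightarrow> norm (ph n \<tau> x) \<le> M * exp (- e * x)"
proof -
  define e where "e = pi * Im \<tau>"
  have e: "e > 0" using v by (simp add: e_def)
  obtain C where C: "C \<ge> 0" "\<And>x. x \<ge> 0 \<Longrightarrow> norm (exp_partial_c n (of_real (4 * pi * Im \<tau>) * of_real x)) \<le> C * exp (e * x)"
    using exp_partial_c_bound[OF e] by blast
  have ee: "norm (ee (of_real x * \<tau>)) = exp (- (2 * e) * x)" for x
    by (simp add: norm_ee e_def mult_ac)
  show ?thesis
  proof (rule that[of e "max 1 C", OF e])
    fix x :: real assume x: "x \<ge> 0"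
    have "exp (- (2 * e) * x) \<le> 1 * exp (- e * x)" using e x by simp
    also have "\<dots> \<le> max 1 C * exp (- e * x)" by (intro mult_right_mono) auto
    finally show "norm (pg \<tau> x) \<le> max 1 C * exp (- e * x)" by (simp add: pg_def ee)
    have "norm (ph n \<tau> x) = norm (exp_partial_c n (of_real (4 * pi * Im \<tau>) * of_real x)) * exp (- (2 * e) * x)"
    proof -
      have "complex_of_real (exp_partial n (4 * pi * x * Im \<tau>)) = exp_partial_c n (of_real (4 * pi * Im \<tau>) * of_real x)"
        by (simp add: mult_ac flip: exp_partial_c_of_real)
      then show ?thesis unfolding ph_def norm_mult complex_mod_cnj ee by simp
    qed
    also have "\<dots> \<le> C * exp (e * x) * exp (- (2 * e) * x)" by (intro mult_right_mono C x) auto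
    also have "\<dots> = C * exp (- e * x)" by (simp add: mult.assoc flip: exp_add)
    also have "\<dots> \<le> max 1 C * exp (- e * x)" by (intro mult_right_mono) auto
    finally show "norm (ph n \<tau> x) \<le> max 1 C * exp (- e * x)" .
  qed
qed

definition periodization :: "nat \<Rightarrow> complex \<Rightarrow> real \<Rightarrow> complex" where
  "periodization n \<tau> t = (\<Sum>l. pg \<tau> (real l + t) + ph n \<tau> (real (Suc l) - t))"

text \<open>With c = 4 pi v, \<alpha> = 2 pi i (\<tau> - d) and \<beta> = \<alpha> + c, the upper
  half contributes -1/\<alpha> and the lower half (1 - (c/\<beta>)^n) / \<alpha>. The leading parts
  cancel, leaving -c^n / (\<alpha> \<beta>^n), which is summable in d although neither contribution
  is.\<close>

lemma periodization_has_sum: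
  assumes v: "Im \<tau> > 0" and n: "n \<ge> 1" and t: "t \<in> {0..1}"
    and summ: "(\<lambda>d::int. inverse (norm (\<tau> - of_int d) ^ Suc n)) summable_on UNIV"
  shows "((\<lambda>d. - (of_real (4 * pi * Im \<tau>) ^ n) / ((2 * of_real pi * \<i>) ^ Suc n * ((\<tau> - of_int d) * (cnj \<tau> - of_int d) ^ n)) * ee (of_int d * of_real t))
     has_sum periodization n \<tau> t) UNIV"
proof -
  define c where "c = complex_of_real (4 * pi * Im \<tau>)"
  define \<alpha> where "\<alpha> = (\<lambda>d::int. 2 * of_real pi * \<i> * (\<tau> - of_int d))"
  define \<beta> where "\<beta> = (\<lambda>d::int. 2 * of_real pi * \<i> * (cnj \<tau> - of_int d))"
  have \<alpha>: "\<alpha> d \<noteq> 0" and \<beta>: "\<beta> d \<noteq> 0" for d using v by (auto simp: \<alpha>_def \<beta>_def complex_eq_iff)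
  have \<alpha>\<beta>: "\<alpha> d = \<beta> d - c" for d by (simp add: \<alpha>_def \<beta>_def c_def complex_eq_iff)
  have Re\<beta>: "Re (\<beta> d) = 2 * pi * Im \<tau>" for d by (simp add: \<beta>_def)
  define G where "G = (\<lambda>d x. exp (\<alpha> d * of_real x) / \<alpha> d)"
  \<comment> \<open>The antiderivative from \<open>incomplete_gamma_antiderivative\<close>; it
    vanishes at infinity because Re \<beta> = 2 pi v > 0.\<close>
  define H where "H = (\<lambda>d (x::real). - 1 / \<alpha> d * (exp_partial_c n (c * of_real x) * exp (- \<beta> d * of_real x) - (c / \<beta> d) ^ n * (exp_partial_c n (\<beta> d * of_real x) * exp (- \<beta> d * of_real x))))"
  obtain M e where Me: "e > 0" "\<And>x. x \<ge> 0 \<Longrightarrow> norm (pg \<tau> x) \<le> M * exp (- e * x)"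
    "\<And>x. x \<ge> 0 \<Longrightarrow> norm (ph n \<tau> x) \<le> M * exp (- e * x)"
    by (rule pg_ph_bound[OF v, of n]) blast
  have hee: "ph n \<tau> x * ee (of_int d * of_real x) = exp_partial_c n (c * of_real x) * exp (- \<beta> d * of_real x)" for d x
  proof -
    have "cnj (ee (of_real x * \<tau>)) * ee (of_int d * of_real x) = exp (- \<beta> d * of_real x)"
      by (simp add: cnj_ee flip: ee_add) (simp add: ee_def \<beta>_def algebra_simps)
    moreover have "complex_of_real (exp_partial n (4 * pi * x * Im \<tau>)) = exp_partial_c n (c * of_real x)"
      by (simp add: c_def mult_ac flip: exp_partial_c_of_real)
    ultimately show ?thesis by (simp add: ph_def mult.assoc)
  qed
  have gee: "pg \<tau> x * ee (- of_int d * of_real x) = exp (\<alpha> d * of_real x)" for d x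
    unfolding pg_def by (simp flip: ee_add) (simp add: ee_def \<alpha>_def algebra_simps)
  have lim0: "((\<lambda>x. exp_partial_c n (b * of_real x) * exp (- \<beta> d * of_real x)) \<longlongrightarrow> 0) at_top" for b d
  proof -
    define e where "e = pi * Im \<tau>"
    have e: "e > 0" using v by (simp add: e_def)
    obtain C where C: "C \<ge> 0" "\<And>x. x \<ge> 0 \<Longrightarrow> norm (exp_partial_c n (b * of_real x)) \<le> C * exp (e * x)"
      using exp_partial_c_bound[OF e] by blast
    have "((\<lambda>x. C * exp (- e * x)) \<longlongrightarrow> C * 0) at_top"
    proof (intro tendsto_mult tendsto_const)
      have "filterlim (\<lambda>x. e * x) at_top at_top"
        using e by (intro filterlim_tendsto_pos_mult_at_top[OF tendsto_const _ filterlim_ident])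
      then have "filterlim (\<lambda>x. - (e * x)) at_bot at_top"
        by (simp add: filterlim_uminus_at_bot)
      then show "((\<lambda>x. exp (- e * x)) \<longlongrightarrow> 0) at_top"
        by (simp add: filterlim_compose[OF exp_at_bot])
    qed
    then show ?thesis
      unfolding mult_zero_right
    proof (rule Lim_null_comparison[rotated])
      show "eventually (\<lambda>x. norm (exp_partial_c n (b * of_real x) * exp (- \<beta> d * of_real x)) \<le> C * exp (- e * x)) at_top"
        using eventually_ge_at_top[of 0]
      proof eventually_elim
        case (elim x)
        have "norm (exp_partial_c n (b * of_real x) * exp (- \<beta> d * of_real x)) = norm (exp_partial_c n (b * of_real x)) * exp (- (2 * e) * x)"
          by (simp add: norm_mult Re\<beta> e_def)
        also have "\<dots> \<le> C * exp (e * x) * exp (- (2 * e) * x)" by (intro mult_right_mono C elim) auto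
        also have "\<dots> = C * exp (- e * x)" by (simp add: mult.assoc flip: exp_add)
        finally show ?case by simp
      qed
    qed
  qed
  have coef: "- G d 0 - H d 0 = - (of_real (4 * pi * Im \<tau>) ^ n) / ((2 * of_real pi * \<i>) ^ Suc n * ((\<tau> - of_int d) * (cnj \<tau> - of_int d) ^ n))" for d
  proof -
    note E0 = exp_partial_c_0[OF n]
    have "- G d 0 - H d 0 = - (c ^ n / (\<alpha> d * \<beta> d ^ n))"
      using \<alpha>[of d] \<beta>[of d] by (simp add: G_def H_def E0 field_simps)
    also have "\<alpha> d * \<beta> d ^ n = (2 * of_real pi * \<i>) ^ Suc n * ((\<tau> - of_int d) * (cnj \<tau> - of_int d) ^ n)"
      unfolding \<alpha>_def \<beta>_def power_mult_distrib by (simp add: mult_ac)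
    finally show ?thesis by (simp only: c_def minus_divide_left)
  qed
  have "((\<lambda>d. (- G d 0 - H d 0) * ee (of_int d * of_real t)) has_sum
           (\<Sum>l. pg \<tau> (real l + t) + ph n \<tau> (real (Suc l) - t))) UNIV"
  proof (rule poisson[OF _ _ Me])
    show "continuous_on {0..} (pg \<tau>)" unfolding pg_def by (intro continuous_intros)
    show "continuous_on {0..} (ph n \<tau>)" unfolding ph_def exp_partial_def by (intro continuous_intros) auto
    show "pg \<tau> 0 = ph n \<tau> 0"
      by (simp add: pg_def ph_def exp_partial_0[OF n])
    show "(G d has_vector_derivative pg \<tau> x * ee (- of_int d * of_real x)) (at x)" for d x
      unfolding gee unfolding G_def
      by (rule has_vector_derivative_real_field) (use \<alpha>[of d] in \<open>auto intro!: derivative_eq_intros\<close>)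
    show "(H d has_vector_derivative ph n \<tau> x * ee (of_int d * of_real x)) (at x)" for d x
      unfolding hee unfolding H_def
      by (rule has_vector_derivative_real_field)
         (use incomplete_gamma_antiderivative[OF n, of "\<beta> d" c] \<alpha>[of d] \<beta>[of d] in \<open>auto simp: \<alpha>\<beta>\<close>)
    show "(H d \<longlongrightarrow> 0) at_top" for d
    proof -
      have "(H d \<longlongrightarrow> - 1 / \<alpha> d * (0 - (c / \<beta> d) ^ n * 0)) at_top"
        unfolding H_def by (intro tendsto_intros lim0)
      then show ?thesis by simp
    qed
    show "(G d \<longlongrightarrow> 0) at_top" for d
    proof -
      have "(pg \<tau> \<longlongrightarrow> 0) at_top"
      proof (rule Lim_null_comparison)
        show "eventually (\<lambda>x. norm (pg \<tau> x) \<le> M * exp (- e * x)) at_top"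
          using eventually_ge_at_top[of 0] by eventually_elim (rule Me)
        have "filterlim (\<lambda>x. e * x) at_top at_top"
          using Me(1) by (intro filterlim_tendsto_pos_mult_at_top[OF tendsto_const _ filterlim_ident])
        then have "filterlim (\<lambda>x. - (e * x)) at_bot at_top"
          by (simp add: filterlim_uminus_at_bot)
        then have "((\<lambda>x. exp (- e * x)) \<longlongrightarrow> 0) at_top"
          by (simp add: filterlim_compose[OF exp_at_bot])
        from tendsto_mult_right_zero[OF this] show "((\<lambda>x. M * exp (- e * x)) \<longlongrightarrow> 0) at_top" .
      qed
      then have "((\<lambda>x. norm (pg \<tau> x) / norm (\<alpha> d)) \<longlongrightarrow> 0) at_top"
        by (intro tendsto_divide_zero tendsto_norm_zero)
      then show ?thesis
      proof (rule Lim_null_comparison[rotated])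
        have "norm (ee (- of_int d * of_real x)) = 1" for x :: real by (simp add: norm_ee)
        then have "norm (G d x) = norm (pg \<tau> x) / norm (\<alpha> d)" for x
          unfolding G_def gee[symmetric] norm_divide norm_mult by simp
        then show "eventually (\<lambda>x. norm (G d x) \<le> norm (pg \<tau> x) / norm (\<alpha> d)) at_top" by simp
      qed
    qed
    show "(\<lambda>d. norm (- G d 0 - H d 0)) summable_on UNIV"
    proof -
      have "(\<lambda>d::int. norm (of_real (4 * pi * Im \<tau>) ^ n / (2 * of_real pi * \<i>) ^ Suc n :: complex) * inverse (norm (\<tau> - of_int d) ^ Suc n)) summable_on UNIV"
        by (intro summable_on_cmult_right summ)
      also have "(\<lambda>d::int. norm (of_real (4 * pi * Im \<tau>) ^ n / (2 * of_real pi * \<i>) ^ Suc n :: complex) * inverse (norm (\<tau> - of_int d) ^ Suc n)) =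
          (\<lambda>d. norm (- G d 0 - H d 0))"
      proof
        fix d :: int
        have "norm (cnj \<tau> - of_int d) = norm (cnj (\<tau> - of_int d))" by simp
        also have "\<dots> = norm (\<tau> - of_int d)" by (rule complex_mod_cnj)
        finally show "norm (of_real (4 * pi * Im \<tau>) ^ n / (2 * of_real pi * \<i>) ^ Suc n :: complex) * inverse (norm (\<tau> - of_int d) ^ Suc n) = norm (- G d 0 - H d 0)"
          unfolding coef norm_divide norm_minus_cancel norm_mult norm_power by (simp add: field_simps)
      qed
      finally show ?thesis .
    qed
  qed (use t in auto)
  then show ?thesis unfolding coef periodization_def .
qed

section \<open>Kronecker series and modularity for \<open>a \<ge> 3\<close>\<close>

text \<open>Separates the row through z from the rows above it (arguments l + t) and below it
  (arguments l - t), to match the blocks. Passing from t to 1 - t exchanges the roles of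
  \<open>pg\<close> and \<open>ph\<close>.\<close>

lemma periodization_split:
  assumes v: "Im \<tau> > 0" and t: "t \<in> {0..1}"
  shows "summable (\<lambda>l. pg \<tau> (real (Suc l) + t))" "summable (\<lambda>l. ph n \<tau> (real (Suc l) + t))"
    "summable (\<lambda>l. pg \<tau> (real (Suc l) - t))" "summable (\<lambda>l. ph n \<tau> (real (Suc l) - t))"
    "periodization n \<tau> t = pg \<tau> t + (\<Sum>l. pg \<tau> (real (Suc l) + t)) + (\<Sum>l. ph n \<tau> (real (Suc l) - t))"
    "periodization n \<tau> (1 - t) = ph n \<tau> t + (\<Sum>l. ph n \<tau> (real (Suc l) + t)) + (\<Sum>l. pg \<tau> (real (Suc l) - t))"
proof -
  obtain M e where Me: "e > 0" "\<And>x. x \<ge> 0 \<Longrightarrow> norm (pg \<tau> x) \<le> M * exp (- e * x)"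
    "\<And>x. x \<ge> 0 \<Longrightarrow> norm (ph n \<tau> x) \<le> M * exp (- e * x)"
    by (rule pg_ph_bound[OF v, of n]) blast
  have M: "M \<ge> 0" using order_trans[OF norm_ge_zero Me(2)[of 0]] by simp
  have sumM: "summable (\<lambda>l. M * exp (- e * real l))"
    by (intro summable_mult summable_exp_neg Me)
  have S: "summable (\<lambda>l. f (x l))" if "\<And>l. x l \<ge> real l" "\<And>x. x \<ge> 0 \<Longrightarrow> norm (f x) \<le> M * exp (- e * x)" for f :: "real \<Rightarrow> complex" and x
  proof (rule summable_comparison_test'[OF sumM])
    fix l
    have "norm (f (x l)) \<le> M * exp (- e * x l)" using that(1)[of l] by (intro that) auto
    also have "\<dots> \<le> M * exp (- e * real l)" using that(1)[of l] M Me(1) by (intro mult_left_mono) auto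
    finally show "norm (f (x l)) \<le> M * exp (- e * real l)" .
  qed
  show 1: "summable (\<lambda>l. pg \<tau> (real (Suc l) + t))" and 2: "summable (\<lambda>l. ph n \<tau> (real (Suc l) + t))"
    and 3: "summable (\<lambda>l. pg \<tau> (real (Suc l) - t))" and 4: "summable (\<lambda>l. ph n \<tau> (real (Suc l) - t))"
    using t by (auto intro!: S Me)
  have 5: "summable (\<lambda>l. pg \<tau> (real l + t))" and 6: "summable (\<lambda>l. ph n \<tau> (real l + t))"
    using t by (auto intro!: S Me)
  show "periodization n \<tau> t = pg \<tau> t + (\<Sum>l. pg \<tau> (real (Suc l) + t)) + (\<Sum>l. ph n \<tau> (real (Suc l) - t))"
    using suminf_split_head[OF 5] unfolding periodization_def suminf_add[OF 5 4, symmetric] by simp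
  have "periodization n \<tau> (1 - t) = (\<Sum>l. pg \<tau> (real (Suc l) - t) + ph n \<tau> (real l + t))"
    unfolding periodization_def by (intro suminf_cong) (simp add: algebra_simps)
  also have "\<dots> = ph n \<tau> t + (\<Sum>l. ph n \<tau> (real (Suc l) + t)) + (\<Sum>l. pg \<tau> (real (Suc l) - t))"
    using suminf_split_head[OF 6] unfolding suminf_add[OF 3 6, symmetric] by simp
  finally show "periodization n \<tau> (1 - t) = \<dots>" .
qed

lemma czero_cnj: "cnj (czero n s i) = czero n (- s) i"
  by (simp add: czero_def cnj_ee)

lemma summable_czero:
  assumes "n \<ge> 2" and b: "\<And>i. norm (w i) \<le> M"
  shows "summable (\<lambda>i. czero n s i * w i)"
proof (rule summable_comparison_test')
  show "summable (\<lambda>i. M * inverse (real (Suc i) ^ n))"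
    using inverse_power_summable[OF assms(1), where 'a = real] summable_Suc_iff[of "\<lambda>i. inverse (real i ^ n)"]
    by (intro summable_mult) simp
  show "norm (czero n s i * w i) \<le> M * inverse (real (Suc i) ^ n)" for i
    using mult_left_mono[OF b[of i], of "inverse (real (Suc i) ^ n)"]
    by (simp add: czero_def norm_mult norm_divide norm_power norm_inverse norm_ee divide_inverse mult_ac del: of_nat_Suc)
qed

lemma Im_Suc_mult: "Im (of_nat (Suc i) * \<tau>) = real (Suc i) * Im \<tau>"
  by simp

lemma block_term_conv:
  "block_term n \<sigma> c (real m * x) \<tau> = c * pg (of_nat m * \<tau>) x + \<sigma> * (cnj c * ph n (of_nat m * \<tau>) x)"
  by (simp add: block_term_def pg_def ph_def mult_ac)

text \<open>The terms of the expansion regrouped by m: those with coefficient \<open>czero\<close>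
  form the periodization at t, those with its conjugate the one at 1 - t.\<close>

lemma Ecal_hat_periodization_sums:
  fixes t s :: real and n :: nat
  defines "\<sigma> \<equiv> (-1) ^ Suc n"
  assumes v: "Im \<tau> > 0" and t: "0 \<le> t" "t < 1" and n: "n \<ge> 2"
  shows "(\<lambda>i. czero n s i * periodization n (of_nat (Suc i) * \<tau>) t +
             \<sigma> * (cnj (czero n s i) * periodization n (of_nat (Suc i) * \<tau>) (1 - t))) sums
         (Ecal_hat (Suc n) (of_real t * \<tau> + of_real s) \<tau> + of_real ((- 4 * pi * Im \<tau>) ^ n * bernoulli_poly (Suc n) t / fact (Suc n)))"
proof -
  have n1: "n \<ge> 1" using n by simp
  have vi: "Im (of_nat (Suc i) * \<tau>) > 0" for i unfolding Im_Suc_mult using v by simp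
  have tt: "t \<in> {0..1}" using t by auto
  define p where "p = (\<lambda>i. czero n s i * pg (of_nat (Suc i) * \<tau>) t)"
  define p' where "p' = (\<lambda>i. cnj (czero n s i) * ph n (of_nat (Suc i) * \<tau>) t)"
  have e1: "czero n s i * ee (of_real (real (Suc i) * t) * \<tau>) = p i" for i
    by (simp add: p_def pg_def mult_ac)
  have e2: "of_real (exp_partial n (4 * pi * (real (Suc i) * t) * Im \<tau>)) * cnj (p i) = p' i" for i
    by (simp add: p_def p'_def pg_def ph_def mult_ac)
  have sp: "summable p"
    unfolding p_def by (rule summable_czero[OF n, of _ 1]) (use v t in \<open>auto simp: pg_def norm_ee\<close>)
  have sp': "summable p'"
  proof (cases "t = 0")
    case True
    then show ?thesis unfolding p'_def czero_cnj
      by (intro summable_czero[OF n, of _ 1]) (simp add: ph_def exp_partial_0[OF n1])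
  next
    case False
    then have "exp_summable UNIV (czero n s) (\<lambda>i. real (Suc i) * t)"
      using t by (intro exp_summable_czero) auto
    from exp_partial_series_summable[OF this v, of n] show ?thesis
      unfolding e1 e2 by (rule sums_summable[OF has_sum_imp_sums])
  qed
  have es: "exp_summable UNIV (cplus n s) (kplus t)" "exp_summable UNIV (cplus n (- s)) (kplus (- t))"
    using t by (auto intro: exp_summable_kplus)
  note hA = block_has_sum[OF es(1) v, of n \<sigma>] and hB = block_has_sum[OF es(2) v, of n \<sigma>]
  have A: "(\<lambda>i. \<Sum>j. block_term n \<sigma> (cplus n s (i, j)) (kplus t (i, j)) \<tau>) sums block n \<sigma> UNIV (cplus n s) (kplus t) \<tau>"
    using double_suminf_eq_infsum(3)[of "\<lambda>x. block_term n \<sigma> (cplus n s x) (kplus t x) \<tau>"] hA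
    by (simp add: has_sum_imp_summable infsumI)
  have B: "(\<lambda>i. \<Sum>j. block_term n \<sigma> (cplus n (- s) (i, j)) (kplus (- t) (i, j)) \<tau>) sums block n \<sigma> UNIV (cplus n (- s)) (kplus (- t)) \<tau>"
    using double_suminf_eq_infsum(3)[of "\<lambda>x. block_term n \<sigma> (cplus n (- s) x) (kplus (- t) x) \<tau>"] hB
    by (simp add: has_sum_imp_summable infsumI)
  have A': "(\<Sum>j. block_term n \<sigma> (cplus n s (i, j)) (kplus t (i, j)) \<tau>) =
      czero n s i * (\<Sum>l. pg (of_nat (Suc i) * \<tau>) (real (Suc l) + t)) +
      \<sigma> * (cnj (czero n s i) * (\<Sum>l. ph n (of_nat (Suc i) * \<tau>) (real (Suc l) + t)))" for i
    unfolding cplus_def kplus_def prod.case block_term_conv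
    by (rule sums_unique [symmetric], intro sums_add sums_mult summable_sums periodization_split[OF vi tt])
  have B': "(\<Sum>j. block_term n \<sigma> (cplus n (- s) (i, j)) (kplus (- t) (i, j)) \<tau>) =
      cnj (czero n s i) * (\<Sum>l. pg (of_nat (Suc i) * \<tau>) (real (Suc l) - t)) +
      \<sigma> * (czero n s i * (\<Sum>l. ph n (of_nat (Suc i) * \<tau>) (real (Suc l) - t)))" for i
    unfolding cplus_def kplus_def prod.case block_term_conv czero_cnj minus_minus diff_conv_add_uminus [symmetric]
    by (rule sums_unique [symmetric], intro sums_add sums_mult summable_sums periodization_split[OF vi tt])
  have \<sigma>\<sigma>: "\<sigma> * (\<sigma> * x) = x" for x
    by (simp add: \<sigma>_def mult.assoc [symmetric] flip: power_mult_distrib)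
  have "(\<lambda>i. p i + \<sigma> * p' i + (\<Sum>j. block_term n \<sigma> (cplus n s (i, j)) (kplus t (i, j)) \<tau>) +
          \<sigma> * (\<Sum>j. block_term n \<sigma> (cplus n (- s) (i, j)) (kplus (- t) (i, j)) \<tau>)) sums
        (suminf p + \<sigma> * suminf p' + block n \<sigma> UNIV (cplus n s) (kplus t) \<tau> + \<sigma> * block n \<sigma> UNIV (cplus n (- s)) (kplus (- t)) \<tau>)"
    by (intro sums_add sums_mult A B summable_sums sp sp')
  also have "(\<lambda>i. p i + \<sigma> * p' i + (\<Sum>j. block_term n \<sigma> (cplus n s (i, j)) (kplus t (i, j)) \<tau>) +
          \<sigma> * (\<Sum>j. block_term n \<sigma> (cplus n (- s) (i, j)) (kplus (- t) (i, j)) \<tau>)) =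
      (\<lambda>i. czero n s i * periodization n (of_nat (Suc i) * \<tau>) t +
             \<sigma> * (cnj (czero n s i) * periodization n (of_nat (Suc i) * \<tau>) (1 - t)))"
    unfolding A' B' periodization_split(5,6)[OF vi tt] p_def p'_def
    by (simp only: ring_distribs \<sigma>\<sigma> add_ac mult_ac)
  also have "suminf p + \<sigma> * suminf p' + block n \<sigma> UNIV (cplus n s) (kplus t) \<tau> + \<sigma> * block n \<sigma> UNIV (cplus n (- s)) (kplus (- t)) \<tau> =
     Ecal_hat (Suc n) (of_real t * \<tau> + of_real s) \<tau> + of_real ((- 4 * pi * Im \<tau>) ^ n * bernoulli_poly (Suc n) t / fact (Suc n))"
    using Ecal_hat_expansion[OF v t n1, of s] sp unfolding e1 e2 \<sigma>_def [symmetric] by simp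
  finally show ?thesis .
qed

text \<open>An Eisenstein-Kronecker series: a character of the lattice over w cnj(w)^n. It is used
  for n \<ge> 2 only, where the unordered sum exists.\<close>

definition kron :: "nat \<Rightarrow> real \<Rightarrow> real \<Rightarrow> complex \<Rightarrow> complex" where
  "kron n t s \<tau> = infsum (lat n t s \<tau>) UNIV"

lemma lat_minus: "lat n t s \<tau> (- m, d) = (-1) ^ Suc n * ee (- of_real (of_int m * s - of_int d * t)) / ((of_int m * \<tau> + of_int d) * (of_int m * cnj \<tau> + of_int d) ^ n)"
proof -
  have 1: "of_int (- m) * \<tau> - of_int d = - (of_int m * \<tau> + of_int d)" "of_int (- m) * cnj \<tau> - of_int d = - (of_int m * cnj \<tau> + of_int d)"
    by simp_all
  have 2: "(- X) * (- Y) ^ n = (- 1) ^ Suc n * (X * Y ^ n)" for X Y :: complex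
    unfolding power_minus[of Y n] by simp
  have 3: "a / ((- 1) ^ Suc n * b) = (- 1) ^ Suc n * a / b" for a b :: complex
    by (cases "even n") auto
  show ?thesis unfolding lat_def prod.case 1 2 3 by (simp add: algebra_simps)
qed

lemma sums_int_from_nat:
  fixes L :: "int \<Rightarrow> complex"
  assumes "L summable_on UNIV"
  shows "(\<lambda>i. L (int (Suc i)) + L (- int (Suc i))) sums (infsum L UNIV - L 0)"
proof -
  have s: "L summable_on A" for A by (rule summable_on_subset_banach[OF assms]) auto
  have i1: "inj_on (\<lambda>i. int (Suc i)) UNIV" and i2: "inj_on (\<lambda>i. - int (Suc i)) UNIV"
    by (auto simp: inj_on_def)
  have "(\<lambda>i. L (int (Suc i))) summable_on UNIV" "(\<lambda>i. L (- int (Suc i))) summable_on UNIV"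
    using s[of "range (\<lambda>i. int (Suc i))"] s[of "range (\<lambda>i. - int (Suc i))"]
    unfolding summable_on_reindex[OF i1] summable_on_reindex[OF i2] o_def .
  then have "((\<lambda>i. L (int (Suc i)) + L (- int (Suc i))) has_sum (\<Sum>\<^sub>\<infinity>i. L (int (Suc i))) + (\<Sum>\<^sub>\<infinity>i. L (- int (Suc i)))) UNIV"
    by (intro has_sum_add has_sum_infsum)
  moreover have "(\<Sum>\<^sub>\<infinity>i. L (int (Suc i))) = infsum L (range (\<lambda>i. int (Suc i)))"
    unfolding infsum_reindex[OF i1] o_def ..
  moreover have "(\<Sum>\<^sub>\<infinity>i. L (- int (Suc i))) = infsum L (range (\<lambda>i. - int (Suc i)))"
    unfolding infsum_reindex[OF i2] o_def ..
  moreover have "infsum L UNIV = L 0 + infsum L (range (\<lambda>i. int (Suc i))) + infsum L (range (\<lambda>i. - int (Suc i)))"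
  proof -
    have "UNIV = insert 0 (range (\<lambda>i. int (Suc i))) \<union> range (\<lambda>i. - int (Suc i))"
    proof -
      have "x \<in> insert 0 (range (\<lambda>i. int (Suc i))) \<union> range (\<lambda>i. - int (Suc i))" for x
      proof (cases x "0::int" rule: linorder_cases)
        case less
        then have "x = - int (Suc (nat (- x - 1)))" by simp
        then show ?thesis by blast
      next
        case greater
        then have "x = int (Suc (nat (x - 1)))" by simp
        then show ?thesis by blast
      qed auto
      then show ?thesis by auto
    qed
    moreover have "infsum L (insert 0 (range (\<lambda>i. int (Suc i))) \<union> range (\<lambda>i. - int (Suc i))) =
      infsum L (insert 0 (range (\<lambda>i. int (Suc i)))) + infsum L (range (\<lambda>i. - int (Suc i)))"
      by (intro infsum_Un_disjoint s) auto
    moreover have "infsum L (insert 0 (range (\<lambda>i. int (Suc i)))) = L 0 + infsum L (range (\<lambda>i. int (Suc i)))"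
      by (subst infsum_insert) (auto intro: s)
    ultimately show ?thesis by simp
  qed
  ultimately show ?thesis by (auto dest: has_sum_imp_sums)
qed

theorem Ecal_hat_eq_kron_aux:
  assumes v: "Im \<tau> > 0" and t: "0 \<le> t" "t < 1" and n: "n \<ge> 2"
  shows "Ecal_hat (Suc n) (of_real t * \<tau> + of_real s) \<tau> =
    - (of_real (4 * pi * Im \<tau>) ^ n / (2 * of_real pi * \<i>) ^ Suc n) * kron n t s \<tau>"
proof -
  define K where "K = - (of_real (4 * pi * Im \<tau>) ^ n / (2 * of_real pi * \<i>) ^ Suc n :: complex)"
  have n1: "n \<ge> 1" using n by simp
  have tt: "t \<in> {0..1}" "1 - t \<in> {0..1}" using t by auto
  have vi: "Im (of_nat (Suc i) * \<tau>) > 0" for i unfolding Im_Suc_mult using v by simp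
  have sl: "lat n t s \<tau> summable_on UNIV"
    using abs_summable_summable[OF lat_abs_summable[OF v n]] .
  have slm: "(\<lambda>d. norm (lat n t s \<tau> (m, d))) summable_on UNIV" for m
  proof -
    have "(\<lambda>x. norm (lat n t s \<tau> x)) summable_on range (\<lambda>d. (m, d))"
      by (rule summable_on_subset_banach[OF lat_abs_summable[OF v n]]) auto
    then show ?thesis by (subst (asm) summable_on_reindex) (auto simp: inj_on_def o_def)
  qed
  have slm': "(\<lambda>d. lat n t s \<tau> (m, d)) summable_on UNIV" for m
    using abs_summable_summable[OF slm] .
  define L where "L = (\<lambda>m. \<Sum>\<^sub>\<infinity>d. lat n t s \<tau> (m, d))"
  have sL: "L summable_on UNIV" and iL: "infsum L UNIV = kron n t s \<tau>"
    using summable_on_Sigma_banach[of "\<lambda>m d. lat n t s \<tau> (m, d)" UNIV "\<lambda>_. UNIV"]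
       infsum_Sigma_banach[of "lat n t s \<tau>" UNIV "\<lambda>_. UNIV"] sl
    unfolding L_def kron_def by (simp_all add: case_prod_unfold)
  have per: "czero n s i * periodization n (of_nat (Suc i) * \<tau>) t = K * L (int (Suc i))"
       "(-1) ^ Suc n * (cnj (czero n s i) * periodization n (of_nat (Suc i) * \<tau>) (1 - t)) = K * L (- int (Suc i))" for i
  proof -
    have cn: "cnj (of_nat (Suc i) * \<tau>) = of_nat (Suc i) * cnj \<tau>" by simp
    have sm: "(\<lambda>d::int. inverse (norm (of_nat (Suc i) * \<tau> - of_int d) ^ Suc n)) summable_on UNIV"
      using slm[of "int (Suc i)"] unfolding norm_lat of_int_of_nat_eq .
    have K': "- (of_real (4 * pi * Im (of_nat (Suc i) * \<tau>)) ^ n) = - (of_real (4 * pi * Im \<tau>) ^ n) * (of_nat (Suc i) :: complex) ^ n"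
      unfolding Im_Suc_mult by (simp add: power_mult_distrib mult_ac del: of_nat_Suc)
    have cz: "czero n s i * (of_nat (Suc i)) ^ n = ee (of_nat (Suc i) * of_real s)"
      by (simp add: czero_def del: of_nat_Suc)
    have cz': "cnj (czero n s i) * (of_nat (Suc i)) ^ n = ee (- (of_nat (Suc i) * of_real s))"
      unfolding czero_cnj by (simp add: czero_def del: of_nat_Suc)
    have "((\<lambda>d. czero n s i * (- (of_real (4 * pi * Im (of_nat (Suc i) * \<tau>)) ^ n) / ((2 * of_real pi * \<i>) ^ Suc n * ((of_nat (Suc i) * \<tau> - of_int d) * (cnj (of_nat (Suc i) * \<tau>) - of_int d) ^ n)) * ee (of_int d * of_real t)))
       has_sum czero n s i * periodization n (of_nat (Suc i) * \<tau>) t) UNIV"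
      by (intro has_sum_cmult_right periodization_has_sum vi n1 tt sm)
    also have "(\<lambda>d. czero n s i * (- (of_real (4 * pi * Im (of_nat (Suc i) * \<tau>)) ^ n) / ((2 * of_real pi * \<i>) ^ Suc n * ((of_nat (Suc i) * \<tau> - of_int d) * (cnj (of_nat (Suc i) * \<tau>) - of_int d) ^ n)) * ee (of_int d * of_real t)))
        = (\<lambda>d. K * lat n t s \<tau> (int (Suc i), d))" (is "?l = ?r")
    proof
      fix d
      have "?l d = - (of_real (4 * pi * Im \<tau>) ^ n) / (2 * of_real pi * \<i>) ^ Suc n *
           ((czero n s i * of_nat (Suc i) ^ n) * ee (of_int d * of_real t) / ((of_nat (Suc i) * \<tau> - of_int d) * (of_nat (Suc i) * cnj \<tau> - of_int d) ^ n))"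
        unfolding K' cn by (simp del: of_nat_Suc power_Suc add: divide_inverse mult_ac)
      also have "\<dots> = K * lat n t s \<tau> (int (Suc i), d)"
        unfolding cz ee_add[symmetric] lat_def prod.case K_def by simp
      finally show "?l d = ?r d" .
    qed
    finally have "(?r has_sum czero n s i * periodization n (of_nat (Suc i) * \<tau>) t) UNIV" .
    moreover have "(?r has_sum K * L (int (Suc i))) UNIV"
      unfolding L_def by (intro has_sum_cmult_right has_sum_infsum slm')
    ultimately show "czero n s i * periodization n (of_nat (Suc i) * \<tau>) t = K * L (int (Suc i))"
      by (rule has_sum_unique)
    \<comment> \<open>These are the rows with negative m. Since e(d (1 - t)) = e(- d t), they appear
      with d replaced by -d, which is undone by a reindexing at the end.\<close>
    have "((\<lambda>d. (-1) ^ Suc n * (cnj (czero n s i) * (- (of_real (4 * pi * Im (of_nat (Suc i) * \<tau>)) ^ n) / ((2 * of_real pi * \<i>) ^ Suc n * ((of_nat (Suc i) * \<tau> - of_int d) * (cnj (of_nat (Suc i) * \<tau>) - of_int d) ^ n)) * ee (of_int d * of_real (1 - t)))))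
       has_sum (-1) ^ Suc n * (cnj (czero n s i) * periodization n (of_nat (Suc i) * \<tau>) (1 - t))) UNIV"
      by (intro has_sum_cmult_right periodization_has_sum vi n1 tt sm)
    also have "(\<lambda>d. (-1) ^ Suc n * (cnj (czero n s i) * (- (of_real (4 * pi * Im (of_nat (Suc i) * \<tau>)) ^ n) / ((2 * of_real pi * \<i>) ^ Suc n * ((of_nat (Suc i) * \<tau> - of_int d) * (cnj (of_nat (Suc i) * \<tau>) - of_int d) ^ n)) * ee (of_int d * of_real (1 - t)))))
        = (\<lambda>d. K * lat n t s \<tau> (- int (Suc i), - d))" (is "?l = ?r")
    proof
      fix d
      have e: "ee (of_int d * of_real (1 - t)) = ee (- (of_int d * of_real t))"
        using ee_add[of "of_int d" "- (of_int d * of_real t)"] by (simp add: algebra_simps)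
      have "?l d = - (of_real (4 * pi * Im \<tau>) ^ n) / (2 * of_real pi * \<i>) ^ Suc n *
           ((-1) ^ Suc n * ((cnj (czero n s i) * of_nat (Suc i) ^ n) * ee (- (of_int d * of_real t))) / ((of_nat (Suc i) * \<tau> - of_int d) * (of_nat (Suc i) * cnj \<tau> - of_int d) ^ n))"
        unfolding K' cn e by (simp del: of_nat_Suc power_Suc add: divide_inverse mult_ac)
      also have "\<dots> = K * lat n t s \<tau> (- int (Suc i), - d)"
        unfolding cz' ee_add[symmetric] lat_minus K_def by (simp del: power_Suc add: algebra_simps)
      finally show "?l d = ?r d" .
    qed
    finally have 1: "(?r has_sum (-1) ^ Suc n * (cnj (czero n s i) * periodization n (of_nat (Suc i) * \<tau>) (1 - t))) UNIV" .
    have "((\<lambda>d. K * lat n t s \<tau> (- int (Suc i), d)) has_sum K * L (- int (Suc i))) UNIV"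
      unfolding L_def by (intro has_sum_cmult_right has_sum_infsum slm')
    then have "(?r has_sum K * L (- int (Suc i))) UNIV"
      using has_sum_reindex_bij_betw[of uminus UNIV UNIV "\<lambda>d::int. K * lat n t s \<tau> (- int (Suc i), d)" "K * L (- int (Suc i))"]
      by (simp add: bij_uminus)
    with 1 show "(-1) ^ Suc n * (cnj (czero n s i) * periodization n (of_nat (Suc i) * \<tau>) (1 - t)) = K * L (- int (Suc i))"
      by (rule has_sum_unique)
  qed
  \<comment> \<open>In the row m = 0 both factors of the denominator are powers of -d, so the row is
    a multiple of the Fourier series of the Bernoulli polynomial; at d = 0 both sides vanish through
    division by zero.\<close>
  have B: "of_real ((- 4 * pi * Im \<tau>) ^ n * bernoulli_poly (Suc n) t / fact (Suc n)) = - (K * L 0)"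
  proof -
    define C where "C = complex_of_real ((- 4 * pi * Im \<tau>) ^ n / fact (Suc n))"
    have "((\<lambda>d. C * (- fact (Suc n) / (2 * of_real pi * \<i> * of_int d) ^ Suc n * ee (of_int d * of_real t))) has_sum
           C * complex_of_real (bernoulli_poly (Suc n) t)) UNIV"
      using n tt by (intro has_sum_cmult_right bernoulli_poly_fourier_series) auto
    also have "(\<lambda>d. C * (- fact (Suc n) / (2 * of_real pi * \<i> * of_int d) ^ Suc n * ee (of_int d * of_real t))) =
        (\<lambda>d. - K * lat n t s \<tau> (0, d))"
    proof
      fix d :: int
      have p: "(- of_int d) * (- of_int d) ^ n = (- 1) ^ Suc n * (of_int d ^ Suc n :: complex)"
        using power_minus[of "of_int d :: complex" "Suc n"] by simp
      have "(- 4 * pi * Im \<tau>) ^ n = (- 1) ^ n * (4 * pi * Im \<tau>) ^ n"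
        using power_minus[of "4 * pi * Im \<tau>" n] by simp
      then have C: "C = (- 1) ^ n * of_real (4 * pi * Im \<tau>) ^ n / fact (Suc n)"
        by (simp add: C_def)
      have inv: "inverse ((- 1 :: complex) ^ Suc n) = - ((- 1) ^ n)" by (cases "even n") auto
      show "C * (- fact (Suc n) / (2 * of_real pi * \<i> * of_int d) ^ Suc n * ee (of_int d * of_real t)) = - K * lat n t s \<tau> (0, d)"
        unfolding lat_def prod.case of_int_0 mult_zero_left diff_0 p C K_def power_mult_distrib[of "2 * of_real pi * \<i>"]
        by (simp del: power_Suc fact_Suc add: divide_inverse inv mult_ac)
    qed
    finally have 1: "((\<lambda>d. - K * lat n t s \<tau> (0, d)) has_sum C * complex_of_real (bernoulli_poly (Suc n) t)) UNIV" .
    have "((\<lambda>d. - K * lat n t s \<tau> (0, d)) has_sum - K * L 0) UNIV"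
      unfolding L_def by (intro has_sum_cmult_right has_sum_infsum slm')
    with 1 have "C * complex_of_real (bernoulli_poly (Suc n) t) = - K * L 0" by (rule has_sum_unique)
    then show ?thesis by (simp add: C_def)
  qed
  have "(\<lambda>i. K * L (int (Suc i)) + K * L (- int (Suc i))) sums (Ecal_hat (Suc n) (of_real t * \<tau> + of_real s) \<tau> - K * L 0)"
    using Ecal_hat_periodization_sums[OF v t n, of s] unfolding per B by simp
  moreover have "(\<lambda>i. K * L (int (Suc i)) + K * L (- int (Suc i))) sums (K * (kron n t s \<tau> - L 0))"
    using sums_mult[OF sums_int_from_nat[OF sL], of K] unfolding iL by (simp add: ring_distribs)
  ultimately have "Ecal_hat (Suc n) (of_real t * \<tau> + of_real s) \<tau> - K * L 0 = K * (kron n t s \<tau> - L 0)"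
    by (rule sums_unique2)
  then show ?thesis by (simp add: K_def ring_distribs)
qed

lemma kron_periodic: "kron n (t + of_int k) s \<tau> = kron n t s \<tau>"
proof -
  have "ee (of_real (of_int m * s + of_int d * (t + of_int k))) = ee (of_real (of_int m * s + of_int d * t))" for m d :: int
  proof -
    have "complex_of_real (of_int m * s + of_int d * (t + of_int k)) = of_real (of_int m * s + of_int d * t) + of_int (d * k)"
      by (simp add: algebra_simps)
    then show ?thesis by (simp only: ee_add ee_of_int mult_1_right)
  qed
  then show ?thesis by (simp add: kron_def lat_def)
qed

theorem Ecal_hat_eq_kron:
  assumes v: "Im \<tau> > 0" and n: "n \<ge> 2"
  shows "Ecal_hat (Suc n) (of_real t * \<tau> + of_real s) \<tau> =
    - (of_real (4 * pi * Im \<tau>) ^ n / (2 * of_real pi * \<i>) ^ Suc n) * kron n t s \<tau>"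
proof -
  have t: "t = frac t + of_int \<lfloor>t\<rfloor>" by (simp add: frac_def)
  have "of_real t * \<tau> + of_real s = (of_real (frac t) * \<tau> + of_real s) + of_int \<lfloor>t\<rfloor> * \<tau>"
    by (subst t) (simp add: algebra_simps)
  then have "Ecal_hat (Suc n) (of_real t * \<tau> + of_real s) \<tau> = Ecal_hat (Suc n) (of_real (frac t) * \<tau> + of_real s) \<tau>"
    using Ecal_hat_translate_tau[OF v] by metis
  also have "\<dots> = - (of_real (4 * pi * Im \<tau>) ^ n / (2 * of_real pi * \<i>) ^ Suc n) * kron n (frac t) s \<tau>"
    by (rule Ecal_hat_eq_kron_aux[OF v _ _ n]) (auto simp: frac_lt_1)
  also have "kron n (frac t) s \<tau> = kron n t s \<tau>"
    by (subst (2) t) (rule kron_periodic [symmetric])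
  finally show ?thesis .
qed

section \<open>The action of SL_2(Z) on the lattice sum\<close>

lemma SL2Z_det: "A \<in> SL2Z \<Longrightarrow> A $ 1 $ 1 * A $ 2 $ 2 - A $ 1 $ 2 * A $ 2 $ 1 = (1::int)"
  by (simp add: SL2Z_def det_2)

lemma automorphy_nonzero:
  assumes "A \<in> SL2Z" "Im \<tau> > 0" shows "automorphy A \<tau> \<noteq> 0"
proof
  assume 0: "automorphy A \<tau> = 0"
  then have "Im (automorphy A \<tau>) = 0" "Re (automorphy A \<tau>) = 0" by auto
  then have "A $ 2 $ 1 = 0" "A $ 2 $ 2 = 0" using assms(2) by (auto simp: automorphy_def)
  then show False using SL2Z_det[OF assms(1)] by simp
qed

lemma Im_moebius:
  assumes A: "A \<in> SL2Z" and v: "Im \<tau> > 0"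
  shows "Im (moebius A \<tau>) = Im \<tau> / (norm (automorphy A \<tau>))\<^sup>2"
proof -
  define a b c d where "a = real_of_int (A $ 1 $ 1)" "b = real_of_int (A $ 1 $ 2)" "c = real_of_int (A $ 2 $ 1)" "d = real_of_int (A $ 2 $ 2)"
  have det: "a * d - b * c = 1"
    using SL2Z_det[OF A] unfolding a_b_c_d_def of_int_mult[symmetric] of_int_diff[symmetric] by simp
  have m: "moebius A \<tau> = (of_real a * \<tau> + of_real b) / automorphy A \<tau>"
    by (simp add: moebius_def automorphy_def a_b_c_d_def)
  have "Im (moebius A \<tau>) = Im ((of_real a * \<tau> + of_real b) * cnj (automorphy A \<tau>)) / (norm (automorphy A \<tau>))\<^sup>2"
    unfolding m Im_complex_div_eq_0 complex_div_cnj[of "of_real a * \<tau> + of_real b"]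
    by (simp add: cmod_power2 flip: of_real_power)
  also have "Im ((of_real a * \<tau> + of_real b) * cnj (automorphy A \<tau>)) = (a * d - b * c) * Im \<tau>"
    by (simp add: automorphy_def a_b_c_d_def algebra_simps)
  finally show ?thesis by (simp add: det)
qed

lemma Im_moebius_pos: "A \<in> SL2Z \<Longrightarrow> Im \<tau> > 0 \<Longrightarrow> Im (moebius A \<tau>) > 0"
  using automorphy_nonzero[of A \<tau>] by (simp add: Im_moebius)

text \<open>Clearing the denominator c \<tau> + d turns a lattice vector at the transformed point
  into one at \<tau>, through a unimodular change of (m, k). The pair (t, s) transforms so that the
  phase of each term is preserved.\<close>

lemma kron_moebius:
  assumes A: "A \<in> SL2Z" and v: "Im \<tau> > 0"
  shows "kron n t s (moebius A \<tau>) = automorphy A \<tau> * cnj (automorphy A \<tau>) ^ n *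
     kron n (of_int (A $ 1 $ 1) * t + of_int (A $ 2 $ 1) * s) (of_int (A $ 1 $ 2) * t + of_int (A $ 2 $ 2) * s) \<tau>"
proof -
  define a b c d where "a = A $ 1 $ 1" "b = A $ 1 $ 2" "c = A $ 2 $ 1" "d = A $ 2 $ 2"
  have det: "a * d - b * c = 1"
    using SL2Z_det[OF A] by (simp add: a_b_c_d_def)
  define j where "j = automorphy A \<tau>"
  have j: "j \<noteq> 0" using automorphy_nonzero[OF A v] by (simp add: j_def)
  have jdef: "j = of_int c * \<tau> + of_int d" by (simp add: j_def automorphy_def a_b_c_d_def)
  have m: "moebius A \<tau> = (of_int a * \<tau> + of_int b) / j"
    by (simp add: moebius_def jdef a_b_c_d_def)
  \<comment> \<open>Coefficients of m (a \<tau> + b) - k (c \<tau> + d), written as m' \<tau> -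
    k'.\<close>
  define \<phi> where "\<phi> = (\<lambda>(m, k). (m * a - k * c, k * d - m * b))"
  define t' where "t' = of_int a * t + of_int c * s"
  define s' where "s' = of_int b * t + of_int d * s"
  have i1: "(m * a - k * c) * d + (k * d - m * b) * c = m" for m k :: int
  proof -
    have "(m * a - k * c) * d + (k * d - m * b) * c = m * (a * d - b * c)" by (simp add: algebra_simps)
    then show ?thesis by (simp add: det)
  qed
  have i2: "(m * a - k * c) * b + (k * d - m * b) * a = k" for m k :: int
  proof -
    have "(m * a - k * c) * b + (k * d - m * b) * a = k * (a * d - b * c)" by (simp add: algebra_simps)
    then show ?thesis by (simp add: det)
  qed
  have i3: "(m * d + k * c) * a - (m * b + k * a) * c = m" "(m * b + k * a) * d - (m * d + k * c) * b = k" for m k :: int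
  proof -
    have "(m * d + k * c) * a - (m * b + k * a) * c = m * (a * d - b * c)" "(m * b + k * a) * d - (m * d + k * c) * b = k * (a * d - b * c)"
      by (simp_all add: algebra_simps)
    then show "(m * d + k * c) * a - (m * b + k * a) * c = m" "(m * b + k * a) * d - (m * d + k * c) * b = k" by (simp_all add: det)
  qed
  have bij: "bij_betw \<phi> UNIV UNIV"
    by (rule bij_betwI[of _ _ _ "\<lambda>(m, k). (m * d + k * c, m * b + k * a)"]) (auto simp: \<phi>_def i1 i2 i3)
  have "lat n t s (moebius A \<tau>) x = j * cnj j ^ n * lat n t' s' \<tau> (\<phi> x)" for x
  proof -
    obtain m k where x: "x = (m, k)" by force
    have 1: "of_int m * moebius A \<tau> - of_int k = (of_int (m * a - k * c) * \<tau> - of_int (k * d - m * b)) / j"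
      unfolding m using j by (simp add: field_simps) (simp add: jdef algebra_simps)
    have 2: "of_int m * cnj (moebius A \<tau>) - of_int k = (of_int (m * a - k * c) * cnj \<tau> - of_int (k * d - m * b)) / cnj j"
      using arg_cong[OF 1, of cnj] by simp
    have "of_int (m * a - k * c) * s' + of_int (k * d - m * b) * t' = 
       of_int ((m * a - k * c) * d + (k * d - m * b) * c) * s + of_int ((m * a - k * c) * b + (k * d - m * b) * a) * t"
      by (simp add: s'_def t'_def algebra_simps)
    then have 3: "of_int m * s + of_int k * t = of_int (m * a - k * c) * s' + of_int (k * d - m * b) * t'"
      unfolding i1 i2 by simp
    show ?thesis
      unfolding x lat_def \<phi>_def prod.case 1 2 3 power_divide using j by (simp add: field_simps)
  qed
  then have "kron n t s (moebius A \<tau>) = (\<Sum>\<^sub>\<infinity>x. j * cnj j ^ n * lat n t' s' \<tau> (\<phi> x))"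
    unfolding kron_def by (intro infsum_cong)
  also have "\<dots> = j * cnj j ^ n * (\<Sum>\<^sub>\<infinity>x. lat n t' s' \<tau> (\<phi> x))"
    using j by (simp add: infsum_cmult_right')
  also have "(\<Sum>\<^sub>\<infinity>x. lat n t' s' \<tau> (\<phi> x)) = kron n t' s' \<tau>"
    unfolding kron_def by (rule infsum_reindex_bij_betw[OF bij])
  finally show ?thesis by (simp add: j_def t'_def s'_def a_b_c_d_def)
qed

theorem Ecal_hat_moebius_ge3:
  assumes A: "A \<in> SL2Z" and v: "Im \<tau> > 0" and n: "n \<ge> 2"
  shows "Ecal_hat (Suc n) (of_real t * moebius A \<tau> + of_real s) (moebius A \<tau>) =
    automorphy A \<tau> powi (1 - int n) *
     Ecal_hat (Suc n) (of_real (of_int (A $ 1 $ 1) * t + of_int (A $ 2 $ 1) * s) * \<tau> + of_real (of_int (A $ 1 $ 2) * t + of_int (A $ 2 $ 2) * s)) \<tau>"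
proof -
  define j where "j = automorphy A \<tau>"
  have j: "j \<noteq> 0" using automorphy_nonzero[OF A v] by (simp add: j_def)
  have I: "complex_of_real (4 * pi * Im (moebius A \<tau>)) ^ n = of_real (4 * pi * Im \<tau>) ^ n / (j * cnj j) ^ n"
    unfolding Im_moebius[OF A v] j_def [symmetric] complex_norm_square [symmetric]
    by (simp flip: power_divide)
  \<comment> \<open>The lattice sum contributes j cnj(j)^n and the power v^n contributes (j cnj
    j)^(-n), so the conjugate factors cancel and the weight is 1 - n = 2 - a.\<close>
  have "(j * cnj j ^ n) / (j * cnj j) ^ n = j powi (1 - int n)"
    using j by (simp add: power_mult_distrib power_int_diff)
  then have "X / (j * cnj j) ^ n / Y * (j * cnj j ^ n * Z) = j powi (1 - int n) * (X / Y * Z)" for X Y Z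
    by (metis (no_types, lifting) mult.assoc mult.commute times_divide_eq_left times_divide_eq_right)
  then show ?thesis
    unfolding Ecal_hat_eq_kron[OF v n] Ecal_hat_eq_kron[OF Im_moebius_pos[OF A v] n] kron_moebius[OF A v] I j_def[symmetric]
    by simp
qed

section \<open>Dependence on the elliptic variable\<close>

text \<open>For fixed \<open>\<tau>\<close>, the parts of the expansion of \<open>Ecal_hat\<close> are again exponential series in \<open>z\<close>:
  \<open>Lser\<close> is the row through \<open>z\<close>, and \<open>User\<close>, taken at \<open>\<tau> + z\<close> and at \<open>\<tau> - z\<close>, the rows above and
  below it.\<close>

definition licoef :: "nat \<Rightarrow> nat \<Rightarrow> complex" where
  "licoef n i = 1 / of_nat (Suc i) ^ n"

definition liexp :: "nat \<Rightarrow> real" where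
  "liexp i = real (Suc i)"

text \<open>Here j starts at 0; the shift to the row l = 1 lies in the argument \<tau> + z or \<tau>
  - z. The power k = 1 occurs for a = 3, where the truncated exponential brings out a factor linear
  in j.\<close>

definition ucoef :: "nat \<Rightarrow> nat \<Rightarrow> complex \<Rightarrow> nat \<times> nat \<Rightarrow> complex" where
  "ucoef k n \<tau> = (\<lambda>(i, j). of_nat j ^ k * ee (of_nat (Suc i) * (of_nat j * \<tau>)) / of_nat (Suc i) ^ n)"

definition uexp :: "nat \<times> nat \<Rightarrow> real" where
  "uexp = (\<lambda>(i, j). real (Suc i))"

abbreviation Lser :: "nat \<Rightarrow> complex \<Rightarrow> complex" where
  "Lser n \<equiv> exp_series UNIV (licoef n) liexp"

abbreviation User :: "nat \<Rightarrow> nat \<Rightarrow> complex \<Rightarrow> complex \<Rightarrow> complex" where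
  "User k n \<tau> \<equiv> exp_series UNIV (ucoef k n \<tau>) uexp"

lemma norm_licoef_le: "norm (licoef n i) \<le> 1"
  using norm_czero_le[of n 0 i] by (simp add: licoef_def czero_def)

lemma exp_summable_licoef: "exp_summable UNIV (licoef n) liexp"
  unfolding exp_summable_def
proof (intro conjI allI impI ballI)
  show "0 \<le> liexp i" for i by (simp add: liexp_def)
  fix \<delta> :: real assume \<delta>: "\<delta> > 0"
  show "(\<lambda>i. norm (licoef n i) * exp (- \<delta> * liexp i)) summable_on UNIV"
  proof (rule summable_on_comparison_real[OF summable_on_exp_neg_nat[OF \<delta>]])
    fix i
    have "norm (licoef n i) * exp (- \<delta> * liexp i) \<le> 1 * exp (- \<delta> * real i)"
      using \<delta> by (intro mult_mono norm_licoef_le) (auto simp: liexp_def)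
    then show "norm (licoef n i) * exp (- \<delta> * liexp i) \<le> exp (- \<delta> * real i)" by simp
  qed auto
qed

text \<open>Decay in j comes from the coefficient, since \<tau> is fixed, and decay in i from the
  exponent. The smaller of the two rates bounds the double series by exp(- \<rho> (i+1)
  (j+1)).\<close>

lemma exp_summable_ucoef:
  assumes v: "Im \<tau> > 0" and k: "k \<le> 1"
  shows "exp_summable UNIV (ucoef k n \<tau>) uexp"
proof -
  define r where "r = pi * Im \<tau>"
  have r: "r > 0" using v by (simp add: r_def)
  define M where "M = max 1 (1 / r)"
  have b: "norm (ucoef k n \<tau> (i, j)) \<le> M * exp (- r * (real (Suc i) * real j))" for i j
  proof -
    have j: "real j ^ k \<le> M * exp (r * real j)"
    proof (cases "k = 0")
      case True
      have "1 * 1 \<le> M * exp (r * real j)" using r by (intro mult_mono) (auto simp: M_def)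
      then show ?thesis using True by simp
    next
      case False
      then have k1: "k = 1" using k by simp
      have "r * real j \<le> exp (r * real j)" using exp_ge_add_one_self[of "r * real j"] by linarith
      then have "real j \<le> 1 / r * exp (r * real j)" using r by (simp add: field_simps)
      also have "\<dots> \<le> M * exp (r * real j)" by (intro mult_right_mono) (auto simp: M_def)
      finally show ?thesis by (simp add: k1)
    qed
    have "norm (ucoef k n \<tau> (i, j)) = real j ^ k * exp (- (2 * r) * (real (Suc i) * real j)) * norm (licoef n i)"
      by (simp add: ucoef_def licoef_def norm_mult norm_divide norm_power norm_ee r_def mult_ac del: of_nat_Suc)
    also have "\<dots> \<le> (M * exp (r * real j)) * exp (- (2 * r) * (real (Suc i) * real j)) * 1"
      using j by (intro mult_mono norm_licoef_le) (auto simp: M_def)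
    also have "\<dots> = M * exp (r * real j - (2 * r) * (real (Suc i) * real j))"
      by (simp add: mult.assoc flip: exp_add)
    also have "\<dots> \<le> M * exp (- r * (real (Suc i) * real j))"
      using r by (intro mult_left_mono) (auto simp: M_def algebra_simps)
    finally show ?thesis .
  qed
  show ?thesis
    unfolding exp_summable_def
  proof (intro conjI allI impI ballI)
    show "0 \<le> uexp x" for x by (cases x) (simp add: uexp_def)
    fix \<delta> :: real assume \<delta>: "\<delta> > 0"
    define \<rho> where "\<rho> = min r \<delta>"
    have \<rho>: "\<rho> > 0" "\<rho> \<le> r" "\<rho> \<le> \<delta>" using r \<delta> by (auto simp: \<rho>_def)
    have "(\<lambda>x. M * (case x of (i, j) \<Rightarrow> exp (- \<rho> * (real (Suc i) * real (Suc j))))) summable_on UNIV"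
      by (intro summable_on_cmult_right summable_on_exp_neg_prod \<rho>)
    then show "(\<lambda>x. norm (ucoef k n \<tau> x) * exp (- \<delta> * uexp x)) summable_on UNIV"
    proof (rule summable_on_comparison_real)
      fix x :: "nat \<times> nat"
      obtain i j where x: "x = (i, j)" by force
      have "norm (ucoef k n \<tau> x) * exp (- \<delta> * uexp x) \<le> M * exp (- r * (real (Suc i) * real j)) * exp (- \<delta> * real (Suc i))"
        unfolding x uexp_def prod.case by (intro mult_right_mono b) auto
      also have "\<dots> = M * exp (- (r * (real (Suc i) * real j) + \<delta> * real (Suc i)))"
        by (simp add: mult.assoc flip: exp_add)
      also have "\<dots> \<le> M * exp (- \<rho> * (real (Suc i) * real (Suc j)))"
      proof -
        have "\<rho> * (real (Suc i) * real j) \<le> r * (real (Suc i) * real j)" "\<rho> * real (Suc i) \<le> \<delta> * real (Suc i)"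
          using \<rho> by (auto intro!: mult_right_mono)
        then show ?thesis by (intro mult_left_mono) (auto simp: M_def algebra_simps)
      qed
      finally show "norm (ucoef k n \<tau> x) * exp (- \<delta> * uexp x) \<le> M * (case x of (i, j) \<Rightarrow> exp (- \<rho> * (real (Suc i) * real (Suc j))))"
        by (simp add: x)
    qed auto
  qed
qed

lemma Lser_deriv: "Im z > 0 \<Longrightarrow> (Lser (Suc n) has_field_derivative 2 * of_real pi * \<i> * Lser n z) (at z)"
proof -
  assume z: "Im z > 0"
  have "(\<lambda>i. licoef (Suc n) i * of_real (liexp i)) = licoef n"
    by (auto simp: licoef_def liexp_def fun_eq_iff divide_simps simp del: of_nat_Suc)
  then show ?thesis using exp_series_has_field_derivative[OF exp_summable_licoef z, of "Suc n"] by simp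
qed

lemma User_deriv:
  assumes "Im \<tau> > 0" "k \<le> 1" "Im z > 0"
  shows "(User k (Suc n) \<tau> has_field_derivative 2 * of_real pi * \<i> * User k n \<tau> z) (at z)"
proof -
  have "(\<lambda>i. ucoef k (Suc n) \<tau> i * of_real (uexp i)) = ucoef k n \<tau>"
    by (auto simp: ucoef_def uexp_def fun_eq_iff divide_simps simp del: of_nat_Suc)
  then show ?thesis using exp_series_has_field_derivative[OF exp_summable_ucoef[OF assms(1,2)] assms(3), of "Suc n"] by simp
qed

lemma ee_User_term:
  "ucoef 0 n \<tau> (i, j) * ee (of_real (uexp (i, j)) * w) = ee (of_nat (Suc i) * (w + of_nat j * \<tau>)) / of_nat (Suc i) ^ n"
proof -
  have "of_nat (Suc i) * (w + of_nat j * \<tau>) = of_nat (Suc i) * (of_nat j * \<tau>) + of_real (real (Suc i)) * w"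
    by (simp add: algebra_simps)
  then show ?thesis unfolding ucoef_def uexp_def prod.case by (simp only: ee_add) simp
qed

lemma exp_series_cplus_eq_User:
  fixes t s :: real
  assumes "z = of_real t * \<tau> + of_real s"
  shows "cplus n s (i, j) * ee (of_real (kplus t (i, j)) * \<tau>) = ucoef 0 n \<tau> (i, j) * ee (of_real (uexp (i, j)) * (z + \<tau>))"
proof -
  have "of_nat (Suc i) * (z + \<tau> + of_nat j * \<tau>) = of_nat (Suc i) * of_real s + of_real (kplus t (i, j)) * \<tau>"
    by (simp add: assms kplus_def algebra_simps)
  then show ?thesis
    unfolding ee_User_term cplus_def czero_def prod.case by (simp only: ee_add times_divide_eq_left)
qed

text \<open>Multiplication by Im \<tau> turns the exponent m (j + 1 + t) into m (Im z + Im \<tau> +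
  j Im \<tau>), because t Im \<tau> = Im z. The factor m lowers n by one; the remainder splits into
  the series for k = 0 and for k = 1.\<close>

lemma exp_series_cplus_eq_User':
  fixes t s :: real
  assumes z: "z = of_real t * \<tau> + of_real s" and v: "Im \<tau> > 0" and t: "-1 < t"
  shows "exp_series UNIV (cplus n s) (kplus t) \<tau> = User 0 n \<tau> (z + \<tau>)"
    and "of_real (Im \<tau>) * exp_series UNIV (\<lambda>x. cplus (Suc n) s x * of_real (kplus t x)) (kplus t) \<tau> =
      of_real (Im z + Im \<tau>) * User 0 n \<tau> (z + \<tau>) + of_real (Im \<tau>) * User 1 n \<tau> (z + \<tau>)"
proof -
  have zt: "Im (z + \<tau>) > 0"
  proof -
    have "(t + 1) * Im \<tau> > 0" using t v by (intro mult_pos_pos) auto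
    then show ?thesis by (simp add: z algebra_simps)
  qed
  show "exp_series UNIV (cplus n s) (kplus t) \<tau> = User 0 n \<tau> (z + \<tau>)"
    unfolding exp_series_def by (intro infsum_cong) (auto simp: exp_series_cplus_eq_User[OF z] split: prod.splits)
  have s0: "(\<lambda>x. ucoef 0 n \<tau> x * ee (of_real (uexp x) * (z + \<tau>))) summable_on UNIV"
    and s1: "(\<lambda>x. ucoef 1 n \<tau> x * ee (of_real (uexp x) * (z + \<tau>))) summable_on UNIV"
    by (auto intro!: exp_series_summable exp_summable_ucoef v zt)
  define L where "L = (\<lambda>x. of_real (Im z + Im \<tau>) * (ucoef 0 n \<tau> x * ee (of_real (uexp x) * (z + \<tau>))) +
      of_real (Im \<tau>) * (ucoef 1 n \<tau> x * ee (of_real (uexp x) * (z + \<tau>))))"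
  define R where "R = (\<lambda>x. of_real (Im \<tau>) * (cplus (Suc n) s x * of_real (kplus t x) * ee (of_real (kplus t x) * \<tau>)))"
  have "(L has_sum of_real (Im z + Im \<tau>) * User 0 n \<tau> (z + \<tau>) + of_real (Im \<tau>) * User 1 n \<tau> (z + \<tau>)) UNIV"
    unfolding exp_series_def L_def by (intro has_sum_add has_sum_cmult_right has_sum_infsum s0 s1)
  also have "L = R"
  proof
    fix x :: "nat \<times> nat"
    obtain i j where x: "x = (i, j)" by force
    have u1: "ucoef 1 n \<tau> (i, j) = of_nat j * ucoef 0 n \<tau> (i, j)" by (simp add: ucoef_def)
    have c: "cplus (Suc n) s (i, j) * of_nat (Suc i) = cplus n s (i, j)"
      by (simp add: cplus_def czero_def del: of_nat_Suc)
    have "L x = of_real (Im z + Im \<tau> + Im \<tau> * real j) * (cplus n s x * ee (of_real (kplus t x) * \<tau>))"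
      unfolding L_def x u1 exp_series_cplus_eq_User[OF z] by (simp add: algebra_simps)
    also have "\<dots> = of_real (Im \<tau> * (real (Suc j) + t)) * (cplus (Suc n) s x * of_nat (Suc i) * ee (of_real (kplus t x) * \<tau>))"
      unfolding x c by (simp add: z algebra_simps)
    also have "\<dots> = R x"
      by (simp add: x R_def kplus_def del: of_nat_Suc)
    finally show "L x = R x" .
  qed
  finally have "(R has_sum of_real (Im z + Im \<tau>) * User 0 n \<tau> (z + \<tau>) + of_real (Im \<tau>) * User 1 n \<tau> (z + \<tau>)) UNIV" .
  moreover have "(R has_sum of_real (Im \<tau>) * exp_series UNIV (\<lambda>x. cplus (Suc n) s x * of_real (kplus t x)) (kplus t) \<tau>) UNIV"
    unfolding R_def exp_series_def
    by (intro has_sum_cmult_right has_sum_infsum exp_series_summable[OF exp_summable_times_exponent[OF exp_summable_kplus[OF t]] v])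
  ultimately show "of_real (Im \<tau>) * exp_series UNIV (\<lambda>x. cplus (Suc n) s x * of_real (kplus t x)) (kplus t) \<tau> =
      of_real (Im z + Im \<tau>) * User 0 n \<tau> (z + \<tau>) + of_real (Im \<tau>) * User 1 n \<tau> (z + \<tau>)"
    using has_sum_unique by blast
qed

lemma Lser_term: "licoef n i * ee (of_real (liexp i) * z) = ee (of_nat (Suc i) * z) / of_nat (Suc i) ^ n"
  by (simp add: licoef_def liexp_def)

lemma czero_term:
  fixes t s :: real
  assumes z: "z = of_real t * \<tau> + of_real s"
  shows "czero n s i * ee (of_real (real (Suc i) * t) * \<tau>) = ee (of_nat (Suc i) * z) / of_nat (Suc i) ^ n"
proof -
  have "of_nat (Suc i) * z = of_nat (Suc i) * of_real s + of_real (real (Suc i) * t) * \<tau>"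
    by (simp add: z algebra_simps)
  then show ?thesis unfolding czero_def by (simp only: ee_add times_divide_eq_left)
qed

definition coord_t :: "complex \<Rightarrow> complex \<Rightarrow> real" where "coord_t \<tau> z = Im z / Im \<tau>"
definition coord_s :: "complex \<Rightarrow> complex \<Rightarrow> real" where "coord_s \<tau> z = Re z - coord_t \<tau> z * Re \<tau>"

lemma coord_eq: "Im \<tau> > 0 \<Longrightarrow> z = of_real (coord_t \<tau> z) * \<tau> + of_real (coord_s \<tau> z)"
  by (simp add: coord_t_def coord_s_def complex_eq_iff)

lemma coord_eq': "Im \<tau> > 0 \<Longrightarrow> - z = of_real (- coord_t \<tau> z) * \<tau> + of_real (- coord_s \<tau> z)"
  by (simp add: coord_t_def coord_s_def complex_eq_iff)

lemma block_1: "block (Suc 0) \<sigma> I c \<kappa> \<tau> = exp_series I c \<kappa> \<tau> + \<sigma> * cnj (exp_series I c \<kappa> \<tau>)"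
  by (simp add: block_def)

lemma block_2: "block (Suc (Suc 0)) \<sigma> I c \<kappa> \<tau> = exp_series I c \<kappa> \<tau> + \<sigma> * (cnj (exp_series I c \<kappa> \<tau>) +
    of_real (4 * pi) * cnj (of_real (Im \<tau>) * exp_series I (\<lambda>i. c i * of_real (\<kappa> i)) \<kappa> \<tau>))"
  by (simp add: block_def)

text \<open>For n = 1 the truncated exponential is 1 and \<sigma> = 1, so every series is added to
  its own conjugate; in particular the function is real. The sum of the row through z is kept as a
  parameter, to include its conditional convergence on the real axis.\<close>

lemma Ecal_hat_2_explicit:
  assumes v: "Im \<tau> > 0" and z: "0 \<le> Im z" "Im z < Im \<tau>"
    and S: "(\<lambda>i. ee (of_nat (Suc i) * z) / of_nat (Suc i)) sums l"
  shows "Ecal_hat 2 z \<tau> = of_real (2 * Re (l + User 0 1 \<tau> (\<tau> + z) + User 0 1 \<tau> (\<tau> - z)) +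
            2 * pi * Im \<tau> * bernoulli_poly 2 (Im z / Im \<tau>))"
proof -
  define t where "t = coord_t \<tau> z"
  define s where "s = coord_s \<tau> z"
  have zz: "z = of_real t * \<tau> + of_real s" "- z = of_real (- t) * \<tau> + of_real (- s)"
    unfolding t_def s_def by (rule coord_eq[OF v], rule coord_eq'[OF v])
  have t: "0 \<le> t" "t < 1" using z v by (simp_all add: t_def coord_t_def)
  then have t': "-1 < t" "- 1 < - t" by linarith+
  have cz: "czero (Suc 0) s i * ee (of_real (real (Suc i) * t) * \<tau>) = ee (of_nat (Suc i) * z) / of_nat (Suc i)" for i
    using czero_term[OF zz(1), of "Suc 0" i] by simp
  have ep: "exp_partial (Suc 0) x = 1" for x by (simp add: exp_partial_def)
  have sm: "summable (\<lambda>i. czero (Suc 0) s i * ee (of_real (real (Suc i) * t) * \<tau>))"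
    unfolding cz using S by (rule sums_summable)
  have S': "(\<lambda>i. cnj (ee (of_nat (Suc i) * z) / of_nat (Suc i))) sums cnj l"
    using S by (rule sums_cnj[THEN iffD2])
  have "Ecal_hat (Suc (Suc 0)) z \<tau> = (l + cnj l) + (User 0 1 \<tau> (z + \<tau>) + cnj (User 0 1 \<tau> (z + \<tau>))) +
       (User 0 1 \<tau> (- z + \<tau>) + cnj (User 0 1 \<tau> (- z + \<tau>))) - of_real ((- 4 * pi * Im \<tau>) ^ (Suc 0) * bernoulli_poly (Suc (Suc 0)) t / fact (Suc (Suc 0)))"
    using Ecal_hat_expansion[OF v t(1,2) _ sm]
    unfolding zz(1)[symmetric] cz ep block_1 exp_series_cplus_eq_User'(1)[OF zz(1) v t'(1)] exp_series_cplus_eq_User'(1)[OF zz(2) v t'(2)]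
    using sums_unique[OF S] sums_unique[OF S'] by simp
  then show ?thesis
    by (simp add: complex_add_cnj numeral_2_eq_2 t_def coord_t_def ring_distribs add.commute[of _ \<tau>] del: One_nat_def)
qed

text \<open>Stated for the conjugate, because then the factors involving Im z multiply functions
  holomorphic in z; the derivative with respect to cnj z sees only these factors, the conjugated
  series and the Bernoulli term.\<close>

lemma Ecal_hat_3_explicit:
  assumes v: "Im \<tau> > 0" and z: "0 < Im z" "Im z < Im \<tau>"
  shows "cnj (Ecal_hat 3 z \<tau>) = cnj (Lser 2 z) - Lser 2 z - of_real (4 * pi * Im z) * Lser 1 z
     + cnj (User 0 2 \<tau> (\<tau> + z)) - User 0 2 \<tau> (\<tau> + z) - of_real (4 * pi * (Im z + Im \<tau>)) * User 0 1 \<tau> (\<tau> + z) - of_real (4 * pi * Im \<tau>) * User 1 1 \<tau> (\<tau> + z)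
     - cnj (User 0 2 \<tau> (\<tau> - z)) + User 0 2 \<tau> (\<tau> - z) + of_real (4 * pi * (- Im z + Im \<tau>)) * User 0 1 \<tau> (\<tau> - z) + of_real (4 * pi * Im \<tau>) * User 1 1 \<tau> (\<tau> - z)
     - of_real ((4 * pi * Im \<tau>)\<^sup>2 / 6 * bernoulli_poly 3 (Im z / Im \<tau>))"
proof -
  define t where "t = coord_t \<tau> z"
  define s where "s = coord_s \<tau> z"
  have zz: "z = of_real t * \<tau> + of_real s" "- z = of_real (- t) * \<tau> + of_real (- s)"
    unfolding t_def s_def by (rule coord_eq[OF v], rule coord_eq'[OF v])
  have t: "0 \<le> t" "t < 1" using z v by (simp_all add: t_def coord_t_def)
  then have t': "-1 < t" "- 1 < - t" by linarith+
  have cz: "czero n s i * ee (of_real (real (Suc i) * t) * \<tau>) = licoef n i * ee (of_real (liexp i) * z)" for i n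
    unfolding Lser_term using czero_term[OF zz(1), of n i] .
  have h: "((\<lambda>i. licoef n i * ee (of_real (liexp i) * z)) has_sum Lser n z) UNIV" for n
    unfolding exp_series_def by (intro has_sum_infsum exp_series_summable exp_summable_licoef z)
  note S = has_sum_imp_sums[OF h]
  have ep: "of_real (exp_partial (Suc (Suc 0)) (4 * pi * (real (Suc i) * t) * Im \<tau>)) * cnj (licoef (Suc (Suc 0)) i * ee (of_real (liexp i) * z)) =
      cnj (licoef (Suc (Suc 0)) i * ee (of_real (liexp i) * z)) + of_real (4 * pi * Im z) * cnj (licoef (Suc 0) i * ee (of_real (liexp i) * z))" for i
  proof -
    have "licoef (Suc 0) i = of_nat (Suc i) * licoef (Suc (Suc 0)) i" by (simp add: licoef_def del: of_nat_Suc)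
    moreover have tz: "t * Im \<tau> = Im z" using v by (simp add: t_def coord_t_def)
    have e: "4 * pi * (real (Suc i) * t) * Im \<tau> = 4 * pi * Im z * real (Suc i)"
      unfolding tz[symmetric] by simp
    have "exp_partial (Suc (Suc 0)) (4 * pi * (real (Suc i) * t) * Im \<tau>) = 1 + 4 * pi * Im z * real (Suc i)"
      unfolding e by (simp add: exp_partial_def)
    ultimately show ?thesis by (simp add: ring_distribs mult_ac del: of_nat_Suc)
  qed
  have S': "(\<lambda>i. cnj (licoef (Suc (Suc 0)) i * ee (of_real (liexp i) * z)) + of_real (4 * pi * Im z) * cnj (licoef (Suc 0) i * ee (of_real (liexp i) * z)))
      sums (cnj (Lser (Suc (Suc 0)) z) + of_real (4 * pi * Im z) * cnj (Lser (Suc 0) z))"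
    by (intro sums_add sums_mult sums_cnj[THEN iffD2] S)
  have sm: "summable (\<lambda>i. czero (Suc (Suc 0)) s i * ee (of_real (real (Suc i) * t) * \<tau>))"
    unfolding cz using S by (rule sums_summable)
  have "Ecal_hat (Suc (Suc (Suc 0))) z \<tau> = Lser (Suc (Suc 0)) z - (cnj (Lser (Suc (Suc 0)) z) + of_real (4 * pi * Im z) * cnj (Lser (Suc 0) z))
    + (User 0 (Suc (Suc 0)) \<tau> (z + \<tau>) - (cnj (User 0 (Suc (Suc 0)) \<tau> (z + \<tau>)) +
        of_real (4 * pi) * cnj (of_real (Im z + Im \<tau>) * User 0 (Suc 0) \<tau> (z + \<tau>) + of_real (Im \<tau>) * User 1 (Suc 0) \<tau> (z + \<tau>))))
    - (User 0 (Suc (Suc 0)) \<tau> (- z + \<tau>) - (cnj (User 0 (Suc (Suc 0)) \<tau> (- z + \<tau>)) +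
        of_real (4 * pi) * cnj (of_real (Im (- z) + Im \<tau>) * User 0 (Suc 0) \<tau> (- z + \<tau>) + of_real (Im \<tau>) * User 1 (Suc 0) \<tau> (- z + \<tau>))))
    - of_real ((- 4 * pi * Im \<tau>) ^ (Suc (Suc 0)) * bernoulli_poly (Suc (Suc (Suc 0))) t / fact (Suc (Suc (Suc 0))))"
    using Ecal_hat_expansion[OF v t(1,2) _ sm]
    unfolding zz(1)[symmetric] cz ep block_2 exp_series_cplus_eq_User'[OF zz(1) v t'(1)] exp_series_cplus_eq_User'[OF zz(2) v t'(2)]
    using sums_unique[OF S[of "Suc (Suc 0)"]] sums_unique[OF S'] by simp
  then show ?thesis
    by (simp add: numeral_2_eq_2 numeral_3_eq_3 t_def coord_t_def add.commute[of _ \<tau>] del: One_nat_def) (simp add: algebra_simps fact_Suc)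
qed

section \<open>Differentiating the modular relation\<close>

text \<open>The remainder after \<open>N\<close> terms is the integral of \<open>w (r w)\<^sup>N / (1 - r w)\<close> over \<open>0 \<le> r \<le> 1\<close>.\<close>

lemma log_series_boundary:
  fixes w :: complex
  assumes w: "norm w \<le> 1" "w \<noteq> 1"
  shows "(\<lambda>i. w ^ Suc i / of_nat (Suc i)) sums - Ln (1 - w)"
proof -
  \<comment> \<open>The segment from 1 to 1 - w avoids the branch cut of the logarithm: meeting it
    would force r w = 1, hence r = 1 and w = 1.\<close>
  have nz: "1 - w * of_real r \<notin> \<real>\<^sub>\<le>\<^sub>0" if "0 \<le> r" "r \<le> 1" for r
  proof
    assume "1 - w * of_real r \<in> \<real>\<^sub>\<le>\<^sub>0"
    then have re: "Re (w * of_real r) \<ge> 1" and im: "Im (w * of_real r) = 0" by (auto simp: complex_nonpos_Reals_iff)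
    have "norm (w * of_real r) \<le> 1 * 1" unfolding norm_mult using w that by (intro mult_mono) auto
    then have "Re (w * of_real r) \<le> 1" using complex_Re_le_cmod[of "w * of_real r"] by linarith
    then have eq: "w * of_real r = 1" using re im by (simp add: complex_eq_iff)
    then have "norm w * r = 1" using that by (metis abs_of_nonneg norm_mult norm_of_real norm_one)
    then have "r = 1" using w that mult_le_one[of "norm w" r] mult_right_mono[of "norm w" 1 r] by auto
    then show False using eq w by simp
  qed
  define S where "S = {0..1::real}"
  have cont: "continuous_on S (\<lambda>r. inverse (norm (1 - w * of_real r)))"
  proof (intro continuous_intros ballI)
    fix r assume "r \<in> S"
    then show "norm (1 - w * of_real r) \<noteq> 0"
      using nz[of r] nonpos_Reals_zero_I unfolding S_def by (metis atLeastAtMost_iff norm_eq_zero)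
  qed
  obtain C where C: "\<And>r. r \<in> S \<Longrightarrow> inverse (norm (1 - w * of_real r)) \<le> C"
  proof -
    have "bdd_above ((\<lambda>r. inverse (norm (1 - w * of_real r))) ` S)"
      by (intro bounded_imp_bdd_above compact_imp_bounded compact_continuous_image cont) (simp add: S_def)
    then show ?thesis using that by (auto simp: bdd_above_def)
  qed
  have bound: "norm (- Ln (1 - w) - (\<Sum>i<N. w ^ Suc i / of_nat (Suc i))) \<le> C * inverse (real (Suc N))" for N
  proof -
    define F where "F = (\<lambda>x. - Ln (1 - w * x) - (\<Sum>i<N. (w * x) ^ Suc i / of_nat (Suc i)))"
    have dF: "((\<lambda>r. F (of_real r)) has_vector_derivative w * (w * of_real r) ^ N / (1 - w * of_real r)) (at r within S)" if "r \<in> S" for r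
    proof (rule has_vector_derivative_real_field)
      have d1: "((\<lambda>x. - Ln (1 - w * x)) has_field_derivative w / (1 - w * of_real r)) (at (of_real r))"
        using nz[of r] that by (auto intro!: derivative_eq_intros simp: S_def divide_inverse mult.commute)
      have d2: "((\<lambda>x. \<Sum>i<N. (w * x) ^ Suc i / of_nat (Suc i)) has_field_derivative (\<Sum>i<N. w * (w * of_real r) ^ i)) (at (of_real r))"
      proof (rule DERIV_sum)
        fix i
        have "((\<lambda>x. (w * x) ^ Suc i / of_nat (Suc i)) has_field_derivative (of_nat (Suc i) * ((w * of_real r) ^ i * w)) / of_nat (Suc i)) (at (of_real r))"
          by (rule derivative_eq_intros refl | simp del: of_nat_Suc)+
        then show "((\<lambda>x. (w * x) ^ Suc i / of_nat (Suc i)) has_field_derivative w * (w * of_real r) ^ i) (at (of_real r))"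
          by (simp add: mult.commute del: of_nat_Suc power_Suc)
      qed
      have "1 - w * of_real r \<noteq> 0" using nz[of r] that by (auto simp: S_def)
      then have "(\<Sum>i<N. (w * of_real r) ^ i) = (1 - (w * of_real r) ^ N) / (1 - w * of_real r)"
        by (intro sum_gp_strict[THEN trans]) auto
      then have "w / (1 - w * of_real r) - (\<Sum>i<N. w * (w * of_real r) ^ i) = w * (w * of_real r) ^ N / (1 - w * of_real r)"
        using \<open>1 - w * of_real r \<noteq> 0\<close> by (simp add: sum_distrib_left [symmetric] diff_divide_distrib [symmetric] right_diff_distrib)
      with DERIV_diff[OF d1 d2]
      show "(F has_field_derivative w * (w * of_real r) ^ N / (1 - w * of_real r)) (at (of_real r))"
        unfolding F_def by simp
    qed
    have I1: "((\<lambda>r. w * (w * of_real r) ^ N / (1 - w * of_real r)) has_integral F (of_real 1) - F (of_real 0)) {0..1}"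
      by (rule fundamental_theorem_of_calculus) (use dF in \<open>auto simp: S_def\<close>)
    have I2: "((\<lambda>r. C * r ^ N) has_integral C * 1 ^ Suc N / real (Suc N) - C * 0 ^ Suc N / real (Suc N)) {0..1}"
    proof (rule fundamental_theorem_of_calculus)
      fix r :: real
      have "((\<lambda>r. C * r ^ Suc N / real (Suc N)) has_real_derivative C * (real (Suc N) * r ^ (Suc N - Suc 0)) / real (Suc N)) (at r within {0..1})"
        by (intro DERIV_cdivide DERIV_cmult DERIV_pow)
      then show "((\<lambda>r. C * r ^ Suc N / real (Suc N)) has_vector_derivative C * r ^ N) (at r within {0..1})"
        by (simp add: has_real_derivative_iff_has_vector_derivative del: of_nat_Suc power_Suc)
    qed auto
    have "norm (integral {0..1} (\<lambda>r. w * (w * of_real r) ^ N / (1 - w * of_real r))) \<le> integral {0..1} (\<lambda>r. C * r ^ N)"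
    proof (rule integral_norm_bound_integral)
      show "(\<lambda>r. w * (w * of_real r) ^ N / (1 - w * of_real r)) integrable_on {0..1}"
        using I1 by (rule has_integral_integrable)
      show "(\<lambda>r. C * r ^ N) integrable_on {0..1}" using I2 by (rule has_integral_integrable)
      fix r :: real assume r: "r \<in> {0..1}"
      have "norm (w * (w * of_real r) ^ N / (1 - w * of_real r)) = (norm w ^ Suc N * r ^ N) * inverse (norm (1 - w * of_real r))"
        using r by (simp add: norm_mult norm_divide norm_power norm_inverse power_mult_distrib divide_inverse)
      also have "\<dots> \<le> (1 * r ^ N) * C"
        using r w C[of r] by (intro mult_mono power_le_one) (auto simp: S_def)
      finally show "norm (w * (w * of_real r) ^ N / (1 - w * of_real r)) \<le> C * r ^ N" by (simp add: mult.commute)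
    qed
    then have "norm (F (of_real 1) - F (of_real 0)) \<le> C * inverse (real (Suc N))"
      unfolding integral_unique[OF I1] integral_unique[OF I2] by (simp add: divide_inverse)
    then show ?thesis by (simp add: F_def)
  qed
  have "(\<lambda>N. C * inverse (real (Suc N))) \<longlonglongrightarrow> C * 0"
    by (intro tendsto_mult tendsto_const LIMSEQ_inverse_real_of_nat)
  then have "(\<lambda>N. - Ln (1 - w) - (\<Sum>i<N. w ^ Suc i / of_nat (Suc i))) \<longlonglongrightarrow> 0"
    unfolding mult_zero_right by (rule Lim_null_comparison[rotated]) (use bound in auto)
  from tendsto_diff[OF tendsto_const[of "- Ln (1 - w)"] this] show ?thesis
    by (simp add: sums_def)
qed

section \<open>The derivative of \<open>Ecal_hat 3\<close> in the elliptic variable\<close>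

lemma has_wbar_affine:
  assumes "has_wbar g D (\<alpha> * z + \<beta>)"
  shows "has_wbar (\<lambda>w. g (\<alpha> * w + \<beta>)) (cnj \<alpha> * D) z"
proof -
  obtain g' where g': "(g has_derivative g') (at (\<alpha> * z + \<beta>))" "D = (g' 1 + \<i> * g' \<i>) / 2"
    using assms by (auto simp: has_wbar_def)
  have "((\<lambda>w. \<alpha> * w + \<beta>) has_derivative (\<lambda>h. \<alpha> * h)) (at z)"
    by (auto intro!: derivative_eq_intros)
  from has_derivative_compose[OF this g'(1)]
  have d: "((\<lambda>w. g (\<alpha> * w + \<beta>)) has_derivative (\<lambda>h. g' (\<alpha> * h))) (at z)" .
  have lin: "g' h = of_real (Re h) * g' 1 + of_real (Im h) * g' \<i>" for h
  proof -
    have l: "linear g'" using g'(1) by (simp add: has_derivative_def bounded_linear.linear)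
    have "g' h = g' (Re h *\<^sub>R 1 + Im h *\<^sub>R \<i>)"
      by (rule arg_cong[of _ _ g']) (auto simp: complex_eq_iff)
    also have "\<dots> = Re h *\<^sub>R g' 1 + Im h *\<^sub>R g' \<i>" using l by (simp add: linear_add linear_scale)
    finally show ?thesis by (simp add: scaleR_conv_of_real)
  qed
  have "cnj \<alpha> * D = (g' (\<alpha> * 1) + \<i> * g' (\<alpha> * \<i>)) / 2"
    unfolding lin[of "\<alpha> * 1"] lin[of "\<alpha> * \<i>"] g'(2)
    by (simp add: complex_eq_iff algebra_simps)
  then show ?thesis using d unfolding has_wbar_def by blast
qed

lemma has_wbar_diff: "has_wbar f D \<tau> \<Longrightarrow> has_wbar g E \<tau> \<Longrightarrow> has_wbar (\<lambda>w. f w - g w) (D - E) \<tau>"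
  using has_wbar_add[of f D \<tau> "\<lambda>w. (-1) * g w" "(-1) * E"] has_wbar_cmult[of g E \<tau> "-1"] by simp

lemma bernoulli_3_deriv: "(bernoulli_poly 3 has_real_derivative 3 * bernoulli_poly 2 t) (at t within A)"
  using bernoulli_poly_deriv[of 2 t A] by (simp add: numeral_2_eq_2 numeral_3_eq_3)

lemma Ecal_hat_2_interior:
  assumes v: "Im \<tau> > 0" and z: "0 < Im z" "Im z < Im \<tau>"
  shows "Ecal_hat 2 z \<tau> = of_real (2 * Re (Lser 1 z + User 0 1 \<tau> (\<tau> + z) + User 0 1 \<tau> (\<tau> - z)) +
            2 * pi * Im \<tau> * bernoulli_poly 2 (Im z / Im \<tau>))"
proof (rule Ecal_hat_2_explicit[OF v])
  have "((\<lambda>i. licoef 1 i * ee (of_real (liexp i) * z)) has_sum Lser 1 z) UNIV"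
    unfolding exp_series_def by (intro has_sum_infsum exp_series_summable exp_summable_licoef z)
  then show "(\<lambda>i. ee (of_nat (Suc i) * z) / of_nat (Suc i)) sums Lser 1 z"
    unfolding Lser_term by (auto dest: has_sum_imp_sums)
qed (use z in auto)

text \<open>Each conjugated series with n = 2 yields a conjugated series with n = 1, and the factors
  linear in Im z release the same series without conjugation. They combine to the real parts in
  \<open>Ecal_hat 2\<close>; the polynomial part is B_3' = 3 B_2.\<close>

lemma has_wbar_cnj_Ecal_hat_3_strip:
  assumes v: "Im \<tau> > 0" and z: "0 < Im z" "Im z < Im \<tau>"
  shows "has_wbar (\<lambda>z. cnj (Ecal_hat 3 z \<tau>)) (- 2 * of_real pi * \<i> * Ecal_hat 2 z \<tau>) z"
proof -
  have zt: "Im (\<tau> + z) > 0" "Im (\<tau> - z) > 0" using z v by auto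
  have dL: "(Lser 2 has_field_derivative 2 * of_real pi * \<i> * Lser 1 z) (at z)"
    using Lser_deriv[of z 1] z by (simp add: numeral_2_eq_2)
  have dL1: "(Lser 1 has_field_derivative 2 * of_real pi * \<i> * Lser 0 z) (at z)"
    using Lser_deriv[of z 0] z by simp
  have dp: "((\<lambda>w. f (\<tau> + w)) has_field_derivative f') (at z)" if "(f has_field_derivative f') (at (\<tau> + z))" for f f'
  proof -
    have "((\<lambda>w. \<tau> + w) has_field_derivative 0 + 1) (at z)" by (intro DERIV_add DERIV_const DERIV_ident)
    from DERIV_chain2[of f f' "\<lambda>w. \<tau> + w" z "0 + 1" UNIV, OF that this] show ?thesis
      by (simp only: add_0 mult_1_right)
  qed
  have dm: "((\<lambda>w. f (\<tau> - w)) has_field_derivative - f') (at z)" if "(f has_field_derivative f') (at (\<tau> - z))" for f f'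
  proof -
    have "((\<lambda>w. \<tau> - w) has_field_derivative 0 - 1) (at z)" by (intro DERIV_diff DERIV_const DERIV_ident)
    from DERIV_chain2[of f f' "\<lambda>w. \<tau> - w" z "0 - 1" UNIV, OF that this] show ?thesis
      by (simp only: diff_0 mult_minus1_right)
  qed
  have U: "(User k 2 \<tau> has_field_derivative 2 * of_real pi * \<i> * User k 1 \<tau> w) (at w)"
    "(User k 1 \<tau> has_field_derivative 2 * of_real pi * \<i> * User k 0 \<tau> w) (at w)" if "k \<le> 1" "Im w > 0" for k w
    using User_deriv[OF v that, of 1] User_deriv[OF v that, of 0] by (simp_all add: numeral_2_eq_2)
  note Up = U[OF _ zt(1), THEN dp] and Um = U[OF _ zt(2), THEN dm]
  have eq: "\<i> * (4 * complex_of_real pi) / 2 = 2 * of_real pi * \<i>" by simp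
  have w1: "has_wbar (\<lambda>w. of_real (4 * pi * Im w)) (2 * of_real pi * \<i>) z"
    using has_wbar_real[OF DERIV_cmult[OF DERIV_ident, where c = "4 * pi"], where \<tau> = z] eq by simp
  have w2: "has_wbar (\<lambda>w. of_real (4 * pi * (Im w + Im \<tau>))) (2 * of_real pi * \<i>) z"
    using has_wbar_real[OF DERIV_cmult[OF DERIV_add[OF DERIV_ident DERIV_const[of "Im \<tau>"]], where c = "4 * pi"], where \<tau> = z] eq by simp
  have w3: "has_wbar (\<lambda>w. of_real (4 * pi * (- Im w + Im \<tau>))) (- 2 * of_real pi * \<i>) z"
    using has_wbar_real[OF DERIV_cmult[OF DERIV_add[OF DERIV_minus[OF DERIV_ident] DERIV_const[of "Im \<tau>"]], where c = "4 * pi"], where \<tau> = z] eq by simp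
  have w4: "has_wbar (\<lambda>w. of_real ((4 * pi * Im \<tau>)\<^sup>2 / 6 * bernoulli_poly 3 (Im w / Im \<tau>)))
       (\<i> / 2 * of_real ((4 * pi * Im \<tau>)\<^sup>2 / 6 * (3 * bernoulli_poly 2 (Im z / Im \<tau>) * (1 / Im \<tau>)))) z"
  proof (rule has_wbar_real[of "\<lambda>x. (4 * pi * Im \<tau>)\<^sup>2 / 6 * bernoulli_poly 3 (x / Im \<tau>)"])
    show "((\<lambda>x. (4 * pi * Im \<tau>)\<^sup>2 / 6 * bernoulli_poly 3 (x / Im \<tau>)) has_real_derivative
        (4 * pi * Im \<tau>)\<^sup>2 / 6 * (3 * bernoulli_poly 2 (Im z / Im \<tau>) * (1 / Im \<tau>))) (at (Im z))"
      by (intro DERIV_cmult DERIV_chain2[OF bernoulli_3_deriv] DERIV_cdivide DERIV_ident)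
  qed
  have "has_wbar (\<lambda>z. cnj (Lser 2 z) - Lser 2 z - of_real (4 * pi * Im z) * Lser 1 z
     + cnj (User 0 2 \<tau> (\<tau> + z)) - User 0 2 \<tau> (\<tau> + z) - of_real (4 * pi * (Im z + Im \<tau>)) * User 0 1 \<tau> (\<tau> + z) - of_real (4 * pi * Im \<tau>) * User 1 1 \<tau> (\<tau> + z)
     - cnj (User 0 2 \<tau> (\<tau> - z)) + User 0 2 \<tau> (\<tau> - z) + of_real (4 * pi * (- Im z + Im \<tau>)) * User 0 1 \<tau> (\<tau> - z) + of_real (4 * pi * Im \<tau>) * User 1 1 \<tau> (\<tau> - z)
     - of_real ((4 * pi * Im \<tau>)\<^sup>2 / 6 * bernoulli_poly 3 (Im z / Im \<tau>)))
    (cnj (2 * of_real pi * \<i> * Lser 1 z) - 0 - (of_real (4 * pi * Im z) * 0 + 2 * of_real pi * \<i> * Lser 1 z)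
     + cnj (2 * of_real pi * \<i> * User 0 1 \<tau> (\<tau> + z)) - 0 - (of_real (4 * pi * (Im z + Im \<tau>)) * 0 + 2 * of_real pi * \<i> * User 0 1 \<tau> (\<tau> + z)) - of_real (4 * pi * Im \<tau>) * 0
     - cnj (- (2 * of_real pi * \<i> * User 0 1 \<tau> (\<tau> - z))) + 0 + (of_real (4 * pi * (- Im z + Im \<tau>)) * 0 + (- 2 * of_real pi * \<i>) * User 0 1 \<tau> (\<tau> - z)) + of_real (4 * pi * Im \<tau>) * 0
     - \<i> / 2 * of_real ((4 * pi * Im \<tau>)\<^sup>2 / 6 * (3 * bernoulli_poly 2 (Im z / Im \<tau>) * (1 / Im \<tau>)))) z" (is "has_wbar _ ?D _")
    by (intro has_wbar_add has_wbar_diff has_wbar_cmult has_wbar_mult w1 w2 w3 w4 has_wbar_cnj_holomorphic dL Up(1) Um(1)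
         has_wbar_holomorphic[OF dL] has_wbar_holomorphic[OF dL1] has_wbar_holomorphic[OF Up(1)] has_wbar_holomorphic[OF Up(2)]
         has_wbar_holomorphic[OF Um(1)] has_wbar_holomorphic[OF Um(2)]) auto
  also have "?D = - 2 * of_real pi * \<i> * Ecal_hat 2 z \<tau>"
    unfolding Ecal_hat_2_interior[OF v z] using v
    by (simp add: complex_eq_iff power2_eq_square algebra_simps)
  finally show ?thesis
  proof (rule has_wbar_cong)
    show "open {w. 0 < Im w \<and> Im w < Im \<tau>}"
      by (intro open_Collect_conj open_Collect_less continuous_intros)
    show "z \<in> {w. 0 < Im w \<and> Im w < Im \<tau>}" using z by simp
  qed (use Ecal_hat_3_explicit[OF v] in auto)
qed

lemma has_wbar_cnj_Ecal_hat_3: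
  assumes v: "Im \<tau> > 0" and z: "Im z / Im \<tau> \<notin> \<int>"
  shows "has_wbar (\<lambda>z. cnj (Ecal_hat 3 z \<tau>)) (- 2 * of_real pi * \<i> * Ecal_hat 2 z \<tau>) z"
proof -
  define k where "k = \<lfloor>Im z / Im \<tau>\<rfloor>"
  have k: "of_int k < Im z / Im \<tau>" "Im z / Im \<tau> < of_int k + 1"
  proof -
    have "of_int k \<noteq> Im z / Im \<tau>" using z by (metis Ints_of_int)
    then show "of_int k < Im z / Im \<tau>" unfolding k_def using of_int_floor_le[of "Im z / Im \<tau>"] by linarith
    show "Im z / Im \<tau> < of_int k + 1" unfolding k_def by linarith
  qed
  define z' where "z' = z + of_int (- k) * \<tau>"
  have z': "0 < Im z'" "Im z' < Im \<tau>" using k v by (auto simp: z'_def field_simps)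
  have "has_wbar (\<lambda>z. cnj (Ecal_hat 3 z \<tau>)) (- 2 * of_real pi * \<i> * Ecal_hat 2 z' \<tau>) (1 * z + of_int (- k) * \<tau>)"
    using has_wbar_cnj_Ecal_hat_3_strip[OF v z'] by (simp add: z'_def)
  from has_wbar_affine[OF this] show ?thesis
    unfolding z'_def mult_1 Ecal_hat_translate_tau[OF v] by simp
qed

text \<open>The form of the law that can be differentiated in z at fixed \<tau>: in real coordinates
  the transformation of (t, s) amounts to z going to z / (c \<tau> + d).\<close>

lemma Ecal_hat_moebius_z:
  assumes A: "A \<in> SL2Z" and v: "Im \<tau> > 0" and n: "n \<ge> 2"
  shows "Ecal_hat (Suc n) (z / automorphy A \<tau>) (moebius A \<tau>) = automorphy A \<tau> powi (1 - int n) * Ecal_hat (Suc n) z \<tau>"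
proof -
  define a b c d where "a = real_of_int (A $ 1 $ 1)" "b = real_of_int (A $ 1 $ 2)" "c = real_of_int (A $ 2 $ 1)" "d = real_of_int (A $ 2 $ 2)"
  have det: "a * d - b * c = 1"
    using SL2Z_det[OF A] unfolding a_b_c_d_def of_int_mult[symmetric] of_int_diff[symmetric] by simp
  define t' where "t' = coord_t \<tau> z"
  define s' where "s' = coord_s \<tau> z"
  \<comment> \<open>The inverse matrix applied to the coordinates of z, so that the forward action
    returns them.\<close>
  define t where "t = d * t' - c * s'"
  define s where "s = a * s' - b * t'"
  have j: "automorphy A \<tau> \<noteq> 0" by (rule automorphy_nonzero[OF A v])
  have "a * t + c * s = (a * d - b * c) * t'" "b * t + d * s = (a * d - b * c) * s'"
    by (simp_all add: t_def s_def algebra_simps)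
  then have ts: "a * t + c * s = t'" "b * t + d * s = s'" by (simp_all add: det)
  have z: "z = of_real t' * \<tau> + of_real s'" unfolding t'_def s'_def by (rule coord_eq[OF v])
  have jj: "automorphy A \<tau> = of_real c * \<tau> + of_real d" by (simp add: automorphy_def a_b_c_d_def)
  have "(of_real t * moebius A \<tau> + of_real s) * automorphy A \<tau> = of_real t * (of_real a * \<tau> + of_real b) + of_real s * automorphy A \<tau>"
    using j by (simp add: moebius_def a_b_c_d_def automorphy_def field_simps)
  also have "\<dots> = of_real (a * t + c * s) * \<tau> + of_real (b * t + d * s)"
    unfolding jj by (simp add: algebra_simps)
  also have "\<dots> = z" unfolding ts z ..
  finally have "of_real t * moebius A \<tau> + of_real s = z / automorphy A \<tau>"
    using j by (simp add: field_simps)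
  then show ?thesis
    using Ecal_hat_moebius_ge3[OF A v n, of t s] unfolding a_b_c_d_def [symmetric] ts z [symmetric] by simp
qed

text \<open>As \<open>\<partial>/\<partial>z\<close> maps \<open>Ecal_hat 3\<close> to a multiple of \<open>Ecal_hat 2\<close>, differentiating the modular relation
  for \<open>a = 3\<close> yields the one for \<open>a = 2\<close>, whose lattice sum converges only conditionally.\<close>

lemma Ecal_hat_2_moebius_generic:
  assumes A: "A \<in> SL2Z" and v: "Im \<tau> > 0"
    and z: "Im z / Im \<tau> \<notin> \<int>" "Im (z / automorphy A \<tau>) / Im (moebius A \<tau>) \<notin> \<int>"
  shows "Ecal_hat 2 (z / automorphy A \<tau>) (moebius A \<tau>) = Ecal_hat 2 z \<tau>"
proof -
  define j where "j = automorphy A \<tau>"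
  have j: "j \<noteq> 0" unfolding j_def by (rule automorphy_nonzero[OF A v])
  have eq: "cnj (Ecal_hat 3 (inverse j * w + 0) (moebius A \<tau>)) = cnj (inverse j) * cnj (Ecal_hat 3 w \<tau>)" for w
    using Ecal_hat_moebius_z[OF A v, of 2 w]
    by (simp add: j_def numeral_3_eq_3 numeral_2_eq_2 power_int_minus divide_inverse mult.commute)
  \<comment> \<open>The chain rule produces the factor cnj(1/j), which is also the conjugate of the
    automorphy factor of weight -1. The two cancel, leaving weight 0.\<close>
  have "has_wbar (\<lambda>w. cnj (Ecal_hat 3 (inverse j * w + 0) (moebius A \<tau>)))
      (cnj (inverse j) * (- 2 * of_real pi * \<i> * Ecal_hat 2 (z / j) (moebius A \<tau>))) z"
    by (rule has_wbar_affine)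
       (use has_wbar_cnj_Ecal_hat_3[OF Im_moebius_pos[OF A v] z(2)] in \<open>simp add: j_def divide_inverse mult.commute\<close>)
  moreover have "has_wbar (\<lambda>w. cnj (Ecal_hat 3 (inverse j * w + 0) (moebius A \<tau>)))
      (cnj (inverse j) * (- 2 * of_real pi * \<i> * Ecal_hat 2 z \<tau>)) z"
    unfolding eq by (rule has_wbar_cmult[OF has_wbar_cnj_Ecal_hat_3[OF v z(1)]])
  ultimately have "cnj (inverse j) * (- 2 * of_real pi * \<i> * Ecal_hat 2 (z / j) (moebius A \<tau>)) =
     cnj (inverse j) * (- 2 * of_real pi * \<i> * Ecal_hat 2 z \<tau>)"
    by (rule has_wbar_unique)
  then show ?thesis using j by (simp add: j_def)
qed

text \<open>Minus the identity fixes \<tau>, has automorphy factor -1, and therefore sends z to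
  -z.\<close>

lemma Ecal_hat_2_minus:
  assumes v: "Im \<tau> > 0" and z: "Im z / Im \<tau> \<notin> \<int>"
  shows "Ecal_hat 2 (- z) \<tau> = Ecal_hat 2 z \<tau>"
proof -
  define A :: "int ^ 2 ^ 2" where "A = - mat 1"
  have c: "A $ 1 $ 1 = -1" "A $ 2 $ 2 = -1" "A $ 1 $ 2 = 0" "A $ 2 $ 1 = 0"
    by (simp_all add: A_def mat_def)
  have A: "A \<in> SL2Z" by (simp add: SL2Z_def det_2 c)
  have 1: "automorphy A \<tau> = -1" "moebius A \<tau> = \<tau>" by (simp_all add: automorphy_def moebius_def c)
  have "- (Im z / Im \<tau>) \<notin> \<int>" using z by simp
  then show ?thesis
    using Ecal_hat_2_moebius_generic[OF A v z] unfolding 1 by simp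
qed

section \<open>The case \<open>a = 2\<close> and the regularized limit\<close>

text \<open>\<open>Ecal_hat 2\<close> is -2 log of the absolute value of the Siegel function
  (Kronecker's second limit formula). This is the part that remains after splitting off its factor 1
  - e(z), and it is regular at z = 0.\<close>

definition kronecker_log :: "complex \<Rightarrow> complex \<Rightarrow> real" where
  "kronecker_log \<tau> z = 2 * Re (User 0 1 \<tau> (\<tau> + z) + User 0 1 \<tau> (\<tau> - z)) + 2 * pi * Im \<tau> * bernoulli_poly 2 (Im z / Im \<tau>)"

lemma bernoulli_poly_2_minus: "bernoulli_poly 2 (- t) = bernoulli_poly 2 t + 2 * t"
proof -
  have B: "bernoulli_poly 2 x = t2 * 2 + x * (2 * t1) + x\<^sup>2" if "t2 = fps_nth bern_base 2" "t1 = fps_nth bern_base 1" for x t1 t2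
    by (simp add: bernoulli_poly_sum numeral_2_eq_2 bern_base_0 that)
  have "bernoulli_poly 2 1 = bernoulli_poly 2 0"
    using bernoulli_poly_1_minus_0[of 2] by simp
  then have "fps_nth bern_base 1 = - 1 / 2" by (simp add: B[OF refl refl])
  then show ?thesis by (simp add: B[OF refl refl])
qed

lemma Ecal_hat_2_eq_aux:
  assumes v: "Im \<tau> > 0" and z: "0 \<le> Im z" "Im z < Im \<tau>" "z \<notin> \<int>"
  shows "Ecal_hat 2 z \<tau> = of_real (kronecker_log \<tau> z - 2 * ln (norm (1 - ee z)))"
proof -
  have e: "norm (ee z) \<le> 1" "ee z \<noteq> 1" using z by (auto simp: norm_ee ee_eq_1_iff)
  have "(\<lambda>i. ee (of_nat (Suc i) * z) / of_nat (Suc i)) sums - Ln (1 - ee z)"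
    using log_series_boundary[OF e] unfolding ee_power .
  from Ecal_hat_2_explicit[OF v z(1,2) this] show ?thesis
    using e by (simp add: kronecker_log_def ring_distribs)
qed

text \<open>The definition switches branch at Im z = 0, yet one formula is needed on a full
  neighbourhood of the real axis. Below it, evenness is used: B_2 and log|1 - e(z)| both produce 4
  pi Im z under z going to -z, and these cancel.\<close>

lemma Ecal_hat_2_eq:
  assumes v: "Im \<tau> > 0" and z: "\<bar>Im z\<bar> < Im \<tau>" "z \<notin> \<int>"
  shows "Ecal_hat 2 z \<tau> = of_real (kronecker_log \<tau> z - 2 * ln (norm (1 - ee z)))"
proof (cases "Im z \<ge> 0")
  case True
  then show ?thesis using Ecal_hat_2_eq_aux[OF v True] z by simp
next
  case False
  have nint: "Im z / Im \<tau> \<notin> \<int>"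
  proof
    assume "Im z / Im \<tau> \<in> \<int>"
    then obtain k :: int where k: "Im z / Im \<tau> = of_int k" by (elim Ints_cases)
    have "-1 < Im z / Im \<tau>" "Im z / Im \<tau> < 0" using False z v by (auto simp: field_simps)
    then have "of_int (- 1) < (of_int k :: real)" "of_int k < (of_int 0 :: real)" unfolding k by simp_all
    then show False unfolding of_int_less_iff by linarith
  qed
  have "Ecal_hat 2 z \<tau> = of_real (kronecker_log \<tau> (- z) - 2 * ln (norm (1 - ee (- z))))"
    using Ecal_hat_2_minus[OF v nint] Ecal_hat_2_eq_aux[OF v, of "- z"] False z by simp
  also have "ln (norm (1 - ee (- z))) = ln (norm (1 - ee z)) + 2 * pi * Im z"
  proof -
    have "ee z \<noteq> 1" using z by (simp add: ee_eq_1_iff)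
    have "1 - ee (- z) = - (1 - ee z) * ee (- z)"
      by (simp add: ee_minus algebra_simps)
    then have "norm (1 - ee (- z)) = norm (1 - ee z) * exp (2 * pi * Im z)"
      by (simp only: norm_mult norm_minus_cancel norm_ee) simp
    then show ?thesis using \<open>ee z \<noteq> 1\<close> by (simp add: ln_mult)
  qed
  also have "kronecker_log \<tau> (- z) = kronecker_log \<tau> z + 4 * pi * Im z"
    using bernoulli_poly_2_minus[of "Im z / Im \<tau>"] v
    by (simp add: kronecker_log_def ring_distribs)
  finally show ?thesis by simp
qed

lemma isCont_exp_series:
  assumes "exp_summable I c \<kappa>" "isCont f z" "Im (f z) > 0"
  shows "isCont (\<lambda>z. exp_series I c \<kappa> (f z)) z"
  using isCont_o2[OF assms(2) DERIV_isCont[OF exp_series_has_field_derivative[OF assms(1,3)]]] .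

lemma isCont_bernoulli_poly: "isCont f z \<Longrightarrow> isCont (\<lambda>z. bernoulli_poly n (f z)) z"
  using isCont_o2[of z f "bernoulli_poly n"] continuous_on_bernoulli_poly[of UNIV n]
  by (auto simp: continuous_on_eq_continuous_at)

lemma isCont_kronecker_log:
  assumes v: "Im \<tau> > 0" and z: "\<bar>Im z\<bar> < Im \<tau>"
  shows "isCont (kronecker_log \<tau>) z"
proof -
  have "isCont (\<lambda>z. User 0 1 \<tau> (\<tau> + z)) z" "isCont (\<lambda>z. User 0 1 \<tau> (\<tau> - z)) z"
    using v z by (auto intro!: isCont_exp_series exp_summable_ucoef continuous_intros)
  moreover have "isCont (\<lambda>z. bernoulli_poly 2 (Im z / Im \<tau>)) z"
    using v by (intro isCont_bernoulli_poly continuous_intros) auto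
  ultimately show ?thesis
    unfolding kronecker_log_def by (intro continuous_intros isCont_Re)
qed

text \<open>Translation by a multiple of \<tau> moves z into the region of the logarithmic formula,
  whose only singularities are the integers.\<close>

lemma isCont_Ecal_hat_2:
  assumes v: "Im \<tau> > 0" and z: "\<And>k l :: int. z \<noteq> of_int k * \<tau> + of_int l"
  shows "isCont (\<lambda>w. Ecal_hat 2 w \<tau>) z"
proof -
  define k where "k = \<lfloor>Im z / Im \<tau>\<rfloor>"
  have k: "of_int k \<le> Im z / Im \<tau>" "Im z / Im \<tau> < of_int k + 1"
    unfolding k_def by linarith+
  define c where "c = of_int (- k) * \<tau>"
  have z': "\<bar>Im (z + c)\<bar> < Im \<tau>" using k v by (auto simp: c_def field_simps)
  have zn: "z + c \<notin> \<int>"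
  proof
    assume "z + c \<in> \<int>"
    then obtain l :: int where "z + c = of_int l" by (elim Ints_cases)
    then show False using z[of k l] by (simp add: c_def algebra_simps)
  qed
  have op: "open {w. \<bar>Im (w + c)\<bar> < Im \<tau> \<and> ee (w + c) \<noteq> 1}"
    unfolding ee_def by (intro open_Collect_conj open_Collect_less open_Collect_neq continuous_intros)
  have "isCont (\<lambda>w. complex_of_real (kronecker_log \<tau> (w + c) - 2 * ln (norm (1 - ee (w + c))))) z"
  proof -
    have "isCont (\<lambda>w. kronecker_log \<tau> (w + c)) z"
      using isCont_o2[of z "\<lambda>w. w + c" "kronecker_log \<tau>"] isCont_kronecker_log[OF v z']
      by (simp add: continuous_intros)
    moreover have "norm (1 - ee (z + c)) \<noteq> 0" using zn by (simp add: ee_eq_1_iff)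
    then have "isCont (\<lambda>w. ln (norm (1 - ee (w + c)))) z"
      unfolding ee_def by (intro continuous_intros) auto
    ultimately show ?thesis by (intro continuous_of_real continuous_diff continuous_mult continuous_const)
  qed
  moreover have "eventually (\<lambda>w. Ecal_hat 2 w \<tau> = complex_of_real (kronecker_log \<tau> (w + c) - 2 * ln (norm (1 - ee (w + c))))) (nhds z)"
    unfolding eventually_nhds
  proof (intro exI conjI ballI)
    show "z \<in> {w. \<bar>Im (w + c)\<bar> < Im \<tau> \<and> ee (w + c) \<noteq> 1}" using z' zn by (simp add: ee_eq_1_iff)
    fix w assume "w \<in> {w. \<bar>Im (w + c)\<bar> < Im \<tau> \<and> ee (w + c) \<noteq> 1}"
    then have "Ecal_hat 2 (w + c) \<tau> = complex_of_real (kronecker_log \<tau> (w + c) - 2 * ln (norm (1 - ee (w + c))))"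
      by (intro Ecal_hat_2_eq v) (auto simp: ee_eq_1_iff)
    then show "Ecal_hat 2 w \<tau> = complex_of_real (kronecker_log \<tau> (w + c) - 2 * ln (norm (1 - ee (w + c))))"
      unfolding c_def Ecal_hat_translate_tau[OF v] .
  qed (rule op)
  ultimately show ?thesis using isCont_cong by fast
qed

section \<open>The transformation law for a = 2 off the lattice\<close>

lemma eventually_affine_not_int:
  fixes \<alpha> \<beta> :: real
  assumes "\<beta> \<noteq> 0"
  shows "eventually (\<lambda>e. \<alpha> + \<beta> * e \<notin> \<int>) (at_right 0)"
proof -
  \<comment> \<open>The distance from \<alpha> to the integers different from \<alpha>.\<close>
  define r where "r = (if \<alpha> \<in> \<int> then 1 else min (frac \<alpha>) (1 - frac \<alpha>))"
  have r: "r > 0" "r \<le> 1" by (auto simp: r_def frac_lt_1 frac_gt_0_iff)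
  have "eventually (\<lambda>e. e \<in> {0<..<r / \<bar>\<beta>\<bar>}) (at_right 0)"
    using r assms by (intro eventually_at_right_real) auto
  then show ?thesis
  proof eventually_elim
    case (elim e)
    have b: "0 < \<bar>\<beta> * e\<bar>" "\<bar>\<beta> * e\<bar> < r" using elim assms by (auto simp: abs_mult field_simps)
    show ?case
    proof
      assume "\<alpha> + \<beta> * e \<in> \<int>"
      then obtain k :: int where k: "\<alpha> + \<beta> * e = of_int k" by (elim Ints_cases)
      show False
      proof (cases "\<alpha> \<in> \<int>")
        case True
        then obtain l :: int where "\<alpha> = of_int l" by (elim Ints_cases)
        then have "\<bar>of_int (k - l) :: real\<bar> = \<bar>\<beta> * e\<bar>" using k by simp
        then have "0 < \<bar>of_int (k - l) :: real\<bar>" "\<bar>of_int (k - l) :: real\<bar> < 1" using b r by linarith+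
        then have "\<bar>k - l\<bar> < 1" "k - l \<noteq> 0" by (simp_all flip: of_int_abs)
        then show False by linarith
      next
        case False
        then have "\<bar>\<beta> * e\<bar> < frac \<alpha>" "\<bar>\<beta> * e\<bar> < 1 - frac \<alpha>" using b by (auto simp: r_def)
        then have "of_int \<lfloor>\<alpha>\<rfloor> < \<alpha> + \<beta> * e" "\<alpha> + \<beta> * e < of_int (\<lfloor>\<alpha>\<rfloor> + 1)"
          unfolding frac_def of_int_add of_int_1 by linarith+
        then show False unfolding k of_int_less_iff by linarith
      qed
    qed
  qed
qed

text \<open>Both sides are continuous off the lattice, and the excluded lines of
  \<open>Ecal_hat_2_moebius_generic\<close> are avoided along a generic ray towards \<open>z\<close>.\<close>

theorem Ecal_hat_2_moebius:
  assumes A: "A \<in> SL2Z" and v: "Im \<tau> > 0" and z: "\<And>k l :: int. z \<noteq> of_int k * \<tau> + of_int l"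
  shows "Ecal_hat 2 (z / automorphy A \<tau>) (moebius A \<tau>) = Ecal_hat 2 z \<tau>"
proof -
  define j where "j = automorphy A \<tau>"
  have j: "j \<noteq> 0" unfolding j_def by (rule automorphy_nonzero[OF A v])
  define \<tau>' where "\<tau>' = moebius A \<tau>"
  have v': "Im \<tau>' > 0" unfolding \<tau>'_def by (rule Im_moebius_pos[OF A v])
  have z': "z / j \<noteq> of_int k * \<tau>' + of_int l" for k l :: int
  proof
    assume "z / j = of_int k * \<tau>' + of_int l"
    then have "z = (of_int k * \<tau>' + of_int l) * j" using j by (simp add: field_simps)
    also have "\<dots> = of_int k * (\<tau>' * j) + of_int l * j" by (simp add: algebra_simps)
    also have "\<tau>' * j = of_int (A $ 1 $ 1) * \<tau> + of_int (A $ 1 $ 2)"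
      using j by (simp add: \<tau>'_def j_def moebius_def automorphy_def)
    also have "of_int k * (of_int (A $ 1 $ 1) * \<tau> + of_int (A $ 1 $ 2)) + of_int l * j =
        of_int (k * A $ 1 $ 1 + l * A $ 2 $ 1) * \<tau> + of_int (k * A $ 1 $ 2 + l * A $ 2 $ 2)"
      by (simp add: j_def automorphy_def algebra_simps)
    finally show False using z by blast
  qed
  \<comment> \<open>The ray must leave both families of lines. If j is real, the direction i works;
    otherwise 1 + j does, since Im(1 + j) = Im j and Im((1 + j) / j) = Im(1 / j).\<close>
  obtain \<delta> where \<delta>: "Im \<delta> \<noteq> 0" "Im (\<delta> / j) \<noteq> 0"
  proof (cases "Im j = 0")
    case True
    then have jr: "j = of_real (Re j)" by (simp add: complex_eq_iff)
    have "Im (\<i> / j) = 1 / Re j" by (subst jr) simp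
    moreover have "Re j \<noteq> 0" using j True by (auto simp: complex_eq_iff)
    ultimately show ?thesis by (intro that[of \<i>]) simp_all
  next
    case False
    have "(1 + j) / j = inverse j + 1" using j by (simp add: field_simps)
    then show ?thesis using False j by (intro that[of "1 + j"]) (auto simp: add_nonneg_eq_0_iff complex_eq_iff)
  qed
  define D where "D = (\<lambda>w. Ecal_hat 2 (w / j) \<tau>' - Ecal_hat 2 w \<tau>)"
  have "isCont D z"
    unfolding D_def
  proof (rule continuous_diff[OF _ isCont_Ecal_hat_2[OF v z]])
    have "isCont (\<lambda>w. w / j) z" using j by (intro continuous_intros)
    from isCont_o2[of z "\<lambda>w. w / j" "\<lambda>w. Ecal_hat 2 w \<tau>'", OF this isCont_Ecal_hat_2[OF v' z']]
    show "isCont (\<lambda>w. Ecal_hat 2 (w / j) \<tau>') z" .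
  qed
  moreover have "((\<lambda>e::real. z + of_real e * \<delta>) \<longlongrightarrow> z + of_real 0 * \<delta>) (at_right 0)"
    by (intro tendsto_intros)
  ultimately have lim: "((\<lambda>e::real. D (z + of_real e * \<delta>)) \<longlongrightarrow> D z) (at_right 0)"
    using isCont_tendsto_compose[of z D] by simp
  have nz: "Im \<delta> / Im \<tau> \<noteq> 0" "Im (\<delta> / j) / Im \<tau>' \<noteq> 0" using \<delta> v v' by auto
  have "eventually (\<lambda>e::real. D (z + of_real e * \<delta>) = 0) (at_right 0)"
    using eventually_affine_not_int[OF nz(1), of "Im z / Im \<tau>"] eventually_affine_not_int[OF nz(2), of "Im (z / j) / Im \<tau>'"]
  proof eventually_elim
    fix e :: real
    assume 1: "Im z / Im \<tau> + Im \<delta> / Im \<tau> * e \<notin> \<int>" "Im (z / j) / Im \<tau>' + Im (\<delta> / j) / Im \<tau>' * e \<notin> \<int>"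
    have "(z + of_real e * \<delta>) / j = z / j + of_real e * (\<delta> / j)" by (simp add: add_divide_distrib)
    then have "Im ((z + of_real e * \<delta>) / j) = Im (z / j) + e * Im (\<delta> / j)"
      by (simp only: plus_complex.sel times_complex.sel Re_complex_of_real Im_complex_of_real mult_zero_left add_0_right)
    then have "Im ((z + of_real e * \<delta>) / j) / Im \<tau>' \<notin> \<int>" "Im (z + of_real e * \<delta>) / Im \<tau> \<notin> \<int>"
      using 1 by (simp_all add: add_divide_distrib mult.commute)
    then show "D (z + of_real e * \<delta>) = 0"
      using Ecal_hat_2_moebius_generic[OF A v] unfolding D_def j_def \<tau>'_def by simp
  qed
  then have "((\<lambda>e::real. D (z + of_real e * \<delta>)) \<longlongrightarrow> 0) (at_right 0)"
    by (rule tendsto_eventually)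
  then have "D z = 0" using lim tendsto_unique trivial_limit_at_right_real by blast
  then show ?thesis by (simp add: D_def j_def \<tau>'_def)
qed

section \<open>The regularized limit at z = 0\<close>

lemma not_int_near_0:
  assumes v: "Im \<tau> > 0"
  shows "eventually (\<lambda>w. w \<noteq> 0 \<and> \<bar>Im w\<bar> < Im \<tau> \<and> w \<notin> \<int> \<and> (\<forall>k l :: int. w \<noteq> of_int k * \<tau> + of_int l)) (at 0)"
proof -
  have "eventually (\<lambda>w::complex. w \<in> ball 0 (min 1 (Im \<tau>)) - {0}) (at 0)"
    using eventually_at_in_open[of "ball 0 (min 1 (Im \<tau>))" "0::complex"] v by simp
  then show ?thesis
  proof eventually_elim
    case (elim w)
    then have w: "w \<noteq> 0" "norm w < 1" "norm w < Im \<tau>" by auto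
    have "\<bar>Im w\<bar> < Im \<tau>" using abs_Im_le_cmod[of w] w by linarith
    moreover have int: "w \<noteq> of_int l" for l :: int
    proof
      assume l: "w = of_int l"
      then have "\<bar>of_int l :: real\<bar> < 1" "l \<noteq> 0" using w by auto
      then show False by linarith
    qed
    moreover have "w \<noteq> of_int k * \<tau> + of_int l" for k l :: int
    proof
      assume eq: "w = of_int k * \<tau> + of_int l"
      then have "\<bar>of_int k\<bar> * Im \<tau> < 1 * Im \<tau>" using \<open>\<bar>Im w\<bar> < Im \<tau>\<close> v by (simp add: abs_mult)
      then have "\<bar>of_int k :: real\<bar> < 1" using v by (simp only: mult_less_cancel_right_pos)
      then have "k = 0" by linarith
      then show False using eq int by simp
    qed
    ultimately show ?case using w by (auto elim!: Ints_cases)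
  qed
qed

text \<open>The term -2 log(2 pi) comes from |1 - e(z)| being asymptotic to 2 pi |z|. After
  subtraction of log v this is the function of Kronecker's first limit formula, - log(v
  |\<eta>(\<tau>)|^4) up to an additive constant.\<close>

definition kronecker_const :: "complex \<Rightarrow> real" where
  "kronecker_const \<tau> = kronecker_log \<tau> 0 - 2 * ln (2 * pi)"

text \<open>The limit is taken over complex w, not just along the positive reals, so that w may be
  replaced by w / j in the transformation law.\<close>

lemma Ecal_hat_2_limit_0:
  assumes v: "Im \<tau> > 0"
  shows "((\<lambda>w. Ecal_hat 2 w \<tau> + of_real (2 * ln (norm w))) \<longlongrightarrow> of_real (kronecker_const \<tau>)) (at 0)"
proof -
  have "(ee has_field_derivative 2 * of_real pi * \<i>) (at 0)"
    using has_field_derivative_ee[OF DERIV_ident, of 0 UNIV] by simp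
  then have "((\<lambda>h. (ee (0 + h) - ee 0) / h) \<longlongrightarrow> 2 * of_real pi * \<i>) (at 0)"
    by (simp add: DERIV_def)
  from tendsto_norm[OF this] have n: "((\<lambda>h. norm (1 - ee h) / norm h) \<longlongrightarrow> 2 * pi) (at 0)"
    by (simp add: norm_divide norm_mult norm_minus_commute)
  have "((\<lambda>w. complex_of_real (kronecker_log \<tau> w - 2 * ln (norm (1 - ee w) / norm w))) \<longlongrightarrow>
      of_real (kronecker_log \<tau> 0 - 2 * ln (2 * pi))) (at 0)"
    using isCont_kronecker_log[OF v, of 0] v n by (intro tendsto_intros) (auto simp: isCont_def)
  then show ?thesis
    unfolding kronecker_const_def
  proof (rule Lim_transform_eventually)
    show "eventually (\<lambda>w. complex_of_real (kronecker_log \<tau> w - 2 * ln (norm (1 - ee w) / norm w)) =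
        Ecal_hat 2 w \<tau> + of_real (2 * ln (norm w))) (at 0)"
      using not_int_near_0[OF v]
    proof eventually_elim
      case (elim w)
      then have "norm (1 - ee w) > 0" "norm w > 0" by (auto simp: ee_eq_1_iff)
      then show ?case using Ecal_hat_2_eq[OF v, of w] elim by (simp add: ln_div ring_distribs)
    qed
  qed
qed

text \<open>Passing to the limit in the law for a = 2 costs 2 log|j| from the regularizing term,
  which is exactly the change of log Im.\<close>

lemma kronecker_const_moebius:
  assumes A: "A \<in> SL2Z" and v: "Im \<tau> > 0"
  shows "kronecker_const (moebius A \<tau>) - ln (Im (moebius A \<tau>)) = kronecker_const \<tau> - ln (Im \<tau>)"
proof -
  define j where "j = automorphy A \<tau>"
  have j: "j \<noteq> 0" unfolding j_def by (rule automorphy_nonzero[OF A v])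
  have "filterlim (\<lambda>w. w / j) (at 0) (at 0)"
    unfolding filterlim_at using j
    by (auto intro!: tendsto_eq_intros eventually_at_filter[THEN iffD2])
  from filterlim_compose[OF Ecal_hat_2_limit_0[OF Im_moebius_pos[OF A v]] this]
  have l1: "((\<lambda>w. Ecal_hat 2 (w / j) (moebius A \<tau>) + of_real (2 * ln (norm (w / j)))) \<longlongrightarrow> of_real (kronecker_const (moebius A \<tau>))) (at 0)" .
  have "((\<lambda>w. Ecal_hat 2 w \<tau> + of_real (2 * ln (norm w)) - of_real (2 * ln (norm j))) \<longlongrightarrow> of_real (kronecker_const \<tau>) - of_real (2 * ln (norm j))) (at 0)"
    by (intro tendsto_diff tendsto_const Ecal_hat_2_limit_0[OF v])
  then have "((\<lambda>w. Ecal_hat 2 (w / j) (moebius A \<tau>) + of_real (2 * ln (norm (w / j)))) \<longlongrightarrow> of_real (kronecker_const \<tau>) - of_real (2 * ln (norm j))) (at 0)"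
  proof (rule Lim_transform_eventually)
    show "eventually (\<lambda>w. Ecal_hat 2 w \<tau> + of_real (2 * ln (norm w)) - of_real (2 * ln (norm j)) =
        Ecal_hat 2 (w / j) (moebius A \<tau>) + of_real (2 * ln (norm (w / j)))) (at 0)"
      using not_int_near_0[OF v]
    proof eventually_elim
      case (elim w)
      then have "Ecal_hat 2 (w / j) (moebius A \<tau>) = Ecal_hat 2 w \<tau>"
        unfolding j_def by (intro Ecal_hat_2_moebius[OF A v]) auto
      moreover have "ln (norm (w / j)) = ln (norm w) - ln (norm j)"
        using elim j by (simp add: norm_divide ln_div)
      ultimately show ?case by (simp add: ring_distribs)
    qed
  qed
  with l1 have "complex_of_real (kronecker_const (moebius A \<tau>)) = of_real (kronecker_const \<tau>) - of_real (2 * ln (norm j))"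
    by (rule tendsto_unique[rotated]) simp
  then have "kronecker_const (moebius A \<tau>) = kronecker_const \<tau> - 2 * ln (norm j)"
    unfolding of_real_diff[symmetric] of_real_eq_iff .
  moreover have "ln (Im (moebius A \<tau>)) = ln (Im \<tau>) - 2 * ln (norm j)"
    unfolding Im_moebius[OF A v] j_def[symmetric] using j v by (simp add: ln_div ln_realpow)
  ultimately show ?thesis by simp
qed

text \<open>At z = 0 the rows above and below the axis give the same series, hence twice one block
  with n = 1. The row through z was absorbed into the logarithm and leaves only a constant.\<close>

lemma preharmonic_kronecker_const: "preharmonic 1 (\<lambda>\<tau>. of_real (kronecker_const \<tau>))"
proof -
  define B where "B = (\<lambda>\<tau>. - of_real (2 * ln (2 * pi)) + 2 * block 1 1 UNIV (cplus 1 0) (kplus 0) \<tau> + of_real (2 * pi * bernoulli_poly 2 0) * of_real (Im \<tau> ^ 1))"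
  have "preharmonic 1 B"
    unfolding B_def by (intro preharmonic_add preharmonic_cmult preharmonic_const preharmonic_block preharmonic_Im_power exp_summable_kplus) auto
  then show ?thesis
  proof (rule preharmonic_cong)
    fix \<tau> :: complex assume v: "Im \<tau> > 0"
    have U: "exp_series UNIV (cplus 1 0) (kplus 0) \<tau> = User 0 1 \<tau> \<tau>"
      using exp_series_cplus_eq_User'(1)[OF _ v, of 0 0 0 1] by simp
    have b: "block 1 1 UNIV (cplus 1 0) (kplus 0) \<tau> = of_real (2 * Re (User 0 1 \<tau> \<tau>))"
      unfolding complex_add_cnj[symmetric] U[symmetric]
      using block_1[of 1 UNIV "cplus 1 0" "kplus 0" \<tau>] by simp
    show "B \<tau> = of_real (kronecker_const \<tau>)"
      unfolding B_def b kronecker_const_def kronecker_log_def by simp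
  qed
qed

text \<open>The logarithm is the only obstruction to harmonicity: \<xi> in weight 0 sends -log v to
  1/v, \<xi> in weight 2 sends 1/v to the constant 1, and one further \<xi> kills it.\<close>

lemma sesquiharmonic_of_preharmonic:
  assumes P: "preharmonic 1 P" and \<tau>: "\<tau> \<in> upper_half_plane"
  shows "xi_op 0 (Delta_op 0 (\<lambda>\<tau>. P \<tau> - of_real (ln (Im \<tau>)))) \<tau> = 0"
proof -
  obtain h where h: "h holomorphic_on upper_half_plane" "\<And>\<tau>. \<tau> \<in> upper_half_plane \<Longrightarrow> has_wbar P (cnj (h \<tau>)) \<tau>"
    using P unfolding preharmonic_def by auto
  have pos: "Im w > 0" if "w \<in> upper_half_plane" for w using that by (simp add: upper_half_plane_def)
  have 1: "xi_op 0 (\<lambda>\<tau>. P \<tau> - of_real (ln (Im \<tau>))) w = - 2 * \<i> * h w + of_real (inverse (Im w))" if "w \<in> upper_half_plane" for w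
  proof -
    have "has_wbar (\<lambda>\<tau>. complex_of_real (ln (Im \<tau>))) (\<i> / 2 * of_real (inverse (Im w))) w"
      using pos[OF that] DERIV_ln[of "Im w"] by (intro has_wbar_real)
    from has_wbar_diff[OF h(2)[OF that] this] show ?thesis
      by (simp add: xi_op_eq algebra_simps)
  qed
  have 2: "Delta_op 0 (\<lambda>\<tau>. P \<tau> - of_real (ln (Im \<tau>))) w = - 1" if w: "w \<in> upper_half_plane" for w
  proof -
    have "((\<lambda>w. - 2 * \<i> * h w) has_field_derivative deriv (\<lambda>w. - 2 * \<i> * h w) w) (at w)"
      by (rule holomorphic_derivI[OF _ open_upper_half_plane w]) (intro holomorphic_intros h)
    moreover have "has_wbar (\<lambda>\<tau>. complex_of_real (inverse (Im \<tau>))) (\<i> / 2 * of_real (- (inverse (Im w) ^ Suc (Suc 0)))) w"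
      using pos[OF w] DERIV_inverse[of "Im w" UNIV] by (intro has_wbar_real) auto
    ultimately have "has_wbar (\<lambda>w. - 2 * \<i> * h w + of_real (inverse (Im w))) (0 + \<i> / 2 * of_real (- (inverse (Im w) ^ Suc (Suc 0)))) w"
      by (intro has_wbar_add has_wbar_holomorphic)
    then have "xi_op 2 (\<lambda>w. - 2 * \<i> * h w + of_real (inverse (Im w))) w = 1"
      using pos[OF w] by (simp add: xi_op_eq power2_eq_square field_simps)
    then show ?thesis
      unfolding Delta_op_def by (simp add: xi_op_cong[OF open_upper_half_plane w 1])
  qed
  show ?thesis
    by (rule xi_op_holomorphic[OF open_upper_half_plane \<tau> 2]) auto
qed

section \<open>Assembling the conditions for Maass forms\<close>

lemma linear_exponential_growthI:
  assumes "\<And>A. A \<in> SL2Z \<Longrightarrow> \<exists>g. g \<in> O[filtercomap Im at_top](\<lambda>\<tau>. of_real (exp (1 * Im \<tau>))) \<and>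
      (\<forall>\<tau>. Im \<tau> > 0 \<longrightarrow> f (moebius A \<tau>) = automorphy A \<tau> powi k * g \<tau>)"
  shows "linear_exponential_growth k f"
  unfolding linear_exponential_growth_def
proof (intro ballI exI conjI)
  fix A :: "int ^ 2 ^ 2" assume A: "A \<in> SL2Z"
  then obtain g where g: "g \<in> O[filtercomap Im at_top](\<lambda>\<tau>. of_real (exp (1 * Im \<tau>)))"
    "\<And>\<tau>. Im \<tau> > 0 \<Longrightarrow> f (moebius A \<tau>) = automorphy A \<tau> powi k * g \<tau>"
    using assms by blast
  have "eventually (\<lambda>\<tau>. Im \<tau> > 0) (filtercomap Im at_top)"
    using eventually_gt_at_top[of "0::real"] by (rule eventually_filtercomapI)
  then have "eventually (\<lambda>\<tau>. automorphy A \<tau> powi (- k) * f (moebius A \<tau>) = g \<tau>) (filtercomap Im at_top)"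
  proof eventually_elim
    case (elim \<tau>)
    then show ?case using automorphy_nonzero[OF A elim]
      by (simp add: g(2) power_int_minus field_simps)
  qed
  from landau_o.big.in_cong[OF this] g(1)
  show "(\<lambda>\<tau>. automorphy A \<tau> powi (- k) * f (moebius A \<tau>)) \<in> O[filtercomap Im at_top](\<lambda>\<tau>. of_real (exp (1 * Im \<tau>)))"
    by simp
qed simp

lemma not_lattice_iff:
  assumes v: "Im \<tau> > 0"
  shows "(\<exists>k l :: int. of_real x * \<tau> + of_real y = of_int k * \<tau> + of_int l) \<longleftrightarrow> x \<in> \<int> \<and> y \<in> \<int>"
proof
  assume "\<exists>k l :: int. of_real x * \<tau> + of_real y = of_int k * \<tau> + of_int l"
  then obtain k l :: int where e: "of_real x * \<tau> + of_real y = of_int k * \<tau> + of_int l" by blast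
  then have "x * Im \<tau> = of_int k * Im \<tau>" by (auto dest: arg_cong[of _ _ Im])
  then have x: "x = of_int k" using v by simp
  then have "y = of_int l" using e by (auto dest: arg_cong[of _ _ Re])
  then show "x \<in> \<int> \<and> y \<in> \<int>" using x by simp
next
  assume "x \<in> \<int> \<and> y \<in> \<int>"
  then obtain k l :: int where "x = of_int k" "y = of_int l" by (auto elim!: Ints_cases)
  then show "\<exists>k l :: int. of_real x * \<tau> + of_real y = of_int k * \<tau> + of_int l" by force
qed

text \<open>The inverse matrix is integral as well, so integrality of the transformed pair would
  give back that of the original one. This keeps every cusp of the a = 2 case away from lattice
  points.\<close>

lemma not_Ints_moebius:
  fixes lam mu :: real and A :: "int ^ 2 ^ 2"
  assumes A: "A \<in> SL2Z" and n: "\<not> (lam \<in> \<int> \<and> mu \<in> \<int>)"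
  shows "\<not> (of_int (A $ 1 $ 1) * lam + of_int (A $ 2 $ 1) * mu \<in> \<int> \<and> of_int (A $ 1 $ 2) * lam + of_int (A $ 2 $ 2) * mu \<in> \<int>)"
proof
  define a b c d where "a = real_of_int (A $ 1 $ 1)" "b = real_of_int (A $ 1 $ 2)" "c = real_of_int (A $ 2 $ 1)" "d = real_of_int (A $ 2 $ 2)"
  have I: "a \<in> \<int>" "b \<in> \<int>" "c \<in> \<int>" "d \<in> \<int>" by (auto simp: a_b_c_d_def)
  have det: "a * d - b * c = 1"
    using SL2Z_det[OF A] unfolding a_b_c_d_def of_int_mult[symmetric] of_int_diff[symmetric] by simp
  assume "of_int (A $ 1 $ 1) * lam + of_int (A $ 2 $ 1) * mu \<in> \<int> \<and> of_int (A $ 1 $ 2) * lam + of_int (A $ 2 $ 2) * mu \<in> \<int>"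
  then have "d * (a * lam + c * mu) - c * (b * lam + d * mu) \<in> \<int>" "a * (b * lam + d * mu) - b * (a * lam + c * mu) \<in> \<int>"
    using I unfolding a_b_c_d_def [symmetric] by auto
  moreover have "d * (a * lam + c * mu) - c * (b * lam + d * mu) = (a * d - b * c) * lam" "a * (b * lam + d * mu) - b * (a * lam + c * mu) = (a * d - b * c) * mu"
    by (simp_all add: algebra_simps)
  ultimately show False using n unfolding det by simp
qed

lemma Ecal_hat_moebius:
  fixes A :: "int ^ 2 ^ 2"
  assumes A: "A \<in> SL2Z" and v: "Im \<tau> > 0" and n: "n \<ge> 1" and reg: "n \<ge> 2 \<or> \<not> (lam \<in> \<int> \<and> mu \<in> \<int>)"
  shows "Ecal_hat (Suc n) (of_real lam * moebius A \<tau> + of_real mu) (moebius A \<tau>) = automorphy A \<tau> powi (1 - int n) *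
     Ecal_hat (Suc n) (of_real (of_int (A $ 1 $ 1) * lam + of_int (A $ 2 $ 1) * mu) * \<tau> + of_real (of_int (A $ 1 $ 2) * lam + of_int (A $ 2 $ 2) * mu)) \<tau>"
proof (cases "n \<ge> 2")
  case True
  then show ?thesis using Ecal_hat_moebius_ge3[OF A v] by blast
next
  case False
  then have n1: "n = 1" using n by simp
  define x where "x = of_int (A $ 1 $ 1) * lam + of_int (A $ 2 $ 1) * mu"
  define y where "y = of_int (A $ 1 $ 2) * lam + of_int (A $ 2 $ 2) * mu"
  have j: "automorphy A \<tau> \<noteq> 0" by (rule automorphy_nonzero[OF A v])
  have "(of_real x * \<tau> + of_real y) / automorphy A \<tau> = of_real lam * moebius A \<tau> + of_real mu"
    using j by (simp add: x_def y_def moebius_def automorphy_def field_simps)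
  moreover have "\<not> (x \<in> \<int> \<and> y \<in> \<int>)"
    unfolding x_def y_def by (rule not_Ints_moebius[OF A]) (use reg False in auto)
  then have "of_real x * \<tau> + of_real y \<noteq> of_int k * \<tau> + of_int l" for k l :: int
    using not_lattice_iff[OF v] by blast
  ultimately have "Ecal_hat 2 (of_real lam * moebius A \<tau> + of_real mu) (moebius A \<tau>) = Ecal_hat 2 (of_real x * \<tau> + of_real y) \<tau>"
    using Ecal_hat_2_moebius[OF A v, of "of_real x * \<tau> + of_real y"] by simp
  then show ?thesis by (simp add: n1 x_def y_def numeral_2_eq_2)
qed

lemma preharmonic_Ecal_hat_torsion:
  assumes n: "n \<ge> 1" and reg: "n \<ge> 2 \<or> \<not> (lam \<in> \<int> \<and> mu \<in> \<int>)"
  shows "preharmonic n (\<lambda>\<tau>. Ecal_hat (Suc n) (of_real lam * \<tau> + of_real mu) \<tau>)"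
proof -
  have "preharmonic n (\<lambda>\<tau>. Ecal_hat (Suc n) (of_real (frac lam) * \<tau> + of_real mu) \<tau>)"
  proof (rule preharmonic_Ecal_hat[OF _ _ n])
    assume "frac lam = 0"
    then have lam: "lam \<in> \<int>" by (simp add: frac_eq_0_iff)
    show "summable (czero n mu)"
    proof (cases "n \<ge> 2")
      case True
      then show ?thesis using summable_czero[of n "\<lambda>_. 1" 1 mu] by simp
    next
      \<comment> \<open>For n = 1 the row through z is the logarithmic series on the unit circle at
        e(mu), which converges because mu is not an integer.\<close>
      case False
      then have "n = 1" "mu \<notin> \<int>" using n reg lam by auto
      moreover have "norm (ee (of_real mu)) \<le> 1" by (simp add: norm_ee)
      moreover have "ee (of_real mu) \<noteq> 1" unfolding ee_eq_1_iff using \<open>mu \<notin> \<int>\<close>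
        by (metis Ints_cases Ints_of_int of_real_eq_iff of_real_of_int_eq)
      ultimately show ?thesis
        using sums_summable[OF log_series_boundary[of "ee (of_real mu)"]] unfolding ee_power
        by (simp add: czero_def [abs_def] del: of_nat_Suc)
    qed
  qed (auto simp: frac_lt_1)
  then show ?thesis
  proof (rule preharmonic_cong)
    fix \<tau> :: complex assume v: "Im \<tau> > 0"
    have "of_real lam * \<tau> + of_real mu = (of_real (frac lam) * \<tau> + of_real mu) + of_int \<lfloor>lam\<rfloor> * \<tau>"
      by (simp add: frac_def algebra_simps)
    then show "Ecal_hat (Suc n) (of_real (frac lam) * \<tau> + of_real mu) \<tau> = Ecal_hat (Suc n) (of_real lam * \<tau> + of_real mu) \<tau>"
      using Ecal_hat_translate_tau[OF v] by metis
  qed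
qed

text \<open>A matrix congruent to the identity mod N moves (lam, mu) by an integer vector, and
  translations of z by lattice points do not change the function.\<close>

theorem harmonic_Maass_form_Ecal_hat:
  fixes lam mu :: real
  assumes n: "n \<ge> 1" and reg: "n \<ge> 2 \<or> \<not> (lam \<in> \<int> \<and> mu \<in> \<int>)"
    and N: "real N * lam \<in> \<int>" "real N * mu \<in> \<int>"
  shows "harmonic_Maass_form (1 - int n) (Gamma_congruence N) (\<lambda>\<tau>. Ecal_hat (Suc n) (of_real lam * \<tau> + of_real mu) \<tau>)"
  unfolding harmonic_Maass_form_def
proof (intro conjI ballI)
  note P = preharmonic_Ecal_hat_torsion[OF n reg]
  show "smooth_on (\<lambda>\<tau>. Ecal_hat (Suc n) (of_real lam * \<tau> + of_real mu) \<tau>) upper_half_plane"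
    using P by (simp add: preharmonic_def)
  show "Delta_op (1 - int n) (\<lambda>\<tau>. Ecal_hat (Suc n) (of_real lam * \<tau> + of_real mu) \<tau>) \<tau> = 0" if "\<tau> \<in> upper_half_plane" for \<tau>
    by (rule preharmonic_Delta[OF P n that])
  show "linear_exponential_growth (1 - int n) (\<lambda>\<tau>. Ecal_hat (Suc n) (of_real lam * \<tau> + of_real mu) \<tau>)"
  proof (rule linear_exponential_growthI, intro exI conjI allI impI)
    fix A :: "int ^ 2 ^ 2" assume A: "A \<in> SL2Z"
    show "Ecal_hat (Suc n) (of_real lam * moebius A \<tau> + of_real mu) (moebius A \<tau>) = automorphy A \<tau> powi (1 - int n) *
     Ecal_hat (Suc n) (of_real (of_int (A $ 1 $ 1) * lam + of_int (A $ 2 $ 1) * mu) * \<tau> + of_real (of_int (A $ 1 $ 2) * lam + of_int (A $ 2 $ 2) * mu)) \<tau>"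
      if "Im \<tau> > 0" for \<tau>
      by (rule Ecal_hat_moebius[OF A that n reg])
    show "(\<lambda>\<tau>. Ecal_hat (Suc n) (of_real (of_int (A $ 1 $ 1) * lam + of_int (A $ 2 $ 1) * mu) * \<tau> + of_real (of_int (A $ 1 $ 2) * lam + of_int (A $ 2 $ 2) * mu)) \<tau>)
      \<in> O[filtercomap Im at_top](\<lambda>\<tau>. of_real (exp (1 * Im \<tau>)))"
      by (intro preharmonic_growth[where n = n] preharmonic_Ecal_hat_torsion n) (use reg not_Ints_moebius[OF A] in blast)
  qed
  show "modular_invariant (1 - int n) (Gamma_congruence N) (\<lambda>\<tau>. Ecal_hat (Suc n) (of_real lam * \<tau> + of_real mu) \<tau>)"
    unfolding modular_invariant_def
  proof (intro ballI)
    fix A \<tau> assume A: "A \<in> Gamma_congruence N" and \<tau>: "\<tau> \<in> upper_half_plane"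
    then have v: "Im \<tau> > 0" by (simp add: upper_half_plane_def)
    have A': "A \<in> SL2Z" and cong: "\<And>i j. [A $ i $ j = mat 1 $ i $ j] (mod int N)" using A by (auto simp: Gamma_congruence_def)
    have dvd: "int N dvd A $ 1 $ 1 - 1" "int N dvd A $ 2 $ 2 - 1" "int N dvd A $ 1 $ 2" "int N dvd A $ 2 $ 1"
      using cong[of 1 1] cong[of 2 2] cong[of 1 2] cong[of 2 1] by (auto simp: mat_def cong_iff_dvd_diff)
    have I: "of_int x * y \<in> \<int>" if dvd: "int N dvd x" and Ny: "real N * y \<in> \<int>" for x y
    proof -
      obtain k where "x = int N * k" using dvd by (elim dvdE)
      then have "of_int x * y = of_int k * (real N * y)" by simp
      then show ?thesis using Ny by (metis Ints_mult Ints_of_int)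
    qed
    have "of_int (A $ 1 $ 1 - 1) * lam + of_int (A $ 2 $ 1) * mu \<in> \<int>" "of_int (A $ 1 $ 2) * lam + of_int (A $ 2 $ 2 - 1) * mu \<in> \<int>"
      by (intro Ints_add I dvd N)+
    then obtain k l :: int where k: "of_int (A $ 1 $ 1 - 1) * lam + of_int (A $ 2 $ 1) * mu = of_int k"
      and l: "of_int (A $ 1 $ 2) * lam + of_int (A $ 2 $ 2 - 1) * mu = of_int l"
      by (elim Ints_cases)
    have x: "of_int (A $ 1 $ 1) * lam + of_int (A $ 2 $ 1) * mu = lam + of_int k" "of_int (A $ 1 $ 2) * lam + of_int (A $ 2 $ 2) * mu = mu + of_int l"
      using k l by (simp_all add: algebra_simps)
    have "of_real (lam + of_int k) * \<tau> + of_real (mu + of_int l) = ((of_real lam * \<tau> + of_real mu) + of_int l) + of_int k * \<tau>"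
      by (simp add: algebra_simps)
    then have "Ecal_hat (Suc n) (of_real (lam + of_int k) * \<tau> + of_real (mu + of_int l)) \<tau> = Ecal_hat (Suc n) (of_real lam * \<tau> + of_real mu) \<tau>"
      by (simp only: Ecal_hat_translate_tau[OF v] Ecal_hat_translate_1)
    then show "Ecal_hat (Suc n) (of_real lam * moebius A \<tau> + of_real mu) (moebius A \<tau>) =
      automorphy A \<tau> powi (1 - int n) * Ecal_hat (Suc n) (of_real lam * \<tau> + of_real mu) \<tau>"
      unfolding Ecal_hat_moebius[OF A' v n reg] x by simp
  qed
qed

lemma Ecal_hat_2_regularized_limit:
  assumes v: "Im \<tau> > 0"
  shows "((\<lambda>x::real. Ecal_hat 2 (of_real x) \<tau> + of_real (2 * ln \<bar>x\<bar> - ln (Im \<tau>))) \<longlongrightarrow>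
            of_real (kronecker_const \<tau>) - of_real (ln (Im \<tau>))) (at_right 0)"
proof -
  have "filterlim (\<lambda>x::real. complex_of_real x) (at 0) (at_right 0)"
    unfolding filterlim_at by (auto intro!: tendsto_eq_intros eventually_at_filter[THEN iffD2])
  from tendsto_diff[OF filterlim_compose[OF Ecal_hat_2_limit_0[OF v] this] tendsto_const[of "complex_of_real (ln (Im \<tau>))"]]
  show ?thesis by (simp add: algebra_simps)
qed

theorem sesquiharmonic_Maass_form_Ecal_hat_0:
  "sesquiharmonic_Maass_form 0 SL2Z
     (\<lambda>\<tau>. Lim (at_right 0) (\<lambda>x::real. Ecal_hat 2 (of_real x) \<tau> + of_real (2 * ln \<bar>x\<bar> - ln (Im \<tau>))))"
  (is "sesquiharmonic_Maass_form 0 SL2Z ?f")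
proof -
  define F where "F = (\<lambda>\<tau>. complex_of_real (kronecker_const \<tau>) - of_real (ln (Im \<tau>)))"
  have f: "?f \<tau> = F \<tau>" if "Im \<tau> > 0" for \<tau>
    unfolding F_def using Ecal_hat_2_regularized_limit[OF that] by (intro tendsto_Lim) auto
  have f': "F w = ?f w" if "w \<in> upper_half_plane" for w
    using that f by (simp add: upper_half_plane_def)
  note P = preharmonic_kronecker_const
  have inv: "F (moebius A \<tau>) = F \<tau>" if "A \<in> SL2Z" "Im \<tau> > 0" for A \<tau>
    using kronecker_const_moebius[OF that] unfolding F_def of_real_diff[symmetric] by simp
  have smooth: "smooth_on F upper_half_plane"
  proof -
    have "smooth_on (\<lambda>\<tau>. complex_of_real (kronecker_const \<tau>) + (-1) * of_real (ln (Im \<tau>))) upper_half_plane"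
      using P by (intro smooth_intros smooth_on_ln_Im open_upper_half_plane) (auto simp: preharmonic_def upper_half_plane_def)
    then show ?thesis by (simp add: F_def)
  qed
  \<comment> \<open>The limit function is identified with \<open>F\<close> on the upper half-plane
    only; locality of the operators carries the identity through each differentiation.\<close>
  have D: "xi_op 0 (Delta_op 0 ?f) \<tau> = 0" if \<tau>: "\<tau> \<in> upper_half_plane" for \<tau>
  proof -
    have x: "xi_op 0 ?f w = xi_op 0 F w" if "w \<in> upper_half_plane" for w
      by (rule xi_op_cong[OF open_upper_half_plane that f'[symmetric]])
    have "Delta_op 0 ?f w = Delta_op 0 F w" if "w \<in> upper_half_plane" for w
      unfolding Delta_op_def using xi_op_cong[OF open_upper_half_plane that x] by simp
    from xi_op_cong[OF open_upper_half_plane \<tau> this]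
    show ?thesis using sesquiharmonic_of_preharmonic[OF P \<tau>] by (simp add: F_def)
  qed
  have growth: "F \<in> O[filtercomap Im at_top](\<lambda>\<tau>. of_real (exp (1 * Im \<tau>)))"
  proof -
    have "eventually (\<lambda>\<tau>. Im \<tau> \<ge> 1) (filtercomap Im at_top)"
      using eventually_ge_at_top[of "1::real"] by (rule eventually_filtercomapI)
    then have "eventually (\<lambda>\<tau>. norm (complex_of_real (ln (Im \<tau>))) \<le> 1 * norm (complex_of_real (exp (1 * Im \<tau>)))) (filtercomap Im at_top)"
    proof eventually_elim
      case (elim \<tau>)
      have "ln (Im \<tau>) \<le> Im \<tau>" using ln_le_minus_one[of "Im \<tau>"] elim by linarith
      also have "\<dots> \<le> exp (Im \<tau>)" using exp_ge_add_one_self[of "Im \<tau>"] by linarith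
      finally show ?case using elim by simp
    qed
    then have "(\<lambda>\<tau>. complex_of_real (ln (Im \<tau>))) \<in> O[filtercomap Im at_top](\<lambda>\<tau>. of_real (exp (1 * Im \<tau>)))"
      by (rule bigoI)
    with preharmonic_growth[OF P] show ?thesis unfolding F_def by (rule sum_in_bigo(2))
  qed
  show ?thesis
    unfolding sesquiharmonic_Maass_form_def
  proof (intro conjI ballI)
    show "smooth_on ?f upper_half_plane"
      by (rule smooth_on_cong[OF open_upper_half_plane f' smooth])
    show "modular_invariant 0 SL2Z ?f"
      unfolding modular_invariant_def
    proof (intro ballI)
      fix A \<tau> assume A: "A \<in> SL2Z" and "\<tau> \<in> upper_half_plane"
      then have v: "Im \<tau> > 0" by (simp add: upper_half_plane_def)
      show "?f (moebius A \<tau>) = automorphy A \<tau> powi 0 * ?f \<tau>"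
        using f[OF v] f[OF Im_moebius_pos[OF A v]] inv[OF A v] by simp
    qed
    show "linear_exponential_growth 0 ?f"
    proof (rule linear_exponential_growthI, intro exI conjI allI impI)
      fix A :: "int ^ 2 ^ 2" and \<tau> assume A: "A \<in> SL2Z" and v: "Im \<tau> > 0"
      show "?f (moebius A \<tau>) = automorphy A \<tau> powi 0 * F \<tau>"
        using f[OF Im_moebius_pos[OF A v]] inv[OF A v] by simp
    qed (rule growth)
  qed (rule D)
qed

text \<open>The existence of the limit is asserted separately because \<open>Lim\<close> by itself
  does not guarantee convergence.\<close>

theorem theorem1p6:
  fixes lam mu :: real and N :: nat
  assumes "lam \<in> \<rat>" and "mu \<in> \<rat>"
    and "N = (LEAST n::nat. n > 0 \<and> real n * lam \<in> \<int> \<and> real n * mu \<in> \<int>)"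
  shows "(\<forall>a\<ge>3. harmonic_Maass_form (2 - int a) (Gamma_congruence N)
            (\<lambda>\<tau>. Ecal_hat a (of_real lam * \<tau> + of_real mu) \<tau>)) \<and>
         (\<not> (lam \<in> \<int> \<and> mu \<in> \<int>) \<longrightarrow>
            harmonic_Maass_form 0 (Gamma_congruence N)
              (\<lambda>\<tau>. Ecal_hat 2 (of_real lam * \<tau> + of_real mu) \<tau>)) \<and>
         (lam \<in> \<int> \<and> mu \<in> \<int> \<longrightarrow>
            (\<forall>\<tau>\<in>upper_half_plane. \<exists>L.
               ((\<lambda>x::real. Ecal_hat 2 (of_real x) \<tau> + of_real (2 * ln \<bar>x\<bar> - ln (Im \<tau>)))
                  \<longlongrightarrow> L) (at_right 0)) \<and>
            sesquiharmonic_Maass_form 0 SL2Z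
              (\<lambda>\<tau>. Lim (at_right 0)
                 (\<lambda>x::real. Ecal_hat 2 (of_real x) \<tau> + of_real (2 * ln \<bar>x\<bar> - ln (Im \<tau>)))))"
proof -
  \<comment> \<open>The product of the denominators is a common multiple, so the minimum defining N
    is attained.\<close>
  have "\<exists>n::nat. n > 0 \<and> real n * lam \<in> \<int> \<and> real n * mu \<in> \<int>"
  proof -
    obtain a b :: int where ab: "b > 0" "lam = of_int a / of_int b" using assms(1) by (elim Rats_cases')
    obtain c d :: int where cd: "d > 0" "mu = of_int c / of_int d" using assms(2) by (elim Rats_cases')
    have "real (nat (b * d)) * lam = of_int (d * a)" "real (nat (b * d)) * mu = of_int (b * c)"
      using ab cd by (simp_all add: field_simps)
    then show ?thesis using ab cd by (intro exI[of _ "nat (b * d)"]) (auto simp del: of_int_mult)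
  qed
  from LeastI_ex[OF this] have N: "real N * lam \<in> \<int>" "real N * mu \<in> \<int>"
    unfolding assms(3) by auto
  have 1: "harmonic_Maass_form (2 - int a) (Gamma_congruence N) (\<lambda>\<tau>. Ecal_hat a (of_real lam * \<tau> + of_real mu) \<tau>)" if a3: "a \<ge> 3" for a
  proof -
    obtain n where a: "a = Suc n" "n \<ge> 2" using a3 by (cases a) auto
    show ?thesis unfolding a(1) using harmonic_Maass_form_Ecal_hat[of n lam mu N] a(2) N by simp
  qed
  have 2: "harmonic_Maass_form 0 (Gamma_congruence N) (\<lambda>\<tau>. Ecal_hat 2 (of_real lam * \<tau> + of_real mu) \<tau>)" if "\<not> (lam \<in> \<int> \<and> mu \<in> \<int>)"
    using harmonic_Maass_form_Ecal_hat[OF _ _ N, of 1] that by (simp add: numeral_2_eq_2)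
  show ?thesis
    using 1 2 Ecal_hat_2_regularized_limit sesquiharmonic_Maass_form_Ecal_hat_0
    by (auto simp: upper_half_plane_def)
qed

end
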